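(* Let $n\ge 1$, let $\xi_1<\dots<\xi_n<0<\xi_{n+1}<\dots<\xi_{2n}$ be real numbers, $\sigma=\mathrm{diag}(\xi_1,\dots,\xi_{2n})$, and consider the system $-i\,y'(x)+Q(x)y(x)=\lambda\sigma y(x)$, $x\ge 0$, where $Q$ is a measurable complex $2n\times 2n$ matrix function such that the system is $\mathcal M$-canonical and $\|Q(x)\|\le Ce^{-\varepsilon x}$ for $x\ge0$ with some constants $C,\varepsilon>0$. Let $H_1,H_2$ be invertible complex $n\times n$ matrices with $\det(H_1-H_2)\neq 0$, and let $S_{H_1}(\lambda),S_{H_2}(\lambda)$, $\lambda\in\mathbb R$, be the scattering matrices on the half-axis of this system corresponding to the boundary conditions $y_2(0,\lambda)=H_1y_1(0,\lambda)$ and $y_2(0,\lambda)=H_2y_1(0,\lambda)$, respectively. Suppose that, for each $k=1,2$, the Riemann–Hilbert problem with data $S_{H_k}$ is uniquely solvable. Then $Q$ is uniquely determined by $S_{H_1}$ and $S_{H_2}$; that is, if $\tilde Q$ is another potential for which the system (with the same $\sigma$) is $\mathcal M$-canonical, which satisfies a bound of the form $\|\tilde Q(x)\|\le \tilde Ce^{-\tilde\varepsilon x}$ with $\tilde C,\tilde\varepsilon>0$, and whose scattering matrices for $H_1$ and $H_2$ coincide with $S_{H_1}$ and $S_{H_2}$ on $\mathbb R$, then $\tilde Q=Q$ almost everywhere on $[0,\infty)$.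
   Context: Write $\sigma_1=\mathrm{diag}(\xi_1,\dots,\xi_n)$, $\sigma_2=\mathrm{diag}(\xi_{n+1},\dots,\xi_{2n})$, $y=\begin{bmatrix} y_1 \\ y_2 \end{bmatrix}$ with $y_1,y_2$ being $n$-dimensional, and $Q=\begin{bmatrix} q_{11} & q_{12} \\ q_{21} & q_{22} \end{bmatrix}$ with $n\times n$ blocks. $I$ is the $n\times n$ identity matrix. **$\mathcal M$-canonical.** The system is called $\mathcal M$-canonical if $q_{11}$ is strictly lower triangular ($[q_{11}]_{kj}=0$ for $j\ge k$), $q_{12}$ is lower anti-triangular ($[q_{12}]_{kj}=0$ for $k+j\le n$), $q_{21}$ is upper anti-triangular ($[q_{21}]_{kj}=0$ for $k+j\ge n+2$), and $q_{22}$ is strictly upper triangular ($[q_{22}]_{kj}=0$ for $j\le k$). **Transformation kernels.** For an $\mathcal M$-canonical system with exponentially decaying $Q$, let $A_{ij}(x,t)$, $t\ge x\ge 0$, $i,j=1,2$, be the $n\times n$ matrix kernels with $A_{11}$ lower triangular, $A_{12}$ lower anti-triangular, $A_{21}$ upper anti-triangular, $A_{22}$ upper triangular, that form the unique bounded solution of the following system (equations for the entries allowed to be nonzero by these patterns; $[qA]_{kj}(s,\tau)$ means $[q(s)A(s,\tau)]_{kj}$; in the equations for $A_{11}$ and $A_{22}$ with $k=j$ the first, non-integral term is absent and the upper limit of integration is $+\infty$): $$[A_{11}(x,t)]_{kj}=\tfrac{i\xi_j}{\xi_j-\xi_k}[q_{11}]_{kj}\!\left(x+\tfrac{\xi_j}{\xi_j-\xi_k}(t-x)\right)+i\int_x^{x+\frac{\xi_j}{\xi_j-\xi_k}(t-x)}[q_{11}A_{11}+q_{12}A_{21}]_{kj}\!\left(s,t+\tfrac{\xi_k}{\xi_j}(s-x)\right)ds,$$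 $$[A_{21}(x,t)]_{kj}=\tfrac{i\xi_j}{\xi_j-\xi_{n+k}}[q_{21}]_{kj}\!\left(x+\tfrac{\xi_j}{\xi_j-\xi_{n+k}}(t-x)\right)+i\int_x^{x+\frac{\xi_j}{\xi_j-\xi_{n+k}}(t-x)}[q_{21}A_{11}+q_{22}A_{21}]_{kj}\!\left(s,t+\tfrac{\xi_{n+k}}{\xi_j}(s-x)\right)ds,$$ $$[A_{12}(x,t)]_{kj}=\tfrac{i\xi_{n+j}}{\xi_{n+j}-\xi_k}[q_{12}]_{kj}\!\left(x+\tfrac{\xi_{n+j}}{\xi_{n+j}-\xi_k}(t-x)\right)+i\int_x^{x+\frac{\xi_{n+j}}{\xi_{n+j}-\xi_k}(t-x)}[q_{12}A_{22}+q_{11}A_{12}]_{kj}\!\left(s,t+\tfrac{\xi_k}{\xi_{n+j}}(s-x)\right)ds,$$ $$[A_{22}(x,t)]_{kj}=\tfrac{i\xi_{n+j}}{\xi_{n+j}-\xi_{n+k}}[q_{22}]_{kj}\!\left(x+\tfrac{\xi_{n+j}}{\xi_{n+j}-\xi_{n+k}}(t-x)\right)+i\int_x^{x+\frac{\xi_{n+j}}{\xi_{n+j}-\xi_{n+k}}(t-x)}[q_{21}A_{12}+q_{22}A_{22}]_{kj}\!\left(s,t+\tfrac{\xi_{n+k}}{\xi_{n+j}}(s-x)\right)ds.$$ For real $\lambda$ every bounded solution $y$ of the system has the form $y_1(x,\lambda)=e^{i\lambda\sigma_1x}A+\int_x^\infty A_{11}(x,t)e^{i\lambda\sigma_1t}A\,dt+\int_x^\infty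 A_{12}(x,t)e^{i\lambda\sigma_2t}B\,dt$, $y_2(x,\lambda)=e^{i\lambda\sigma_2x}B+\int_x^\infty A_{21}(x,t)e^{i\lambda\sigma_1t}A\,dt+\int_x^\infty A_{22}(x,t)e^{i\lambda\sigma_2t}B\,dt$ with $A,B\in\mathbb C^n$. **Scattering matrix.** Put $A_{k1-}(\lambda)=\int_0^\infty A_{k1}(0,t)e^{i\lambda\sigma_1t}dt$, $A_{k2+}(\lambda)=\int_0^\infty A_{k2}(0,t)e^{i\lambda\sigma_2t}dt$ ($k=1,2$), and for an invertible $n\times n$ matrix $H$ $$A_{H+}(\lambda)=A_{22+}(\lambda)-HA_{12+}(\lambda),\qquad A_{H-}(\lambda)=HA_{11-}(\lambda)H^{-1}-A_{21-}(\lambda)H^{-1}.$$ The scattering matrix on the half-axis with boundary condition $y_2(0,\lambda)=Hy_1(0,\lambda)$ is $S_H(\lambda)=[I+A_{H+}(\lambda)]^{-1}[I+A_{H-}(\lambda)]$, $\lambda\in\mathbb R$. **Riemann–Hilbert problem.** By definition of $S_H$, the relation $$[I+A_{H+}(\lambda)]S_H(\lambda)=I+A_{H-}(\lambda),\qquad \lambda\in\mathbb R,$$ holds. The Riemann–Hilbert problem with data $S_H$ (contour: the real axis; canonical normalization) is this relation, with $S_H$ regarded as known, for the unknown $n\times n$ matrix functions $A_{H+}(\lambda)$ and $A_{H-}(\lambda)$, which are analytic in the upper and lower complex $\lambda$-plane respectively, satisfy $A_{H\pm}(\infty)=0$, and have entries in $\mathfrak S^{+}$ and $\mathfrak S^{-}$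 respectively. Here $\mathfrak S^{\pm}$ is the set of functions of the form $\lambda\mapsto\int_0^{+\infty}f(x)e^{\pm i\lambda x}dx$, $\lambda\in\mathbb R$, with $f$ continuous and $f\in L_1$. The problem is uniquely solvable if the matrices $A_{H+}(\lambda)$ and $A_{H-}(\lambda)$ are uniquely determined from $S_H(\lambda)$ in the domains in which they are analytic. *)

theory Defs
  imports "HOL-Analysis.Analysis" "Jordan_Normal_Form.Jordan_Normal_Form"
begin

(* Matrix indices are 0-based: xi 0 < ... < xi (2n-1) are the diagonal entries of sigma, and
   sigma_1, sigma_2 carry xi k and xi (n + k) for k < n.  The library names mat and det
   are qualified because HOL-Analysis uses them for matrices with type-level dimensions. *)

definition ordered_speeds :: "nat \<Rightarrow> (nat \<Rightarrow> real) \<Rightarrow> bool" where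
  "ordered_speeds n \<xi> \<longleftrightarrow>
     strict_mono_on {..<2*n} \<xi> \<and> (\<forall>k<n. \<xi> k < 0) \<and> (\<forall>k<n. 0 < \<xi> (n + k))"

definition block :: "nat \<Rightarrow> nat \<Rightarrow> nat \<Rightarrow> complex mat \<Rightarrow> complex mat" where
  "block n a b M = Matrix.mat n n (\<lambda>(k, j). M $$ (a * n + k, b * n + j))"

abbreviation q11 :: "nat \<Rightarrow> (real \<Rightarrow> complex mat) \<Rightarrow> real \<Rightarrow> complex mat" where
  "q11 n Q x \<equiv> block n 0 0 (Q x)"
abbreviation q12 :: "nat \<Rightarrow> (real \<Rightarrow> complex mat) \<Rightarrow> real \<Rightarrow> complex mat" where
  "q12 n Q x \<equiv> block n 0 1 (Q x)"
abbreviation q21 :: "nat \<Rightarrow> (real \<Rightarrow> complex mat) \<Rightarrow> real \<Rightarrow> complex mat" where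
  "q21 n Q x \<equiv> block n 1 0 (Q x)"
abbreviation q22 :: "nat \<Rightarrow> (real \<Rightarrow> complex mat) \<Rightarrow> real \<Rightarrow> complex mat" where
  "q22 n Q x \<equiv> block n 1 1 (Q x)"

definition strictly_lower_tri :: "nat \<Rightarrow> complex mat \<Rightarrow> bool" where
  "strictly_lower_tri n M \<longleftrightarrow> (\<forall>k<n. \<forall>j<n. k \<le> j \<longrightarrow> M $$ (k, j) = 0)"

definition strictly_upper_tri :: "nat \<Rightarrow> complex mat \<Rightarrow> bool" where
  "strictly_upper_tri n M \<longleftrightarrow> (\<forall>k<n. \<forall>j<n. j \<le> k \<longrightarrow> M $$ (k, j) = 0)"

definition lower_tri :: "nat \<Rightarrow> complex mat \<Rightarrow> bool" where
  "lower_tri n M \<longleftrightarrow> (\<forall>k<n. \<forall>j<n. k < j \<longrightarrow> M $$ (k, j) = 0)"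

definition upper_tri :: "nat \<Rightarrow> complex mat \<Rightarrow> bool" where
  "upper_tri n M \<longleftrightarrow> (\<forall>k<n. \<forall>j<n. j < k \<longrightarrow> M $$ (k, j) = 0)"

(* In 1-based indices these two read k + j <= n and k + j >= n + 2, respectively. *)
definition lower_anti_tri :: "nat \<Rightarrow> complex mat \<Rightarrow> bool" where
  "lower_anti_tri n M \<longleftrightarrow> (\<forall>k<n. \<forall>j<n. Suc k + Suc j \<le> n \<longrightarrow> M $$ (k, j) = 0)"

definition upper_anti_tri :: "nat \<Rightarrow> complex mat \<Rightarrow> bool" where
  "upper_anti_tri n M \<longleftrightarrow> (\<forall>k<n. \<forall>j<n. n + 2 \<le> Suc k + Suc j \<longrightarrow> M $$ (k, j) = 0)"

definition M_canonical :: "nat \<Rightarrow> (real \<Rightarrow> complex mat) \<Rightarrow> bool" where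
  "M_canonical n Q \<longleftrightarrow> (\<forall>x\<ge>0.
     strictly_lower_tri n (q11 n Q x) \<and> lower_anti_tri n (q12 n Q x) \<and>
     upper_anti_tri n (q21 n Q x) \<and> strictly_upper_tri n (q22 n Q x))"

definition measurable_potential :: "nat \<Rightarrow> (real \<Rightarrow> complex mat) \<Rightarrow> bool" where
  "measurable_potential n Q \<longleftrightarrow>
     (\<forall>x\<ge>0. Q x \<in> carrier_mat (2*n) (2*n)) \<and>
     (\<forall>k<2*n. \<forall>j<2*n. (\<lambda>x. Q x $$ (k, j)) \<in> borel_measurable (lebesgue_on {0..}))"

(* norm_bound is the library's entrywise (maximum norm) bound; as C is arbitrary, any other
   matrix norm gives the same condition. *)
definition exp_decaying :: "(real \<Rightarrow> complex mat) \<Rightarrow> bool" where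
  "exp_decaying Q \<longleftrightarrow>
     (\<exists>C>0. \<exists>\<epsilon>>0. \<forall>x\<ge>0. norm_bound (Q x) (C * exp (- \<epsilon> * x)))"

(* The common form of the integral equations for the kernel entries a = [A(x,t)]_kj: mu and nu are
   the diagonal entries of sigma belonging to the row and the column, q is the matching entry of Q,
   and F s tau is the entry of the product of Q and the kernels at (s,tau).
   mu = nu happens exactly for the diagonal entries of the diagonal blocks. *)
definition kernel_entry_eq ::
  "real \<Rightarrow> real \<Rightarrow> (real \<Rightarrow> complex) \<Rightarrow> (real \<Rightarrow> real \<Rightarrow> complex) \<Rightarrow> real \<Rightarrow> real \<Rightarrow> complex \<Rightarrow> bool" where
  "kernel_entry_eq \<mu> \<nu> q F x t a \<longleftrightarrow>
     (let u = x + \<nu> / (\<nu> - \<mu>) * (t - x);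
          J = (if \<mu> = \<nu> then {x..} else {x..u});
          G = (\<lambda>s. F s (t + \<mu> / \<nu> * (s - x)))
      in set_integrable lebesgue J G \<and>
         a = (if \<mu> = \<nu> then 0 else \<i> * of_real (\<nu> / (\<nu> - \<mu>)) * q u)
             + \<i> * (LINT s:J|lebesgue. G s))"

(* The bounded solution of the system of kernel equations on 0 <= x <= t.  Measurability in t is
   what the integrals of the kernels over t in the transformation formulas presuppose. *)
definition transformation_kernels ::
  "nat \<Rightarrow> (nat \<Rightarrow> real) \<Rightarrow> (real \<Rightarrow> complex mat) \<Rightarrow>
   (real \<Rightarrow> real \<Rightarrow> complex mat) \<Rightarrow> (real \<Rightarrow> real \<Rightarrow> complex mat) \<Rightarrow>
   (real \<Rightarrow> real \<Rightarrow> complex mat) \<Rightarrow> (real \<Rightarrow> real \<Rightarrow> complex mat) \<Rightarrow> bool" where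
  "transformation_kernels n \<xi> Q A11 A12 A21 A22 \<longleftrightarrow>
     (\<forall>A\<in>{A11, A12, A21, A22}.
        (\<forall>x t. 0 \<le> x \<and> x \<le> t \<longrightarrow> A x t \<in> carrier_mat n n) \<and>
        (\<exists>M. \<forall>x t. 0 \<le> x \<and> x \<le> t \<longrightarrow> norm_bound (A x t) M) \<and>
        (\<forall>x\<ge>0. \<forall>k<n. \<forall>j<n. (\<lambda>t. A x t $$ (k, j)) \<in> borel_measurable (lebesgue_on {x..}))) \<and>
     (\<forall>x t. 0 \<le> x \<and> x \<le> t \<longrightarrow>
        lower_tri n (A11 x t) \<and> lower_anti_tri n (A12 x t) \<and>
        upper_anti_tri n (A21 x t) \<and> upper_tri n (A22 x t) \<and>
        (\<forall>k<n. \<forall>j<n. j \<le> k \<longrightarrow>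
           kernel_entry_eq (\<xi> k) (\<xi> j) (\<lambda>s. q11 n Q s $$ (k, j))
             (\<lambda>s \<tau>. (q11 n Q s * A11 s \<tau> + q12 n Q s * A21 s \<tau>) $$ (k, j)) x t (A11 x t $$ (k, j))) \<and>
        (\<forall>k<n. \<forall>j<n. Suc k + Suc j \<le> n + 1 \<longrightarrow>
           kernel_entry_eq (\<xi> (n + k)) (\<xi> j) (\<lambda>s. q21 n Q s $$ (k, j))
             (\<lambda>s \<tau>. (q21 n Q s * A11 s \<tau> + q22 n Q s * A21 s \<tau>) $$ (k, j)) x t (A21 x t $$ (k, j))) \<and>
        (\<forall>k<n. \<forall>j<n. n + 1 \<le> Suc k + Suc j \<longrightarrow>
           kernel_entry_eq (\<xi> k) (\<xi> (n + j)) (\<lambda>s. q12 n Q s $$ (k, j))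
             (\<lambda>s \<tau>. (q12 n Q s * A22 s \<tau> + q11 n Q s * A12 s \<tau>) $$ (k, j)) x t (A12 x t $$ (k, j))) \<and>
        (\<forall>k<n. \<forall>j<n. k \<le> j \<longrightarrow>
           kernel_entry_eq (\<xi> (n + k)) (\<xi> (n + j)) (\<lambda>s. q22 n Q s $$ (k, j))
             (\<lambda>s \<tau>. (q21 n Q s * A12 s \<tau> + q22 n Q s * A22 s \<tau>) $$ (k, j)) x t (A22 x t $$ (k, j))))"

(* The integral over t >= 0 of A(0,t) exp(i lam diag(eta) t). *)
definition kernel_transform ::
  "nat \<Rightarrow> (nat \<Rightarrow> real) \<Rightarrow> (real \<Rightarrow> real \<Rightarrow> complex mat) \<Rightarrow> real \<Rightarrow> complex mat" where
  "kernel_transform n \<eta> A lam = Matrix.mat n n (\<lambda>(k, j).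
     LINT t:{0..}|lebesgue.
       (A 0 t * mat_diag n (\<lambda>l. exp (\<i> * of_real (lam * \<eta> l * t)))) $$ (k, j))"

abbreviation mat_inv :: "complex mat \<Rightarrow> complex mat" where
  "mat_inv M \<equiv> the (mat_inverse M)"

definition A_H_plus ::
  "nat \<Rightarrow> (nat \<Rightarrow> real) \<Rightarrow> complex mat \<Rightarrow> (real \<Rightarrow> real \<Rightarrow> complex mat) \<Rightarrow>
   (real \<Rightarrow> real \<Rightarrow> complex mat) \<Rightarrow> real \<Rightarrow> complex mat" where
  "A_H_plus n \<xi> H A12 A22 lam =
     kernel_transform n (\<lambda>l. \<xi> (n + l)) A22 lam - H * kernel_transform n (\<lambda>l. \<xi> (n + l)) A12 lam"

definition A_H_minus ::
  "nat \<Rightarrow> (nat \<Rightarrow> real) \<Rightarrow> complex mat \<Rightarrow> (real \<Rightarrow> real \<Rightarrow> complex mat) \<Rightarrow>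
   (real \<Rightarrow> real \<Rightarrow> complex mat) \<Rightarrow> real \<Rightarrow> complex mat" where
  "A_H_minus n \<xi> H A11 A21 lam =
     H * kernel_transform n \<xi> A11 lam * mat_inv H - kernel_transform n \<xi> A21 lam * mat_inv H"

(* S is the scattering matrix S_H of the system with potential Q; this includes that S_H is
   defined at every real lam, i.e. that the matrix to be inverted is invertible there. *)
definition scattering_matrix ::
  "nat \<Rightarrow> (nat \<Rightarrow> real) \<Rightarrow> (real \<Rightarrow> complex mat) \<Rightarrow> complex mat \<Rightarrow> (real \<Rightarrow> complex mat) \<Rightarrow> bool" where
  "scattering_matrix n \<xi> Q H S \<longleftrightarrow>
     (\<exists>A11 A12 A21 A22. transformation_kernels n \<xi> Q A11 A12 A21 A22 \<and>
        (\<forall>lam. invertible_mat (1\<^sub>m n + A_H_plus n \<xi> H A12 A22 lam) \<and>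
               S lam = mat_inv (1\<^sub>m n + A_H_plus n \<xi> H A12 A22 lam)
                       * (1\<^sub>m n + A_H_minus n \<xi> H A11 A21 lam)))"

(* The classes S^+ (sg = 1) and S^- (sg = -1). *)
definition half_line_transforms :: "real \<Rightarrow> (real \<Rightarrow> complex) set" where
  "half_line_transforms sg = {g. \<exists>f :: real \<Rightarrow> complex.
     continuous_on {0..} f \<and> set_integrable lebesgue {0..} f \<and>
     (\<forall>lam. g lam = (LINT x:{0..}|lebesgue. f x * exp (\<i> * of_real (sg * lam * x))))}"

(* Unknowns of the Riemann-Hilbert problem, for the upper (sg = 1) and the lower (sg = -1)
   half-plane.  Continuity up to the real axis ties the values on the axis, which enter the
   relation of the problem, to the analytic function in the open half-plane. *)
definition rh_unknown :: "nat \<Rightarrow> real \<Rightarrow> (complex \<Rightarrow> complex mat) \<Rightarrow> bool" where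
  "rh_unknown n sg X \<longleftrightarrow>
     (\<forall>z. 0 \<le> sg * Im z \<longrightarrow> X z \<in> carrier_mat n n) \<and>
     (\<forall>k<n. \<forall>j<n.
        (\<lambda>z. X z $$ (k, j)) holomorphic_on {z. 0 < sg * Im z} \<and>
        continuous_on {z. 0 \<le> sg * Im z} (\<lambda>z. X z $$ (k, j)) \<and>
        ((\<lambda>z. X z $$ (k, j)) \<longlongrightarrow> 0) (inf at_infinity (principal {z. 0 \<le> sg * Im z})) \<and>
        (\<lambda>lam. X (of_real lam) $$ (k, j)) \<in> half_line_transforms sg)"

definition rh_solution ::
  "nat \<Rightarrow> (real \<Rightarrow> complex mat) \<Rightarrow> (complex \<Rightarrow> complex mat) \<Rightarrow> (complex \<Rightarrow> complex mat) \<Rightarrow> bool" where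
  "rh_solution n S Xp Xm \<longleftrightarrow> rh_unknown n 1 Xp \<and> rh_unknown n (-1) Xm \<and>
     (\<forall>lam::real. (1\<^sub>m n + Xp (of_real lam)) * S lam = 1\<^sub>m n + Xm (of_real lam))"

definition rh_uniquely_solvable :: "nat \<Rightarrow> (real \<Rightarrow> complex mat) \<Rightarrow> bool" where
  "rh_uniquely_solvable n S \<longleftrightarrow>
     (\<exists>Xp Xm. rh_solution n S Xp Xm) \<and>
     (\<forall>Xp Xm Yp Ym. rh_solution n S Xp Xm \<and> rh_solution n S Yp Ym \<longrightarrow>
        (\<forall>z. 0 < Im z \<longrightarrow> Xp z = Yp z) \<and> (\<forall>z. Im z < 0 \<longrightarrow> Xm z = Ym z))"

end

theory Submission
  imports Defs "HOL-Complex_Analysis.Complex_Analysis" "HOL-Probability.Levy" "HOL-Real_Asymp.Real_Asymp"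
begin

text \<open>
  The integral equations say that along a characteristic the kernel entry with row speed
  \<open>\<xi> r\<close> and column speed \<open>\<xi> c\<close> changes by the integral of \<open>Q A\<close>, and that it starts on the
  diagonal \<open>t = x\<close> with a multiple of the corresponding entry of \<open>Q\<close>. Iterating them from infinity
  gives uniqueness and exponential decay of the kernels.

  The Riemann--Hilbert problem is posed for transforms of \<^emph>\<open>continuous\<close> functions, while \<open>A(0, t)\<close> is
  only measurable. Uniqueness extends to the larger class: let \<open>A\<^sub>\<plusminus>\<close> be one solution there and
  \<open>Y\<^sub>\<plusminus>\<close> its difference to another one, and choose \<open>z\<^sub>0\<close> in the lower half-plane with \<open>I + A\<^sub>-(z\<^sub>0)\<close>
  invertible and a matrix \<open>c\<close> with \<open>c (I + A\<^sub>-(z\<^sub>0)) = Y\<^sub>-(z\<^sub>0)\<close>. Then \<open>(Y\<^sub>\<plusminus> - c (I + A\<^sub>\<plusminus>)) / (z - z\<^sub>0)\<close>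
  solves the homogeneous problem, and dividing by \<open>z - z\<^sub>0\<close> makes the underlying functions continuous.
  So it vanishes, and letting \<open>z\<close> tend to infinity gives \<open>c = 0\<close> and \<open>Y\<^sub>\<plusminus> = 0\<close>.

  Hence \<open>A\<^sub>H\<^sub>\<plusminus>\<close> are determined for \<open>H = H1\<close> and \<open>H = H2\<close>. As \<open>H1 - H2\<close> is invertible, this
  determines the transforms of all four kernels at \<open>x = 0\<close> and, by Fourier uniqueness, \<open>A(0, t)\<close> for
  almost every \<open>t\<close>. Integrating the equations along characteristics from \<open>x = 0\<close> instead of from the
  diagonal turns them into a Volterra system for the differences of the kernels and of the potentials
  with zero initial data.
\<close>

text \<open>The equations promise only bounded kernels, while the scattering matrices involve their
  transforms at every real \<lambda>. Turning boundedness into decay like exp (- \<delta> t) makes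
  these transforms genuine integrals and, the decay being exponential, holomorphic slightly beyond
  the real axis, so continuity up to the axis comes for free. Each \<open>scattering_matrix\<close>
  assumption brings its own existentially bound kernels. Uniqueness of the kernels is what allows
  the relations for \<open>H1\<close> and \<open>H2\<close> to be combined. In the Riemann--Hilbert
  step the pole of 1 / (z - z0) is harmless in the upper half-plane. In the lower one it must be
  removable, which is what the choice of c achieves; a left factor c respects the relation because S
  stands on the right. In the final step the term with the potential depends only on the
  characteristic, not on the point chosen on it. Subtracting the equations at two points of one
  characteristic removes it, and the equation at x = 0 alone expresses it by an integral over a
  bounded range.\<close>

section \<open>The kernel equations along characteristics\<close>

text \<open>The \<open>s\<close>-range of the characteristic of slope \<open>\<kappa>\<close> through \<open>(x, t)\<close> before it leaves the wedge
  \<open>s \<le> \<tau>\<close>; for \<open>\<kappa> = 1\<close> it never does, which is the case of the diagonal entries.\<close>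

definition ray :: "real \<Rightarrow> real \<Rightarrow> real \<Rightarrow> real set" where
  "ray \<kappa> x t = {s. x \<le> s \<and> s \<le> t + \<kappa> * (s - x)}"

lemma ray_eq:
  assumes "\<kappa> \<le> 1" "x \<le> t"
  shows "ray \<kappa> x t = (if \<kappa> = 1 then {x..} else {x..x + (t - x) / (1 - \<kappa>)})"
proof (cases "\<kappa> = 1")
  case True then show ?thesis using assms by (auto simp: ray_def)
next
  case False
  then have k: "1 - \<kappa> > 0" using assms by simp
  have "s \<le> t + \<kappa> * (s - x) \<longleftrightarrow> s \<le> x + (t - x) / (1 - \<kappa>)" for s
  proof -
    have "s \<le> x + (t - x) / (1 - \<kappa>) \<longleftrightarrow> (s - x) \<le> (t - x) / (1 - \<kappa>)" by auto
    also have "\<dots> \<longleftrightarrow> (s - x) * (1 - \<kappa>) \<le> t - x" using k by (simp add: pos_le_divide_eq)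
    also have "\<dots> \<longleftrightarrow> s \<le> t + \<kappa> * (s - x)" by (simp add: algebra_simps)
    finally show ?thesis by simp
  qed
  then have "ray \<kappa> x t = {x..x + (t - x) / (1 - \<kappa>)}"
    unfolding ray_def atLeastAtMost_def atLeast_def atMost_def by blast
  then show ?thesis using False by simp
qed

text \<open>Dividing by \<nu> leaves the single parameter \<kappa> = \<mu> / \<nu>, the slope of the
  characteristic, and \<nu> / (\<nu> - \<mu>) is 1 / (1 - \<kappa>). The half-line and the bounded
  interval of integration thereby become one set.\<close>

lemma kernel_entry_eq_iff_ray:
  assumes "\<nu> \<noteq> 0" "\<mu> / \<nu> \<le> 1" "x \<le> t"
  shows "kernel_entry_eq \<mu> \<nu> q F x t a \<longleftrightarrow>
     set_integrable lebesgue (ray (\<mu> / \<nu>) x t) (\<lambda>s. F s (t + \<mu> / \<nu> * (s - x))) \<and>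
     a = (if \<mu> = \<nu> then 0
              else \<i> * of_real (1 / (1 - \<mu> / \<nu>)) * q (x + (t - x) / (1 - \<mu> / \<nu>)))
             + \<i> * (LINT s:ray (\<mu> / \<nu>) x t|lebesgue. F s (t + \<mu> / \<nu> * (s - x)))"
proof -
  have e: "\<mu> / \<nu> = 1 \<longleftrightarrow> \<mu> = \<nu>" using assms(1) by (auto simp: divide_eq_1_iff)
  have "1 - \<mu> / \<nu> = (\<nu> - \<mu>) / \<nu>" using assms(1) by (simp add: diff_divide_distrib)
  then have r: "\<nu> / (\<nu> - \<mu>) = 1 / (1 - \<mu> / \<nu>)" by simp
  have J: "(if \<mu> = \<nu> then {x..} else {x..x + \<nu> / (\<nu> - \<mu>) * (t - x)}) = ray (\<mu> / \<nu>) x t"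
    unfolding ray_eq[OF assms(2,3)] e r by simp
  show ?thesis
    unfolding kernel_entry_eq_def Let_def J unfolding r times_divide_eq_left mult_1_left ..
qed

text \<open>Integrands are sampled only on the ray, which stays inside 0 \<le> s \<le> \<tau>. The
  kernels are controlled only in this wedge: outside it the matrices may have wrong dimensions, so
  that entries of products mean nothing there.\<close>

lemma kernel_entry_eq_cong:
  assumes "kernel_entry_eq \<mu> \<nu> q F x t a"
    and "\<nu> \<noteq> 0" "\<mu> / \<nu> \<le> 1" "0 \<le> x" "x \<le> t"
    and "\<And>s \<tau>. 0 \<le> s \<Longrightarrow> s \<le> \<tau> \<Longrightarrow> F s \<tau> = G s \<tau>"
  shows "kernel_entry_eq \<mu> \<nu> q G x t a"
proof -
  let ?J = "ray (\<mu> / \<nu>) x t"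
  have FG: "F s (t + \<mu> / \<nu> * (s - x)) = G s (t + \<mu> / \<nu> * (s - x))" if "s \<in> ?J" for s
    using that assms(4) unfolding ray_def by (intro assms(6)) auto
  have "set_integrable lebesgue ?J (\<lambda>s. F s (t + \<mu> / \<nu> * (s - x))) \<longleftrightarrow>
        set_integrable lebesgue ?J (\<lambda>s. G s (t + \<mu> / \<nu> * (s - x)))"
    by (rule set_integrable_cong) (simp_all only: FG)
  moreover have "?J \<in> sets lebesgue" unfolding ray_eq[OF assms(3,5)] by simp
  then have "(LINT s:?J|lebesgue. F s (t + \<mu> / \<nu> * (s - x))) =
        (LINT s:?J|lebesgue. G s (t + \<mu> / \<nu> * (s - x)))"
    by (rule set_lebesgue_integral_cong) (use FG in blast)
  ultimately show ?thesis
    using assms(1) unfolding kernel_entry_eq_iff_ray[OF assms(2,3,5)] by (simp only:)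
qed

section \<open>Merging the four block systems into one\<close>

text \<open>With the second block in reverse order all patterns become lower triangular: an entry \<open>(r, c)\<close>
  of the kernels may be nonzero only if \<open>level n c \<le> level n r\<close>.\<close>

definition level :: "nat \<Rightarrow> nat \<Rightarrow> nat" where
  "level n r = (if r < n then r else 2 * n - 1 - r)"

text \<open>Where the pattern allows an entry, the speeds of row and column have opposite signs, so
  the ratio is negative, or equal signs with the column speed at least as large in modulus. Hence no
  slope exceeds 1, and slope 1 occurs only on the diagonal.\<close>

lemma speed_ratio:
  assumes "ordered_speeds n \<xi>" "r < 2 * n" "c < 2 * n" "level n c \<le> level n r"
  shows "\<xi> c \<noteq> 0" "\<xi> r / \<xi> c \<le> 1" "\<xi> r = \<xi> c \<longleftrightarrow> r = c"
proof -
  have sm: "strict_mono_on {..<2*n} \<xi>" and neg: "\<And>k. k < n \<Longrightarrow> \<xi> k < 0"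
    and pos: "\<And>k. n \<le> k \<Longrightarrow> k < 2 * n \<Longrightarrow> 0 < \<xi> k"
    using assms(1) unfolding ordered_speeds_def by (auto simp: nat_le_iff_add)
  show nz: "\<xi> c \<noteq> 0" using neg[of c] pos[of c] assms(3) by (cases "c < n") auto
  show "\<xi> r = \<xi> c \<longleftrightarrow> r = c"
    using strict_mono_on_imp_inj_on[OF sm] assms(2,3) by (auto simp: inj_on_def)
  have mono: "\<xi> i \<le> \<xi> j" if "i \<le> j" "j < 2 * n" for i j
    using strict_mono_on_leD[OF sm, of i j] that by auto
  show "\<xi> r / \<xi> c \<le> 1"
  proof (cases "c < n")
    case True
    note c = this
    have "\<xi> c \<le> \<xi> r"
    proof (cases "r < n")
      case True then show ?thesis using assms c by (intro mono) (auto simp: level_def)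
    next
      case False then show ?thesis using pos[of r] neg[of c] c assms by auto
    qed
    moreover have "\<xi> c < 0" using neg c .
    ultimately show ?thesis by (simp add: divide_le_eq_1_neg)
  next
    case False
    note c = this
    have "\<xi> r \<le> \<xi> c"
    proof (cases "r < n")
      case True then show ?thesis using pos[of c] neg[of r] c assms by auto
    next
      case False then show ?thesis using assms c by (intro mono) (auto simp: level_def)
    qed
    moreover have "\<xi> c > 0" using pos[of c] c assms(3) by simp
    ultimately show ?thesis by (simp add: divide_le_eq_1_pos)
  qed
qed

text \<open>Numbering rows and columns through both blocks turns the sums of block products into one
  sum over m < 2 n. Measurability is recorded at x = 0, where the kernels are transformed.\<close>

definition full_kernels ::
  "nat \<Rightarrow> (nat \<Rightarrow> real) \<Rightarrow> (real \<Rightarrow> complex mat) \<Rightarrow> (nat \<Rightarrow> nat \<Rightarrow> real \<Rightarrow> real \<Rightarrow> complex) \<Rightarrow> bool"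
where
  "full_kernels n \<xi> Q a \<longleftrightarrow>
     (\<exists>M. \<forall>r<2*n. \<forall>c<2*n. \<forall>x t. 0 \<le> x \<and> x \<le> t \<longrightarrow> norm (a r c x t) \<le> M) \<and>
     (\<forall>r<2*n. \<forall>c<2*n. a r c 0 \<in> borel_measurable (lebesgue_on {0..})) \<and>
     (\<forall>r<2*n. \<forall>c<2*n. \<forall>x t. 0 \<le> x \<and> x \<le> t \<longrightarrow>
        (if level n c \<le> level n r
         then kernel_entry_eq (\<xi> r) (\<xi> c) (\<lambda>s. Q s $$ (r, c))
                (\<lambda>s \<tau>. \<Sum>m<2*n. Q s $$ (r, m) * a m c s \<tau>) x t (a r c x t)
         else a r c x t = 0))"

lemma full_kernels_ray:
  assumes "ordered_speeds n \<xi>" "full_kernels n \<xi> Q a" "r < 2 * n" "c < 2 * n"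
    "level n c \<le> level n r" "0 \<le> x" "x \<le> t"
  defines "\<kappa> \<equiv> \<xi> r / \<xi> c"
  shows "set_integrable lebesgue (ray \<kappa> x t) (\<lambda>s. \<Sum>m<2*n. Q s $$ (r, m) * a m c s (t + \<kappa> * (s - x)))"
    and "a r c x t = (if r = c then 0
              else \<i> * of_real (1 / (1 - \<kappa>)) * Q (x + (t - x) / (1 - \<kappa>)) $$ (r, c))
             + \<i> * (LINT s:ray \<kappa> x t|lebesgue. \<Sum>m<2*n. Q s $$ (r, m) * a m c s (t + \<kappa> * (s - x)))"
proof -
  have "kernel_entry_eq (\<xi> r) (\<xi> c) (\<lambda>s. Q s $$ (r, c))
                (\<lambda>s \<tau>. \<Sum>m<2*n. Q s $$ (r, m) * a m c s \<tau>) x t (a r c x t)"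
    using assms(2)[unfolded full_kernels_def, THEN conjunct2, THEN conjunct2, rule_format,
        OF assms(3,4) conjI[OF assms(6,7)]] assms(5) by (simp only: if_True)
  note * = this[unfolded kernel_entry_eq_iff_ray[OF speed_ratio(1,2)[OF assms(1,3,4,5)] assms(7)]]
  show "set_integrable lebesgue (ray \<kappa> x t) (\<lambda>s. \<Sum>m<2*n. Q s $$ (r, m) * a m c s (t + \<kappa> * (s - x)))"
    unfolding \<kappa>_def by (rule *[THEN conjunct1])
  show "a r c x t = (if r = c then 0
              else \<i> * of_real (1 / (1 - \<kappa>)) * Q (x + (t - x) / (1 - \<kappa>)) $$ (r, c))
             + \<i> * (LINT s:ray \<kappa> x t|lebesgue. \<Sum>m<2*n. Q s $$ (r, m) * a m c s (t + \<kappa> * (s - x)))"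
    using *[THEN conjunct2] unfolding \<kappa>_def speed_ratio(3)[OF assms(1,3,4,5)] .
qed

definition block_entry ::
  "nat \<Rightarrow> (real \<Rightarrow> real \<Rightarrow> complex mat) \<Rightarrow> (real \<Rightarrow> real \<Rightarrow> complex mat) \<Rightarrow>
   (real \<Rightarrow> real \<Rightarrow> complex mat) \<Rightarrow> (real \<Rightarrow> real \<Rightarrow> complex mat) \<Rightarrow>
   nat \<Rightarrow> nat \<Rightarrow> real \<Rightarrow> real \<Rightarrow> complex" where
  "block_entry n A11 A12 A21 A22 r c x t =
     (if r < n then if c < n then A11 x t $$ (r, c) else A12 x t $$ (r, c - n)
      else if c < n then A21 x t $$ (r - n, c) else A22 x t $$ (r - n, c - n))"

lemma sum_double:
  fixes f :: "nat \<Rightarrow> 'a::comm_monoid_add"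
  shows "(\<Sum>m<2*n. f m) = (\<Sum>m<n. f m) + (\<Sum>m<n. f (n + m))"
proof -
  have "{..<2*n} = {..<n} \<union> {n..<n+n}" by auto
  then have "(\<Sum>m<2*n. f m) = (\<Sum>m<n. f m) + (\<Sum>m\<in>{n..<n+n}. f m)"
    using sum.union_disjoint[of "{..<n}" "{n..<n+n}" f] by (simp add: ivl_disj_int)
  also have "(\<Sum>m\<in>{n..<n+n}. f m) = (\<Sum>m<n. f (n + m))"
    using sum.shift_bounds_nat_ivl[of f 0 n n] by (simp add: add.commute lessThan_atLeast0)
  finally show ?thesis .
qed

lemma block_product_entry:
  assumes "k < n" "j < n" "B \<in> carrier_mat n n" "C \<in> carrier_mat n n"
  shows "(block n a b M * B + block n a b' M * C) $$ (k, j) =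
    (\<Sum>m<n. M $$ (a * n + k, b * n + m) * B $$ (m, j)) + (\<Sum>m<n. M $$ (a * n + k, b' * n + m) * C $$ (m, j))"
  using assms by (simp add: block_def scalar_prod_def lessThan_atLeast0)

lemma norm_boundD: "norm_bound A b \<Longrightarrow> A \<in> carrier_mat p q \<Longrightarrow> i < p \<Longrightarrow> j < q \<Longrightarrow> norm (A $$ (i, j)) \<le> b"
  by (auto simp: norm_bound_def)

lemma full_kernels_block_entry:
  assumes "ordered_speeds n \<xi>" "transformation_kernels n \<xi> Q A11 A12 A21 A22"
  shows "full_kernels n \<xi> Q (block_entry n A11 A12 A21 A22)" (is "full_kernels n \<xi> Q ?a")
proof -
  note T = assms(2)[unfolded transformation_kernels_def]
  define \<A> where "\<A> = {A11, A12, A21, A22}"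
  have car: "A x t \<in> carrier_mat n n" if "A \<in> \<A>" "0 \<le> x" "x \<le> t" for A x t
    using T that unfolding \<A>_def by blast
  have "\<forall>A\<in>\<A>. \<exists>M. \<forall>x t. 0 \<le> x \<and> x \<le> t \<longrightarrow> norm_bound (A x t) M"
    using T unfolding \<A>_def by blast
  then obtain Mf where Mf: "\<And>A x t. A \<in> \<A> \<Longrightarrow> 0 \<le> x \<Longrightarrow> x \<le> t \<Longrightarrow> norm_bound (A x t) (Mf A)"
    by metis
  define M where "M = Max (Mf ` \<A>)"
  have M: "norm (A x t $$ (k, j)) \<le> M" if "A \<in> \<A>" "0 \<le> x" "x \<le> t" "k < n" "j < n" for A x t k j
  proof -
    have "Mf A \<le> M" unfolding M_def using that by (intro Max_ge) (auto simp: \<A>_def)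
    then show ?thesis
      using norm_boundD[OF Mf[OF that(1-3)] car[OF that(1-3)] that(4,5)] by simp
  qed
  have meas: "(\<lambda>t. A 0 t $$ (k, j)) \<in> borel_measurable (lebesgue_on {0..})"
    if "A \<in> \<A>" "k < n" "j < n" for A k j
  proof -
    have "\<forall>x\<ge>0. \<forall>k<n. \<forall>j<n. (\<lambda>t. A x t $$ (k, j)) \<in> borel_measurable (lebesgue_on {x..})"
      using T that(1) unfolding \<A>_def by blast
    then show ?thesis using that(2,3) by simp
  qed
  have in\<A>: "A11 \<in> \<A>" "A12 \<in> \<A>" "A21 \<in> \<A>" "A22 \<in> \<A>" unfolding \<A>_def by auto
  note T2 = T[THEN conjunct2, rule_format]
  show ?thesis unfolding full_kernels_def
  proof (intro conjI allI impI)
    show "\<exists>M. \<forall>r<2*n. \<forall>c<2*n. \<forall>x t. 0 \<le> x \<and> x \<le> t \<longrightarrow> norm (?a r c x t) \<le> M"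
      by (intro exI[of _ M] allI impI) (auto simp: block_entry_def intro!: M in\<A>)
  next
    fix r c assume "r < 2 * n" "c < 2 * n"
    then show "?a r c 0 \<in> borel_measurable (lebesgue_on {0..})"
      unfolding block_entry_def
      by (cases "r < n"; cases "c < n") (auto intro!: meas in\<A>)
  next
    fix r c x t assume rc: "r < 2 * n" "c < 2 * n" and xt: "0 \<le> x \<and> x \<le> (t::real)"
    note K = T2[OF xt]
    note Kd = K[THEN conjunct2, THEN conjunct2, THEN conjunct2, THEN conjunct2]
    note K11 = Kd[THEN conjunct1, rule_format]
      and K21 = Kd[THEN conjunct2, THEN conjunct1, rule_format]
      and K12 = Kd[THEN conjunct2, THEN conjunct2, THEN conjunct1, rule_format]
      and K22 = Kd[THEN conjunct2, THEN conjunct2, THEN conjunct2, rule_format]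
    have tri: "lower_tri n (A11 x t)" "lower_anti_tri n (A12 x t)"
      "upper_anti_tri n (A21 x t)" "upper_tri n (A22 x t)" using K by blast+
    define f where "f = (\<lambda>s \<tau>. \<Sum>m<2*n. Q s $$ (r, m) * ?a m c s \<tau>)"
    note cong = kernel_entry_eq_cong[OF _ _ _ conjunct1[OF xt] conjunct2[OF xt]]
    have "kernel_entry_eq (\<xi> r) (\<xi> c) (\<lambda>s. Q s $$ (r, c)) f x t (?a r c x t)"
      if p: "level n c \<le> level n r"
    proof -
      note sr = speed_ratio[OF \<open>ordered_speeds n \<xi>\<close> rc p]
      have p11: "\<lbrakk>r = k; c = j\<rbrakk> \<Longrightarrow> (q11 n Q s * A11 s \<tau> + q12 n Q s * A21 s \<tau>) $$ (k, j) = f s \<tau>"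
        and p21: "\<lbrakk>r = n + k; c = j\<rbrakk> \<Longrightarrow> (q21 n Q s * A11 s \<tau> + q22 n Q s * A21 s \<tau>) $$ (k, j) = f s \<tau>"
        and p12: "\<lbrakk>r = k; c = n + j\<rbrakk> \<Longrightarrow> (q12 n Q s * A22 s \<tau> + q11 n Q s * A12 s \<tau>) $$ (k, j) = f s \<tau>"
        and p22: "\<lbrakk>r = n + k; c = n + j\<rbrakk> \<Longrightarrow> (q21 n Q s * A12 s \<tau> + q22 n Q s * A22 s \<tau>) $$ (k, j) = f s \<tau>"
        if "k < n" "j < n" "0 \<le> s" "s \<le> \<tau>" for k j s \<tau>
        unfolding f_def sum_double
        using block_product_entry[OF that(1,2) car[OF in\<A>(1) that(3,4)] car[OF in\<A>(3) that(3,4)], of 0 0 "Q s" 1]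
          block_product_entry[OF that(1,2) car[OF in\<A>(1) that(3,4)] car[OF in\<A>(3) that(3,4)], of 1 0 "Q s" 1]
          block_product_entry[OF that(1,2) car[OF in\<A>(4) that(3,4)] car[OF in\<A>(2) that(3,4)], of 0 1 "Q s" 0]
          block_product_entry[OF that(1,2) car[OF in\<A>(2) that(3,4)] car[OF in\<A>(4) that(3,4)], of 1 0 "Q s" 1]
          that(1,2)
        by (simp_all add: block_entry_def add.commute del: index_add_mat)
      \<comment> \<open>The four patterns in 0-based global indices. For the upper right block the
        1-based condition k + j \<ge> n + 1 becomes r + c + 1 \<ge> 2 n because c is shifted by
        n.\<close>
      have "(r < n \<and> c < n \<and> c \<le> r) \<or> (r < n \<and> n \<le> c \<and> 2 * n \<le> r + c + 1)
          \<or> (n \<le> r \<and> c < n \<and> r + c + 1 \<le> 2 * n) \<or> (n \<le> r \<and> n \<le> c \<and> r \<le> c)"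
        using p rc by (auto simp: level_def split: if_splits)
      then consider (ll) "r < n" "c < n" "c \<le> r" | (lu) "r < n" "n \<le> c" "2 * n \<le> r + c + 1"
        | (ul) "n \<le> r" "c < n" "r + c + 1 \<le> 2 * n" | (uu) "n \<le> r" "n \<le> c" "r \<le> c"
        by blast
      then show ?thesis
      proof cases
        case ll
        have "kernel_entry_eq (\<xi> r) (\<xi> c) (\<lambda>s. q11 n Q s $$ (r, c))
             (\<lambda>s \<tau>. (q11 n Q s * A11 s \<tau> + q12 n Q s * A21 s \<tau>) $$ (r, c)) x t (A11 x t $$ (r, c))"
          by (rule K11) (use ll in auto)
        then have "kernel_entry_eq (\<xi> r) (\<xi> c) (\<lambda>s. q11 n Q s $$ (r, c)) f x t (A11 x t $$ (r, c))"
          by (rule cong[OF _ _ _ p11]) (use ll sr in simp_all)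
        then show ?thesis using ll by (simp add: block_def block_entry_def)
      next
        case lu
        define j where "j = c - n"
        have j: "c = n + j" "j < n" using lu rc by (auto simp: j_def)
        have "kernel_entry_eq (\<xi> r) (\<xi> (n + j)) (\<lambda>s. q12 n Q s $$ (r, j))
             (\<lambda>s \<tau>. (q12 n Q s * A22 s \<tau> + q11 n Q s * A12 s \<tau>) $$ (r, j)) x t (A12 x t $$ (r, j))"
          by (rule K12) (use lu j in auto)
        then have "kernel_entry_eq (\<xi> r) (\<xi> (n + j)) (\<lambda>s. q12 n Q s $$ (r, j)) f x t (A12 x t $$ (r, j))"
          by (rule cong[OF _ _ _ p12]) (use lu j sr in simp_all)
        then show ?thesis using lu j by (simp add: block_def block_entry_def)
      next
        case ul
        define k where "k = r - n"
        have k: "r = n + k" "k < n" using ul rc by (auto simp: k_def)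
        have "kernel_entry_eq (\<xi> (n + k)) (\<xi> c) (\<lambda>s. q21 n Q s $$ (k, c))
             (\<lambda>s \<tau>. (q21 n Q s * A11 s \<tau> + q22 n Q s * A21 s \<tau>) $$ (k, c)) x t (A21 x t $$ (k, c))"
          by (rule K21) (use ul k in auto)
        then have "kernel_entry_eq (\<xi> (n + k)) (\<xi> c) (\<lambda>s. q21 n Q s $$ (k, c)) f x t (A21 x t $$ (k, c))"
          by (rule cong[OF _ _ _ p21]) (use ul k sr in simp_all)
        then show ?thesis using ul k by (simp add: block_def block_entry_def)
      next
        case uu
        define k where "k = r - n"
        define j where "j = c - n"
        have kj: "r = n + k" "k < n" "c = n + j" "j < n" using uu rc by (auto simp: k_def j_def)
        have "kernel_entry_eq (\<xi> (n + k)) (\<xi> (n + j)) (\<lambda>s. q22 n Q s $$ (k, j))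
             (\<lambda>s \<tau>. (q21 n Q s * A12 s \<tau> + q22 n Q s * A22 s \<tau>) $$ (k, j)) x t (A22 x t $$ (k, j))"
          by (rule K22) (use uu kj in auto)
        then have "kernel_entry_eq (\<xi> (n + k)) (\<xi> (n + j)) (\<lambda>s. q22 n Q s $$ (k, j)) f x t (A22 x t $$ (k, j))"
          by (rule cong[OF _ _ _ p22]) (use uu kj sr in simp_all)
        then show ?thesis using uu kj by (simp add: block_def block_entry_def)
      qed
    qed
    moreover have "?a r c x t = 0" if "\<not> level n c \<le> level n r"
    proof -
      have "(r < n \<and> c < n \<and> r < c) \<or> (r < n \<and> n \<le> c \<and> Suc r + Suc (c - n) \<le> n)
          \<or> (n \<le> r \<and> c < n \<and> n + 2 \<le> Suc (r - n) + Suc c) \<or> (n \<le> r \<and> n \<le> c \<and> c - n < r - n)"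
        using that rc unfolding level_def by (cases "r < n"; cases "c < n") auto
      then show ?thesis
        using tri rc
        unfolding lower_tri_def lower_anti_tri_def upper_anti_tri_def upper_tri_def block_entry_def
        by (elim disjE conjE) simp_all
    qed
    ultimately show "if level n c \<le> level n r then kernel_entry_eq (\<xi> r) (\<xi> c) (\<lambda>s. Q s $$ (r, c))
                (\<lambda>s \<tau>. \<Sum>m<2*n. Q s $$ (r, m) * ?a m c s \<tau>) x t (?a r c x t)
         else ?a r c x t = 0"
      unfolding f_def by simp
  qed
qed

section \<open>Decay and uniqueness of the kernels\<close>

lemma has_bochner_integral_lebesgueI:
  fixes f :: "real \<Rightarrow> 'b::{banach, second_countable_topology}"
  assumes "has_bochner_integral lborel f I"
  shows "has_bochner_integral lebesgue f I"
proof -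
  have "f \<in> borel_measurable lborel" using assms by (rule has_bochner_integral_iff[THEN iffD1, THEN conjunct1, THEN borel_measurable_integrable])
  from integrable_completion[OF this] integral_completion[OF this] show ?thesis
    using assms by (simp add: has_bochner_integral_iff)
qed

text \<open>For a nonnegative integrand, integrability over the half-line comes together with the
  limit of an antiderivative.\<close>

lemma has_bochner_integral_FTC_Ici_nonneg:
  fixes F g :: "real \<Rightarrow> real"
  assumes "g \<in> borel_measurable borel"
    and "\<And>s. x \<le> s \<Longrightarrow> DERIV F s :> g s" "\<And>s. x \<le> s \<Longrightarrow> 0 \<le> g s" "(F \<longlongrightarrow> T) at_top"
  shows "has_bochner_integral lborel (\<lambda>s. indicator {x..} s * g s) (T - F x)"
proof (rule has_bochner_integral_nn_integral)
  show "(\<lambda>s. indicator {x..} s * g s) \<in> borel_measurable lborel" using assms(1) by simp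
  show "AE s in lborel. 0 \<le> indicator {x..} s * g s" using assms(3) by (auto simp: indicator_def)
  have "(\<integral>\<^sup>+ s. ennreal (indicator {x..} s * g s) \<partial>lborel) = (\<integral>\<^sup>+ s. ennreal (g s) * indicator {x..} s \<partial>lborel)"
    by (intro nn_integral_cong) (auto simp: indicator_def)
  also have "\<dots> = ennreal (T - F x)"
    by (rule nn_integral_FTC_atLeast[OF assms(1,2,3,4)])
  finally show "(\<integral>\<^sup>+ s. ennreal (indicator {x..} s * g s) \<partial>lborel) = ennreal (T - F x)" .
  have mono: "F x \<le> F s" if "x \<le> s" for s
    by (rule DERIV_nonneg_imp_nondecreasing[OF that]) (use assms(2,3) in blast)
  have "F x \<le> T"
    by (rule tendsto_lowerbound[OF assms(4)]) (auto intro: eventually_at_top_linorderI mono)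
  then show "0 \<le> T - F x" by simp
qed

text \<open>The majorant is integrated over the whole line and not over J, so one closed formula
  serves rays of every slope.\<close>

lemma norm_set_integral_le:
  fixes G :: "real \<Rightarrow> complex"
  assumes "set_integrable M J G" "has_bochner_integral M g I"
    and "AE s in M. s \<in> J \<longrightarrow> norm (G s) \<le> g s" "\<And>s. 0 \<le> g s"
  shows "norm (LINT s:J|M. G s) \<le> I"
proof -
  have "norm (LINT s:J|M. G s) \<le> (LINT s|M. norm (indicator J s *\<^sub>R G s))"
    unfolding set_lebesgue_integral_def by (rule integral_norm_bound)
  also have "\<dots> \<le> (LINT s|M. g s)"
  proof (rule integral_mono_AE)
    show "integrable M (\<lambda>s. norm (indicator J s *\<^sub>R G s))"
      using assms(1) unfolding set_integrable_def by (rule integrable_norm)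
    show "integrable M g" using assms(2) by (simp add: has_bochner_integral_iff)
    show "AE s in M. norm (indicator J s *\<^sub>R G s) \<le> g s"
      using assms(3) by eventually_elim (use assms(4) in \<open>auto simp: indicator_def\<close>)
  qed
  also have "\<dots> = I" using assms(2) by (simp add: has_bochner_integral_iff)
  finally show ?thesis .
qed

text \<open>An abstract column of kernels. The decay rate of \<open>q\<close> is written as 2 *
  \<eta> because it is spent twice: one \<eta> keeps the integrals over s convergent, the other pays
  for the change of exp (- \<delta> * \<tau>) along the characteristic, whence the condition on
  \<kappa>. With \<delta> > 0 the result is decay, with B = \<delta> = 0 it is uniqueness.\<close>

context
  fixes N :: nat and D :: "nat \<Rightarrow> real \<Rightarrow> real \<Rightarrow> complex" and q :: "nat \<Rightarrow> nat \<Rightarrow> real \<Rightarrow> complex"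
    and B C K \<delta> \<eta> :: real
  assumes K: "\<And>r x t. r < N \<Longrightarrow> 0 \<le> x \<Longrightarrow> x \<le> t \<Longrightarrow> norm (D r x t) \<le> K" "0 \<le> K"
    and q: "\<And>r m s. r < N \<Longrightarrow> m < N \<Longrightarrow> 0 \<le> s \<Longrightarrow> norm (q r m s) \<le> C * exp (- (2 * \<eta>) * s)" "0 \<le> C"
    and pos: "0 < \<eta>" "0 \<le> B" "0 \<le> \<delta>"
    and eq: "\<And>r x t. r < N \<Longrightarrow> 0 \<le> x \<Longrightarrow> x \<le> t \<Longrightarrow> D r x t = 0 \<or>
        (\<exists>\<kappa>. \<delta> * \<bar>\<kappa>\<bar> \<le> \<eta> \<and>
          set_integrable lebesgue (ray \<kappa> x t) (\<lambda>s. \<Sum>m<N. q r m s * D m s (t + \<kappa> * (s - x))) \<and>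
          norm (D r x t) \<le> B * exp (- \<delta> * t) +
            norm (LINT s:ray \<kappa> x t|lebesgue. \<Sum>m<N. q r m s * D m s (t + \<kappa> * (s - x))))"
begin

text \<open>The coefficients of a row add up to at most N * C * exp (- \<eta> * s) = \<eta> * y s =
  - y' s, so a Picard step amounts to integrating the bound with respect to y from 0 to y x. The
  exponential part reproduces itself, since its integral b * exp (y x) - b is completed by the
  inhomogeneous term b; the a priori bound K acquires the factorial.\<close>

lemma volterra_iterate_bound:
  assumes "r < N" "0 \<le> x" "x \<le> t"
  defines "y \<equiv> \<lambda>s. real N * C / \<eta> * exp (- \<eta> * s)"
  shows "norm (D r x t) \<le> B * exp (- \<delta> * t) * exp (y x) + K * y x ^ m / fact m"
  using assms(1-3)
proof (induction m arbitrary: r x t)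
  case 0
  have "0 \<le> B * exp (- \<delta> * t) * exp (y x)" using pos by simp
  then show ?case using K(1)[OF 0] by simp
next
  case (Suc m)
  define b where "b = B * exp (- \<delta> * t)"
  have b: "0 \<le> b" using pos by (simp add: b_def)
  have y: "0 \<le> y s" for s using pos q(2) by (simp add: y_def)
  consider "D r x t = 0" | \<kappa> where "\<delta> * \<bar>\<kappa>\<bar> \<le> \<eta>"
      "set_integrable lebesgue (ray \<kappa> x t) (\<lambda>s. \<Sum>m<N. q r m s * D m s (t + \<kappa> * (s - x)))"
      "norm (D r x t) \<le> b +
            norm (LINT s:ray \<kappa> x t|lebesgue. \<Sum>m<N. q r m s * D m s (t + \<kappa> * (s - x)))"
    using eq[OF Suc.prems] unfolding b_def by blast
  then show ?case
  proof cases
    case 1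
    then show ?thesis using b y K(2) unfolding b_def by simp
  next
    case 2
    define g where "g s = \<eta> * y s * (b * exp (y s) + K * y s ^ m / fact m)" for s
    \<comment> \<open>An antiderivative of \<open>g\<close> because y' = - \<eta> * y. Its limit at
      infinity is - b, since y tends to 0.\<close>
    define F where "F s = - (b * exp (y s) + K * y s ^ Suc m / fact (Suc m))" for s
    have dy: "DERIV y s :> - \<eta> * y s" for s
      unfolding y_def by (auto intro!: derivative_eq_intros)
    have ylim: "(y \<longlongrightarrow> 0) at_top"
      unfolding y_def using pos(1) by real_asymp
    have g0: "0 \<le> g s" for s unfolding g_def using b y[of s] K(2) pos(1) by simp
    have int: "has_bochner_integral lebesgue (\<lambda>s. indicator {x..} s * g s) (- b - F x)"
    proof (rule has_bochner_integral_lebesgueI, rule has_bochner_integral_FTC_Ici_nonneg)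
      show "g \<in> borel_measurable borel" unfolding g_def y_def by measurable
      show "DERIV F s :> g s" for s
        unfolding F_def g_def
        by (rule derivative_eq_intros dy refl | simp add: field_simps del: fact_Suc of_nat_Suc)+
           (simp add: field_simps)
      show "(F \<longlongrightarrow> - b) at_top"
        unfolding F_def by (rule tendsto_eq_intros ylim refl | simp)+
    qed (rule g0)
    have bound: "norm (\<Sum>m<N. q r m s * D m s (t + \<kappa> * (s - x))) \<le> g s"
      if s: "s \<in> ray \<kappa> x t" for s
    proof -
      have s: "x \<le> s" "s \<le> t + \<kappa> * (s - x)" "0 \<le> s" using s Suc.prems by (auto simp: ray_def)
      have "\<delta> * \<bar>\<kappa>\<bar> * (s - x) \<le> \<eta> * s"
        using 2(1) s Suc.prems pos by (intro mult_mono) auto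
      \<comment> \<open>For \<kappa> < 0 the height \<tau> falls below t and the weight grows; the
        loss is at most exp (\<delta> * \<bar>\<kappa>\<bar> * (s - x)).\<close>
      moreover have "- (\<delta> * \<kappa> * (s - x)) \<le> \<delta> * \<bar>\<kappa>\<bar> * (s - x)"
      proof -
        have "- \<kappa> * (\<delta> * (s - x)) \<le> \<bar>\<kappa>\<bar> * (\<delta> * (s - x))"
          using s pos by (intro mult_right_mono) auto
        then show ?thesis by (simp add: algebra_simps)
      qed
      ultimately have "- (2 * \<eta>) * s + - \<delta> * (t + \<kappa> * (s - x)) \<le> - \<eta> * s + - \<delta> * t"
        by (simp add: algebra_simps)
      then have e1: "exp (- (2 * \<eta>) * s) * exp (- \<delta> * (t + \<kappa> * (s - x))) \<le> exp (- \<eta> * s) * exp (- \<delta> * t)"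
        unfolding exp_add[symmetric] by simp
      have e2: "exp (- (2 * \<eta>) * s) \<le> exp (- \<eta> * s)" using pos s by simp
      have "norm (\<Sum>m<N. q r m s * D m s (t + \<kappa> * (s - x))) \<le>
        (\<Sum>j<N. C * exp (- \<eta> * s) * (b * exp (y s) + K * y s ^ m / fact m))"
      proof (rule sum_norm_le)
        fix j assume "j \<in> {..<N}"
        then have "norm (q r j s * D j s (t + \<kappa> * (s - x))) \<le>
          (C * exp (- (2 * \<eta>) * s)) *
          (B * exp (- \<delta> * (t + \<kappa> * (s - x))) * exp (y s) + K * y s ^ m / fact m)"
          unfolding norm_mult using Suc.prems s q(2)
          by (intro mult_mono q(1) Suc.IH) auto
        also have "\<dots> = C * B * exp (y s) * (exp (- (2 * \<eta>) * s) * exp (- \<delta> * (t + \<kappa> * (s - x))))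
          + C * (K * y s ^ m / fact m) * exp (- (2 * \<eta>) * s)"
          by (simp only: algebra_simps)
        also have "\<dots> \<le> C * B * exp (y s) * (exp (- \<eta> * s) * exp (- \<delta> * t))
          + C * (K * y s ^ m / fact m) * exp (- \<eta> * s)"
          using q(2) pos K(2) y[of s] by (intro add_mono mult_left_mono e1 e2) auto
        also have "\<dots> = C * exp (- \<eta> * s) * (b * exp (y s) + K * y s ^ m / fact m)"
          unfolding b_def by (simp only: algebra_simps)
        finally show "norm (q r j s * D j s (t + \<kappa> * (s - x))) \<le>
          C * exp (- \<eta> * s) * (b * exp (y s) + K * y s ^ m / fact m)" .
      qed
      also have "\<dots> = g s" unfolding g_def using pos by (simp add: y_def)
      finally show ?thesis .
    qed
    have "norm (LINT s:ray \<kappa> x t|lebesgue. \<Sum>m<N. q r m s * D m s (t + \<kappa> * (s - x))) \<le> - b - F x"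
    proof (rule norm_set_integral_le[OF 2(2) int])
      show "AE s in lebesgue. s \<in> ray \<kappa> x t \<longrightarrow>
        norm (\<Sum>m<N. q r m s * D m s (t + \<kappa> * (s - x))) \<le> indicator {x..} s * g s"
        using bound by (intro AE_I2) (auto simp: ray_def)
    qed (use g0 in auto)
    then show ?thesis using 2(3) unfolding F_def b_def by simp
  qed
qed

lemma volterra_exp_bound:
  assumes "r < N" "0 \<le> x" "x \<le> t"
  shows "norm (D r x t) \<le> B * exp (real N * C / \<eta>) * exp (- \<delta> * t)"
proof -
  let ?y = "real N * C / \<eta> * exp (- \<eta> * x)"
  have "(\<lambda>m. B * exp (- \<delta> * t) * exp ?y + K * (?y ^ m / fact m)) \<longlonglongrightarrow> B * exp (- \<delta> * t) * exp ?y + K * 0"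
    using summable_LIMSEQ_zero[OF summable_exp[of ?y]]
    by (intro tendsto_intros) (simp add: divide_inverse mult.commute)
  then have "norm (D r x t) \<le> B * exp (- \<delta> * t) * exp ?y"
    using volterra_iterate_bound[OF assms] by (intro LIMSEQ_le_const) auto
  also have "?y \<le> real N * C / \<eta>"
    using q(2) pos assms by (intro mult_left_le) auto
  then have "B * exp (- \<delta> * t) * exp ?y \<le> B * exp (- \<delta> * t) * exp (real N * C / \<eta>)"
    using pos by (intro mult_left_mono) auto
  finally show ?thesis by (simp add: mult_ac)
qed

end

text \<open>The parameter telling which characteristic of a second family passes through a point is
  affine in s. A null set of bad characteristics is therefore met for almost no s.\<close>

lemma AE_lebesgue_affine:
  fixes P :: "real \<Rightarrow> bool"
  assumes "AE x in lebesgue. P x" "c \<noteq> 0"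
  shows "AE x in lebesgue. P (t + c * x)"
proof -
  have "AE x in lborel. P x" using assms(1) by (simp add: AE_completion_iff)
  then obtain N where N: "{x. \<not> P x} \<subseteq> N" "emeasure lborel N = 0" "N \<in> sets lborel"
    by (auto elim: AE_E)
  then have "AE x in lborel. x \<notin> N" by (intro AE_not_in) (simp add: null_sets_def)
  moreover have "Measurable.pred borel (\<lambda>x. x \<notin> N)" using N(3) by simp
  ultimately have "AE x in lborel. t + c * x \<notin> N"
    using AE_borel_affine[OF assms(2), of "\<lambda>x. x \<notin> N" t] by simp
  then have "AE x in lborel. P (t + c * x)" by eventually_elim (use N(1) in blast)
  then show ?thesis by (simp add: AE_completion_iff)
qed

section \<open>Bounds uniform in the entries\<close>

lemma finite_double_bound:
  fixes f :: "nat \<Rightarrow> nat \<Rightarrow> real"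
  obtains L where "0 \<le> L" "\<And>r c. r < N \<Longrightarrow> c < N \<Longrightarrow> f r c \<le> L"
proof
  let ?S = "insert 0 ((\<lambda>(r, c). f r c) ` ({..<N} \<times> {..<N}))"
  show "0 \<le> Max ?S" by (intro Max_ge) auto
  show "f r c \<le> Max ?S" if "r < N" "c < N" for r c
    using that by (intro Max_ge) auto
qed

lemma potential_exp_bound:
  assumes "measurable_potential n Q" "exp_decaying Q"
  obtains C \<epsilon> where "0 < C" "0 < \<epsilon>"
    "\<And>r c x. r < 2 * n \<Longrightarrow> c < 2 * n \<Longrightarrow> 0 \<le> x \<Longrightarrow> norm (Q x $$ (r, c)) \<le> C * exp (- \<epsilon> * x)"
proof -
  from assms(2) obtain C \<epsilon> where "0 < C" "0 < \<epsilon>"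
    and b: "\<And>x. 0 \<le> x \<Longrightarrow> norm_bound (Q x) (C * exp (- \<epsilon> * x))"
    unfolding exp_decaying_def by blast
  moreover have "norm (Q x $$ (r, c)) \<le> C * exp (- \<epsilon> * x)"
    if "r < 2 * n" "c < 2 * n" "0 \<le> x" for r c x
    by (rule norm_boundD[OF b[OF that(3)] _ that(1,2)])
       (use assms(1) that in \<open>simp add: measurable_potential_def\<close>)
  ultimately show thesis using that by blast
qed

lemma full_kernels_outside:
  assumes "full_kernels n \<xi> Q a" "r < 2 * n" "c < 2 * n" "0 \<le> x" "x \<le> t" "\<not> level n c \<le> level n r"
  shows "a r c x t = 0"
  using assms(1)[unfolded full_kernels_def, THEN conjunct2, THEN conjunct2, rule_format,
      OF assms(2,3) conjI[OF assms(4,5)]] assms(6) by simp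

lemma full_kernels_bounded:
  assumes "full_kernels n \<xi> Q a"
  obtains M where "0 \<le> M"
    "\<And>r c x t. r < 2 * n \<Longrightarrow> c < 2 * n \<Longrightarrow> 0 \<le> x \<Longrightarrow> x \<le> t \<Longrightarrow> norm (a r c x t) \<le> M"
proof -
  from assms[unfolded full_kernels_def, THEN conjunct1] obtain M where
    M: "\<forall>r<2*n. \<forall>c<2*n. \<forall>x t. 0 \<le> x \<and> x \<le> t \<longrightarrow> norm (a r c x t) \<le> M" ..
  show thesis
  proof (rule that[of "max M 0"])
    fix r c and x t :: real
    assume "r < 2 * n" "c < 2 * n" "0 \<le> x" "x \<le> t"
    then show "norm (a r c x t) \<le> max M 0" using M by (simp add: le_max_iff_disj)
  qed simp
qed

text \<open>Decay of Q at the diagonal point u of a characteristic has to become decay in t. Slopes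
  are at least - L1, so u is at least t / (1 + L1), and a fixed fraction of the rate
  survives.\<close>

lemma full_kernels_exp_bound:
  assumes os: "ordered_speeds n \<xi>" and fk: "full_kernels n \<xi> Q a"
    and mp: "measurable_potential n Q" and ed: "exp_decaying Q"
  obtains B \<delta> where "0 \<le> B" "0 < \<delta>"
    "\<And>r c x t. r < 2 * n \<Longrightarrow> c < 2 * n \<Longrightarrow> 0 \<le> x \<Longrightarrow> x \<le> t \<Longrightarrow> norm (a r c x t) \<le> B * exp (- \<delta> * t)"
proof -
  obtain C \<epsilon> where C: "0 < C" "0 < \<epsilon>"
    and Q: "\<And>r c x. r < 2 * n \<Longrightarrow> c < 2 * n \<Longrightarrow> 0 \<le> x \<Longrightarrow> norm (Q x $$ (r, c)) \<le> C * exp (- \<epsilon> * x)"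
    using potential_exp_bound[OF mp ed] by blast
  obtain M where M: "0 \<le> M"
    "\<And>r c x t. r < 2 * n \<Longrightarrow> c < 2 * n \<Longrightarrow> 0 \<le> x \<Longrightarrow> x \<le> t \<Longrightarrow> norm (a r c x t) \<le> M"
    by (rule full_kernels_bounded[OF fk]) (rule that)
  obtain L1 where L1: "0 \<le> L1" "\<And>r c. r < 2 * n \<Longrightarrow> c < 2 * n \<Longrightarrow> \<bar>\<xi> r / \<xi> c\<bar> \<le> L1"
    using finite_double_bound[of "2 * n" "\<lambda>r c. \<bar>\<xi> r / \<xi> c\<bar>"] by blast
  obtain L2 where L2: "0 \<le> L2" "\<And>r c. r < 2 * n \<Longrightarrow> c < 2 * n \<Longrightarrow> \<bar>1 / (1 - \<xi> r / \<xi> c)\<bar> \<le> L2"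
    using finite_double_bound[of "2 * n" "\<lambda>r c. \<bar>1 / (1 - \<xi> r / \<xi> c)\<bar>"] by blast
  \<comment> \<open>Meets both demands on the rate: \<delta> * L1 \<le> \<epsilon> / 2 for the
    integral term and \<delta> * t \<le> \<epsilon> * u for the term with Q. The iteration is run
    with \<eta> = \<epsilon> / 2.\<close>
  define \<delta> where "\<delta> = \<epsilon> / (2 * (1 + L1))"
  have L1': "0 < 1 + L1" using L1(1) by simp
  have \<delta>2: "\<delta> * (1 + L1) = \<epsilon> / 2" unfolding \<delta>_def using L1' by (simp del: distrib_left_numeral)
  have "0 < \<delta>" unfolding \<delta>_def using C(2) L1' by simp
  with \<delta>2 have \<delta>: "0 < \<delta>" "\<delta> * L1 \<le> \<epsilon> / 2" unfolding distrib_left by simp_all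
  have bound: "norm (a r c x t) \<le> L2 * C * exp (real (2 * n) * C / (\<epsilon> / 2)) * exp (- \<delta> * t)"
    if rcx: "r < 2 * n" "c < 2 * n" "0 \<le> x" "x \<le> t" for r c x t
  proof (rule volterra_exp_bound[where D = "\<lambda>r. a r c" and q = "\<lambda>r m s. Q s $$ (r, m)" and K = M
        and N = "2 * n" and r = r and x = x and \<delta> = \<delta>])
    fix r x t assume r: "r < 2 * n" "0 \<le> x" "x \<le> (t::real)"
    let ?F = "\<lambda>\<kappa> s. \<Sum>m<2*n. Q s $$ (r, m) * a m c s (t + \<kappa> * (s - x))"
    show "a r c x t = 0 \<or>
        (\<exists>\<kappa>. \<delta> * \<bar>\<kappa>\<bar> \<le> \<epsilon> / 2 \<and>
          set_integrable lebesgue (ray \<kappa> x t) (\<lambda>s. ?F \<kappa> s) \<and>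
          norm (a r c x t) \<le> L2 * C * exp (- \<delta> * t) +
            norm (LINT s:ray \<kappa> x t|lebesgue. ?F \<kappa> s))"
    proof (cases "level n c \<le> level n r")
      case False
      then show ?thesis
        using full_kernels_outside[OF fk r(1) rcx(2) r(2,3)] by simp
    next
      case True
      define \<kappa> where "\<kappa> = \<xi> r / \<xi> c"
      define G where "G = (\<lambda>s. ?F \<kappa> s)"
      note E = full_kernels_ray[OF os fk r(1) rcx(2) True r(2,3), folded \<kappa>_def, folded G_def]
      have \<kappa>: "\<bar>\<kappa>\<bar> \<le> L1" "\<bar>1 / (1 - \<kappa>)\<bar> \<le> L2"
        using L1(2)[OF r(1) rcx(2)] L2(2)[OF r(1) rcx(2)] unfolding \<kappa>_def .
      have \<kappa>1: "\<kappa> < 1" if "r \<noteq> c"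
        using speed_ratio[OF os r(1) rcx(2) True] that unfolding \<kappa>_def less_le
        by (simp add: eq_divide_eq_1 divide_eq_1_iff del: right_minus_eq)
      have head: "norm (if r = c then 0 else \<i> * of_real (1 / (1 - \<kappa>)) * Q (x + (t - x) / (1 - \<kappa>)) $$ (r, c))
          \<le> L2 * C * exp (- \<delta> * t)"
      proof (cases "r = c")
        case True then show ?thesis using L2(1) C by simp
      next
        case False
        define u where "u = x + (t - x) / (1 - \<kappa>)"
        have k: "0 < 1 - \<kappa>" "1 - \<kappa> \<le> 1 + L1" using \<kappa>(1) \<kappa>1[OF False] by auto
        have "(t - x) / (1 + L1) \<le> (t - x) / (1 - \<kappa>)" using r k by (intro divide_left_mono) auto
        moreover have "x / (1 + L1) \<le> x" using r L1(1) by (simp add: divide_le_eq mult_le_cancel_left1)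
        ultimately have "t / (1 + L1) \<le> u" unfolding u_def by (simp add: diff_divide_distrib)
        then have "t \<le> u * (1 + L1)" using L1(1) by (simp add: divide_le_eq)
        then have "\<delta> * t \<le> \<delta> * (u * (1 + L1))" using \<delta>(1) by simp
        also have "\<dots> = \<epsilon> / 2 * u" using \<delta>2 by (simp add: mult.commute mult.left_commute)
        also have "\<dots> \<le> \<epsilon> * u"
        proof (rule mult_right_mono)
          show "0 \<le> u" using r k by (simp add: u_def)
        qed (use C in simp)
        finally have "\<delta> * t \<le> \<epsilon> * u" .
        have "norm (Q u $$ (r, c)) \<le> C * exp (- \<epsilon> * u)"
          using r k by (intro Q r(1) rcx(2)) (simp add: u_def)
        also have "\<dots> \<le> C * exp (- \<delta> * t)" using \<open>\<delta> * t \<le> \<epsilon> * u\<close> C by simp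
        finally have "\<bar>1 / (1 - \<kappa>)\<bar> * norm (Q u $$ (r, c)) \<le> L2 * (C * exp (- \<delta> * t))"
          using \<kappa>(2) L2(1) by (intro mult_mono) auto
        moreover have "norm (1 - complex_of_real \<kappa>) = \<bar>1 - \<kappa>\<bar>"
          by (metis norm_of_real of_real_1 of_real_diff)
        ultimately show ?thesis using False unfolding u_def[symmetric]
          by (simp add: norm_mult norm_divide)
      qed
      have "norm (a r c x t) \<le> L2 * C * exp (- \<delta> * t) + norm (LINT s:ray \<kappa> x t|lebesgue. G s)"
        unfolding E(2) using head by (intro order_trans[OF norm_triangle_ineq] add_mono) (simp_all add: norm_mult)
      moreover have "\<delta> * \<bar>\<kappa>\<bar> \<le> \<epsilon> / 2"
        using \<delta> \<kappa>(1) by (intro order_trans[OF mult_left_mono[of "\<bar>\<kappa>\<bar>" L1 \<delta>]]) auto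
      ultimately show ?thesis using E(1) unfolding G_def by blast
    qed
  next
    fix r m s assume "r < 2 * n" "m < 2 * n" "0 \<le> (s::real)"
    then show "norm (Q s $$ (r, m)) \<le> C * exp (- (2 * (\<epsilon> / 2)) * s)" using Q by simp
  next
    show "0 \<le> L2 * C" using C L2(1) by simp
  qed (use C \<delta>(1) rcx M in auto)
  show thesis
    by (rule that[OF _ \<delta>(1) bound]) (use C L2(1) in auto)
qed

text \<open>The terms with the potential cancel in the difference, which leaves the homogeneous
  equations. The lemma is needed because every scattering matrix may be built from kernels of its
  own.\<close>

lemma full_kernels_unique:
  assumes os: "ordered_speeds n \<xi>" and fk: "full_kernels n \<xi> Q a" "full_kernels n \<xi> Q b"
    and mp: "measurable_potential n Q" and ed: "exp_decaying Q"
    and rcx: "r < 2 * n" "c < 2 * n" "0 \<le> x" "x \<le> t"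
  shows "a r c x t = b r c x t"
proof -
  obtain C \<epsilon> where C: "0 < C" "0 < \<epsilon>"
    and Q: "\<And>r c x. r < 2 * n \<Longrightarrow> c < 2 * n \<Longrightarrow> 0 \<le> x \<Longrightarrow> norm (Q x $$ (r, c)) \<le> C * exp (- \<epsilon> * x)"
    using potential_exp_bound[OF mp ed] by blast
  obtain M1 where M1: "0 \<le> M1"
    "\<And>r c x t. r < 2 * n \<Longrightarrow> c < 2 * n \<Longrightarrow> 0 \<le> x \<Longrightarrow> x \<le> t \<Longrightarrow> norm (a r c x t) \<le> M1"
    by (rule full_kernels_bounded[OF fk(1)]) (rule that)
  obtain M2 where M2: "0 \<le> M2"
    "\<And>r c x t. r < 2 * n \<Longrightarrow> c < 2 * n \<Longrightarrow> 0 \<le> x \<Longrightarrow> x \<le> t \<Longrightarrow> norm (b r c x t) \<le> M2"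
    by (rule full_kernels_bounded[OF fk(2)]) (rule that)
  \<comment> \<open>No inhomogeneity and no weight: B = 0 and \<delta> = 0.\<close>
  have "norm (a r c x t - b r c x t) \<le> 0 * exp (real (2 * n) * C / (\<epsilon> / 2)) * exp (- 0 * t)"
  proof (rule volterra_exp_bound[where D = "\<lambda>r x t. a r c x t - b r c x t" and q = "\<lambda>r m s. Q s $$ (r, m)"
        and K = "\<bar>M1\<bar> + \<bar>M2\<bar>" and N = "2 * n" and r = r and x = x])
    fix r x t assume r: "r < 2 * n" "0 \<le> x" "x \<le> (t::real)"
    show "norm (a r c x t - b r c x t) \<le> \<bar>M1\<bar> + \<bar>M2\<bar>"
      using M1(2)[OF r(1) rcx(2) r(2,3)] M2(2)[OF r(1) rcx(2) r(2,3)]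
        norm_triangle_ineq4[of "a r c x t" "b r c x t"] M1(1) M2(1) by linarith
    let ?F = "\<lambda>\<kappa> s. \<Sum>m<2*n. Q s $$ (r, m) * (a m c s (t + \<kappa> * (s - x)) - b m c s (t + \<kappa> * (s - x)))"
    show "a r c x t - b r c x t = 0 \<or>
        (\<exists>\<kappa>. 0 * \<bar>\<kappa>\<bar> \<le> \<epsilon> / 2 \<and>
          set_integrable lebesgue (ray \<kappa> x t) (\<lambda>s. ?F \<kappa> s) \<and>
          norm (a r c x t - b r c x t) \<le> 0 * exp (- 0 * t) +
            norm (LINT s:ray \<kappa> x t|lebesgue. ?F \<kappa> s))"
    proof (cases "level n c \<le> level n r")
      case False
      then show ?thesis
        using full_kernels_outside[OF fk(1) r(1) rcx(2) r(2,3)]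
          full_kernels_outside[OF fk(2) r(1) rcx(2) r(2,3)] by simp
    next
      case True
      define \<kappa> where "\<kappa> = \<xi> r / \<xi> c"
      define G where "G f = (\<lambda>s. \<Sum>m<2*n. Q s $$ (r, m) * f m c s (t + \<kappa> * (s - x)))"
        for f :: "nat \<Rightarrow> nat \<Rightarrow> real \<Rightarrow> real \<Rightarrow> complex"
      note Ea = full_kernels_ray[OF os fk(1) r(1) rcx(2) True r(2,3), folded \<kappa>_def, folded G_def]
      note Eb = full_kernels_ray[OF os fk(2) r(1) rcx(2) True r(2,3), folded \<kappa>_def, folded G_def]
      have G: "(\<lambda>s. ?F \<kappa> s)
          = (\<lambda>s. G a s - G b s)"
        unfolding G_def by (simp add: sum_subtractf right_diff_distrib)
      have "a r c x t - b r c x t = \<i> * (LINT s:ray \<kappa> x t|lebesgue. G a s - G b s)"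
        unfolding Ea(2) Eb(2) set_integral_diff(2)[OF Ea(1) Eb(1)] by (simp add: right_diff_distrib)
      then have "norm (a r c x t - b r c x t) \<le> norm (LINT s:ray \<kappa> x t|lebesgue. G a s - G b s)"
        by (simp add: norm_mult)
      then show ?thesis
        using set_integral_diff(1)[OF Ea(1) Eb(1)] C
        by (intro disjI2 exI[of _ \<kappa>]) (simp add: G)
    qed
  next
    fix r m s assume "r < 2 * n" "m < 2 * n" "0 \<le> (s::real)"
    then show "norm (Q s $$ (r, m)) \<le> C * exp (- (2 * (\<epsilon> / 2)) * s)" using Q by simp
  qed (use C rcx in simp_all)
  then show ?thesis by simp
qed

section \<open>The kernels at \<open>x = 0\<close> determine the potential\<close>

text \<open>Of the decay of the potentials only boundedness is kept, as the integrals now run over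
  bounded ranges. \<open>L\<close> dominates the factors 1 - \<kappa> that arise when an equation is
  solved for an entry of the potential; 1 \<le> \<open>L\<close> lets the same estimate serve the
  kernels.\<close>

locale kernel_pair =
  fixes n :: nat and \<xi> :: "nat \<Rightarrow> real" and Q Q' :: "real \<Rightarrow> complex mat"
    and a a' :: "nat \<Rightarrow> nat \<Rightarrow> real \<Rightarrow> real \<Rightarrow> complex" and C M L :: real
  assumes os: "ordered_speeds n \<xi>" and fk: "full_kernels n \<xi> Q a" and fk': "full_kernels n \<xi> Q' a'"
    and Q: "\<And>r c s. r < 2 * n \<Longrightarrow> c < 2 * n \<Longrightarrow> 0 \<le> s \<Longrightarrow> norm (Q s $$ (r, c)) \<le> C"
    and Q': "\<And>r c s. r < 2 * n \<Longrightarrow> c < 2 * n \<Longrightarrow> 0 \<le> s \<Longrightarrow> norm (Q' s $$ (r, c)) \<le> C"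
    and Q0: "\<And>r c s. r < 2 * n \<Longrightarrow> c < 2 * n \<Longrightarrow> 0 \<le> s \<Longrightarrow> r = c \<or> \<not> level n c \<le> level n r \<Longrightarrow> Q s $$ (r, c) = 0"
    and Q'0: "\<And>r c s. r < 2 * n \<Longrightarrow> c < 2 * n \<Longrightarrow> 0 \<le> s \<Longrightarrow> r = c \<or> \<not> level n c \<le> level n r \<Longrightarrow> Q' s $$ (r, c) = 0"
    and a: "\<And>r c x t. r < 2 * n \<Longrightarrow> c < 2 * n \<Longrightarrow> 0 \<le> x \<Longrightarrow> x \<le> t \<Longrightarrow> norm (a r c x t) \<le> M"
    and a': "\<And>r c x t. r < 2 * n \<Longrightarrow> c < 2 * n \<Longrightarrow> 0 \<le> x \<Longrightarrow> x \<le> t \<Longrightarrow> norm (a' r c x t) \<le> M"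
    and C: "0 \<le> C" and M: "0 \<le> M"
    and L: "1 \<le> L" "\<And>r c. r < 2 * n \<Longrightarrow> c < 2 * n \<Longrightarrow> 1 - \<xi> r / \<xi> c \<le> L"
    and a_eq: "\<And>r c. r < 2 * n \<Longrightarrow> c < 2 * n \<Longrightarrow> AE t in lebesgue. 0 \<le> t \<longrightarrow> a r c 0 t = a' r c 0 t"
begin

text \<open>As \<open>a r c 0\<close> and \<open>a' r c 0\<close> agree only almost everywhere, estimates are restricted to
  characteristics starting at good points. Characteristics of different slopes meet the bad ones of
  each other in null sets, so no joint measurability of the kernels is needed.\<close>

definition good :: "nat \<Rightarrow> nat \<Rightarrow> real \<Rightarrow> bool" where
  "good r c t \<longleftrightarrow> (0 \<le> t \<longrightarrow> a r c 0 t = a' r c 0 t)"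

text \<open>The cost of one Picard step. A row sum has 2 n products; the difference of two products
  is at most M times a difference of potentials plus C times a difference of kernels;
  \<open>L\<close> is the price of solving for the potential. Below, \<open>bnd m\<close> is the
  effect of m steps on the crude bound 2 * (C + M).\<close>

definition b :: real where "b = 2 * real n * (C + M) * L"

definition bnd :: "nat \<Rightarrow> real \<Rightarrow> real" where "bnd m x = 2 * (C + M) * (b * x) ^ m / fact m"

lemma b_nonneg: "0 \<le> b" unfolding b_def using C M L by simp

lemma bnd_nonneg: "0 \<le> x \<Longrightarrow> 0 \<le> bnd m x"
  unfolding bnd_def using C M b_nonneg by simp

text \<open>Here \<open>t\<close> is the foot of the characteristic, its height at s = 0, and not
  its height at the current point.\<close>

definition G :: "(real \<Rightarrow> complex mat) \<Rightarrow> (nat \<Rightarrow> nat \<Rightarrow> real \<Rightarrow> real \<Rightarrow> complex) \<Rightarrow> nat \<Rightarrow> nat \<Rightarrow> real \<Rightarrow> real \<Rightarrow> complex" where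
  "G q f r c t s = (\<Sum>m<2*n. q s $$ (r, m) * f m c s (t + \<xi> r / \<xi> c * s))"

text \<open>In terms of the foot, the diagonal is reached at s = t / (1 - \<kappa>), wherever the
  characteristic is entered. The term with q is thus constant along a characteristic and can be
  eliminated or solved for.\<close>

lemma characteristic:
  assumes "full_kernels n \<xi> q f" "r < 2 * n" "c < 2 * n" "level n c \<le> level n r" "0 \<le> x" "0 \<le> t"
    and x: "x \<le> t + \<xi> r / \<xi> c * x"
  defines "\<kappa> \<equiv> \<xi> r / \<xi> c"
  shows "set_integrable lebesgue {s. x \<le> s \<and> s \<le> t + \<kappa> * s} (G q f r c t)"
    and "f r c x (t + \<kappa> * x) = (if r = c then 0 else \<i> * of_real (1 / (1 - \<kappa>)) * q (t / (1 - \<kappa>)) $$ (r, c))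
           + \<i> * (LINT s:{s. x \<le> s \<and> s \<le> t + \<kappa> * s}|lebesgue. G q f r c t s)"
proof -
  have ar: "t + \<kappa> * x + \<kappa> * (s - x) = t + \<kappa> * s" for s by (simp add: algebra_simps)
  have J: "ray \<kappa> x (t + \<kappa> * x) = {s. x \<le> s \<and> s \<le> t + \<kappa> * s}" unfolding ray_def ar ..
  note E = full_kernels_ray[OF os assms(1-5) x, folded \<kappa>_def, unfolded ar J, folded G_def]
  have G: "G q f r c t = (\<lambda>s. \<Sum>m<2*n. q s $$ (r, m) * f m c s (t + \<kappa> * s))"
    unfolding G_def \<kappa>_def ..
  show "set_integrable lebesgue {s. x \<le> s \<and> s \<le> t + \<kappa> * s} (G q f r c t)"
    using E(1) unfolding G .
  have u: "r \<noteq> c \<Longrightarrow> x + (t + \<kappa> * x - x) / (1 - \<kappa>) = t / (1 - \<kappa>)"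
  proof -
    assume "r \<noteq> c"
    then have "1 - \<kappa> \<noteq> 0" using speed_ratio[OF os assms(2-4)] unfolding \<kappa>_def by auto
    then have "x = x * (1 - \<kappa>) / (1 - \<kappa>)" by simp
    then have "x + (t + \<kappa> * x - x) / (1 - \<kappa>) = (x * (1 - \<kappa>) + (t + \<kappa> * x - x)) / (1 - \<kappa>)"
      unfolding add_divide_distrib by simp
    then show ?thesis by (simp add: algebra_simps)
  qed
  show "f r c x (t + \<kappa> * x) = (if r = c then 0 else \<i> * of_real (1 / (1 - \<kappa>)) * q (t / (1 - \<kappa>)) $$ (r, c))
           + \<i> * (LINT s:{s. x \<le> s \<and> s \<le> t + \<kappa> * s}|lebesgue. G q f r c t s)"
    using E(2) u unfolding G by (cases "r = c") simp_all
qed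

text \<open>The integrand at s involves entries (r, j) of the potentials and (j, c) of the kernels,
  each belonging to a characteristic of its own. The induction hypotheses speak of good feet only,
  but for almost every s all these finitely many feet are good. The factor \<open>L\<close> in the
  conclusion is the reserve for solving for the potential.\<close>

lemma diff_integral_bound:
  assumes rc: "r < 2 * n" "c < 2 * n" "level n c \<le> level n r"
    and t: "0 \<le> t" "good r c t" and y: "0 \<le> y" "y \<le> t + \<xi> r / \<xi> c * y"
    and J: "J \<subseteq> {0..y}" "set_integrable lebesgue J (G Q a r c t)" "set_integrable lebesgue J (G Q' a' r c t)"
    and IHa: "\<And>r c t x. r < 2 * n \<Longrightarrow> c < 2 * n \<Longrightarrow> level n c \<le> level n r \<Longrightarrow> 0 \<le> x \<Longrightarrow> x \<le> t
      \<Longrightarrow> good r c (t - \<xi> r / \<xi> c * x) \<Longrightarrow> norm (a r c x t - a' r c x t) \<le> bnd m x"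
    and IHQ: "\<And>r c u. r < 2 * n \<Longrightarrow> c < 2 * n \<Longrightarrow> level n c \<le> level n r \<Longrightarrow> r \<noteq> c \<Longrightarrow> 0 \<le> u
      \<Longrightarrow> good r c (u * (1 - \<xi> r / \<xi> c)) \<Longrightarrow> norm (Q u $$ (r, c) - Q' u $$ (r, c)) \<le> bnd m u"
  shows "L * norm ((LINT s:J|lebesgue. G Q a r c t s) - (LINT s:J|lebesgue. G Q' a' r c t s)) \<le> bnd (Suc m) y"
proof -
  define \<kappa> where "\<kappa> = \<xi> r / \<xi> c"
  have \<kappa>: "\<kappa> \<le> 1" using speed_ratio(2)[OF os rc] by (simp add: \<kappa>_def)
  define g where "g s = 2 * real n * (C + M) * bnd m s" for s
  define F where "F s = bnd (Suc m) s / L" for s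
  have nz: "\<xi> k \<noteq> 0" if "k < 2 * n" for k
    using speed_ratio(1)[OF os that that] by simp
  have inj: "\<xi> k = \<xi> l \<longleftrightarrow> k = l" if "k < 2 * n" "l < 2 * n" for k l
    using speed_ratio(3)[OF os that] speed_ratio(3)[OF os that(2,1)] by (cases "level n l \<le> level n k") auto
  \<comment> \<open>The foot of the (r, j)-characteristic that reaches the diagonal at s. For j = r
    the slope is 1 and the diagonal is never reached, but there the potential vanishes.\<close>
  have AEQ: "AE s in lebesgue. \<forall>j\<in>{..<2*n}. j \<noteq> r \<longrightarrow> good r j (s * (1 - \<xi> r / \<xi> j))"
  proof (rule AE_finite_allI)
    fix j assume j: "j \<in> {..<2*n}"
    show "AE s in lebesgue. j \<noteq> r \<longrightarrow> good r j (s * (1 - \<xi> r / \<xi> j))"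
    proof (cases "j = r")
      case False
      then have "1 - \<xi> r / \<xi> j \<noteq> 0" using nz[of j] inj[of r j] rc j by auto
      from AE_lebesgue_affine[OF a_eq[of r j] this, of 0] show ?thesis
        using rc j unfolding good_def by (simp add: mult.commute)
    qed simp
  qed simp
  \<comment> \<open>The foot of the (j, c)-characteristic through the current point. It moves with s
    unless j = r, where it is t itself and good by assumption.\<close>
  have AEa: "AE s in lebesgue. \<forall>j\<in>{..<2*n}. good j c (t + \<kappa> * s - \<xi> j / \<xi> c * s)"
  proof (rule AE_finite_allI)
    fix j assume j: "j \<in> {..<2*n}"
    show "AE s in lebesgue. good j c (t + \<kappa> * s - \<xi> j / \<xi> c * s)"
    proof (cases "j = r")
      case True
      then show ?thesis using t by (simp add: \<kappa>_def)
    next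
      case False
      then have "\<kappa> - \<xi> j / \<xi> c \<noteq> 0" using nz[of c] inj[of r j] rc j by (auto simp: \<kappa>_def)
      from AE_lebesgue_affine[OF a_eq[of j c] this, of t] show ?thesis
        using rc j unfolding good_def by (simp add: algebra_simps)
    qed
  qed simp
  have bound: "AE s in lebesgue. s \<in> J \<longrightarrow> norm (G Q a r c t s - G Q' a' r c t s) \<le> indicator {0..y} s * g s"
    using AEQ AEa
  proof (eventually_elim, intro impI)
    fix s assume gQ: "\<forall>j\<in>{..<2*n}. j \<noteq> r \<longrightarrow> good r j (s * (1 - \<xi> r / \<xi> j))"
      and ga: "\<forall>j\<in>{..<2*n}. good j c (t + \<kappa> * s - \<xi> j / \<xi> c * s)" and "s \<in> J"
    then have s: "0 \<le> s" "s \<le> y" using J(1) by auto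
    \<comment> \<open>The characteristic stays in the wedge up to y, because s * (1 - \<kappa>)
      \<le> y * (1 - \<kappa>) \<le> t.\<close>
    have "s * (1 - \<kappa>) \<le> y * (1 - \<kappa>)" using s \<kappa> by (intro mult_right_mono) auto
    then have st: "s \<le> t + \<kappa> * s" using y(2) unfolding \<kappa>_def[symmetric] by (simp add: algebra_simps)
    have "norm (G Q a r c t s - G Q' a' r c t s) =
      norm (\<Sum>j<2*n. (Q s $$ (r, j) - Q' s $$ (r, j)) * a j c s (t + \<kappa> * s)
        + Q' s $$ (r, j) * (a j c s (t + \<kappa> * s) - a' j c s (t + \<kappa> * s)))"
      unfolding G_def \<kappa>_def sum_subtractf[symmetric] by (simp add: algebra_simps)
    also have "\<dots> \<le> (\<Sum>j<2*n. bnd m s * M + C * bnd m s)"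
    proof (rule sum_norm_le)
      fix j assume "j \<in> {..<2*n}"
      then have j: "j < 2 * n" by simp
      have 1: "norm (Q s $$ (r, j) - Q' s $$ (r, j)) \<le> bnd m s"
      proof (cases "r = j \<or> \<not> level n j \<le> level n r")
        case True
        then show ?thesis using Q0[OF rc(1) j s(1)] Q'0[OF rc(1) j s(1)] bnd_nonneg[OF s(1)] by simp
      next
        case False
        then show ?thesis using gQ j s rc by (intro IHQ) auto
      qed
      have 2: "norm (a j c s (t + \<kappa> * s) - a' j c s (t + \<kappa> * s)) \<le> bnd m s"
      proof (cases "level n c \<le> level n j")
        case False
        then show ?thesis using full_kernels_outside[OF fk j rc(2) s(1) st False] full_kernels_outside[OF fk' j rc(2) s(1) st False] bnd_nonneg[OF s(1)] by simp
      next
        case True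
        then show ?thesis using ga j s rc st by (intro IHa) auto
      qed
      show "norm ((Q s $$ (r, j) - Q' s $$ (r, j)) * a j c s (t + \<kappa> * s)
        + Q' s $$ (r, j) * (a j c s (t + \<kappa> * s) - a' j c s (t + \<kappa> * s))) \<le> bnd m s * M + C * bnd m s"
        using 1 2 a[OF j rc(2) s(1) st] Q'[OF rc(1) j s(1)] C M bnd_nonneg[OF s(1), of m]
        by (intro order_trans[OF norm_triangle_ineq] add_mono) (auto simp: norm_mult intro!: mult_mono)
    qed
    also have "\<dots> = g s" unfolding g_def by (simp add: algebra_simps)
    finally show "norm (G Q a r c t s - G Q' a' r c t s) \<le> indicator {0..y} s * g s" using s by simp
  qed
  have gn: "0 \<le> g s" if "0 \<le> s" for s unfolding g_def using C M bnd_nonneg[OF that] by simp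
  have int: "has_bochner_integral lebesgue (\<lambda>s. indicator {0..y} s * g s) (F y - F 0)"
  proof (rule has_bochner_integral_lebesgueI)
    have "has_bochner_integral lborel (\<lambda>s. g s * indicator {0..y} s) (F y - F 0)"
    proof (rule has_bochner_integral_FTC_Icc_nonneg[OF _ _ _ y(1)])
      show "g \<in> borel_measurable borel" unfolding g_def bnd_def by measurable
      fix s assume "s \<in> {0..y}"
      then show "0 \<le> g s" by (intro gn) simp
      have "DERIV (\<lambda>s. (b * s) ^ Suc m) s :> real (Suc m) * (b * s) ^ m * b"
        by (rule derivative_eq_intros refl | simp del: power_Suc)+
      from DERIV_cmult[OF this, of "2 * (C + M) / fact (Suc m) / L"]
      have "DERIV F s :> 2 * (C + M) / fact (Suc m) / L * (real (Suc m) * (b * s) ^ m * b)"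
        unfolding F_def bnd_def by (simp add: mult_ac del: fact_Suc power_Suc)
      also have "2 * (C + M) / fact (Suc m) / L * (real (Suc m) * (b * s) ^ m * b)
          = 2 * (C + M) * (b * s) ^ m / fact m * (b / L)"
        unfolding fact_Suc of_nat_mult by simp
      also have "b / L = 2 * real n * (C + M)" unfolding b_def using L(1) by simp
      finally show "DERIV F s :> g s" unfolding g_def bnd_def by (simp add: mult_ac)
    qed
    then show "has_bochner_integral lborel (\<lambda>s. indicator {0..y} s * g s) (F y - F 0)"
      by (simp add: mult.commute)
  qed
  have "norm ((LINT s:J|lebesgue. G Q a r c t s) - (LINT s:J|lebesgue. G Q' a' r c t s))
     = norm (LINT s:J|lebesgue. G Q a r c t s - G Q' a' r c t s)"
    using set_integral_diff(2)[OF J(2,3)] by simp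
  also have "\<dots> \<le> F y - F 0"
    by (rule norm_set_integral_le[OF set_integral_diff(1)[OF J(2,3)] int bound])
       (use gn in \<open>auto simp: indicator_def\<close>)
  also have "\<dots> = bnd (Suc m) y / L" unfolding F_def bnd_def by simp
  finally show ?thesis using L(1) by (simp add: le_divide_eq mult.commute)
qed

text \<open>Differences of kernels and of potentials feed into each other, so they are estimated in
  one induction. Both are integrals over s below x or u, which gives the Volterra structure: for the
  kernels by subtracting the equations at the foot and at x, for the potentials by solving the
  equation at the foot.\<close>

lemma iterate_bound:
  shows "\<lbrakk>r < 2 * n; c < 2 * n; level n c \<le> level n r; 0 \<le> x; x \<le> t; good r c (t - \<xi> r / \<xi> c * x)\<rbrakk>
      \<Longrightarrow> norm (a r c x t - a' r c x t) \<le> bnd m x"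
    and "\<lbrakk>r < 2 * n; c < 2 * n; level n c \<le> level n r; r \<noteq> c; 0 \<le> u; good r c (u * (1 - \<xi> r / \<xi> c))\<rbrakk>
      \<Longrightarrow> norm (Q u $$ (r, c) - Q' u $$ (r, c)) \<le> bnd m u"
proof (induction m arbitrary: r c x t u)
  case 0
  {
    case 1
    then show ?case using a[of r c x t] a'[of r c x t] norm_triangle_ineq4[of "a r c x t" "a' r c x t"] C M
      by (simp add: bnd_def)
  next
    case 2
    then show ?case using Q[of r c u] Q'[of r c u] norm_triangle_ineq4[of "Q u $$ (r, c)" "Q' u $$ (r, c)"] C M
      by (simp add: bnd_def)
  }
next
  case (Suc m)
  {
    case 1
    define \<kappa> where "\<kappa> = \<xi> r / \<xi> c"
    have \<kappa>: "\<kappa> \<le> 1" using speed_ratio(2)[OF os 1(1-3)] by (simp add: \<kappa>_def)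
    define t0 where "t0 = t - \<kappa> * x"
    have g: "good r c t0" using 1(6) by (simp add: t0_def \<kappa>_def)
    have t: "t = t0 + \<kappa> * x" by (simp add: t0_def)
    have "\<kappa> * x \<le> 1 * x" using \<kappa> 1 by (intro mult_right_mono) auto
    then have t0: "0 \<le> t0" using 1 by (simp add: t0_def)
    have xt: "x \<le> t0 + \<xi> r / \<xi> c * x" using 1(5) unfolding t0_def \<kappa>_def by simp
    let ?J = "{s. 0 \<le> s \<and> s \<le> t0 + \<kappa> * s}" and ?K = "{s. x \<le> s \<and> s \<le> t0 + \<kappa> * s}"
    \<comment> \<open>Both ranges continue to the diagonal, or to infinity for slope 1, so they
      differ by the segment before x only.\<close>
    have J: "?J = {0..<x} \<union> ?K" "{0..<x} \<inter> ?K = {}" "{0..<x} \<subseteq> ?J"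
    proof -
      have "s \<le> t0 + \<kappa> * s" if "s \<le> x" for s
      proof -
        have "s * (1 - \<kappa>) \<le> x * (1 - \<kappa>)" using that \<kappa> by (intro mult_right_mono) auto
        then show ?thesis using xt unfolding \<kappa>_def[symmetric] by (simp add: algebra_simps)
      qed
      then show "?J = {0..<x} \<union> ?K" "{0..<x} \<inter> ?K = {}" "{0..<x} \<subseteq> ?J" using 1(4) by auto
    qed
    have step: "set_integrable lebesgue {0..<x} (G q f r c t0)"
      "f r c x t = f r c 0 t0 - \<i> * (LINT s:{0..<x}|lebesgue. G q f r c t0 s)"
      if q: "full_kernels n \<xi> q f" for q f
    proof -
      have lin: "J = I + K \<Longrightarrow> w + \<i> * K = w + \<i> * J - \<i> * I" for I J K w :: complex
        by (simp add: algebra_simps)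
      note c0 = characteristic[OF q 1(1-3) order_refl t0, folded \<kappa>_def, simplified mult_zero_right add_0_right, OF t0]
      note cx = characteristic[OF q 1(1-4) t0 xt, folded \<kappa>_def]
      show i: "set_integrable lebesgue {0..<x} (G q f r c t0)"
        by (rule set_integrable_subset[OF c0(1) _ J(3)]) simp
      have "(LINT s:?J|lebesgue. G q f r c t0 s) =
        (LINT s:{0..<x}|lebesgue. G q f r c t0 s) + (LINT s:?K|lebesgue. G q f r c t0 s)"
        unfolding J(1) by (rule set_integral_Un[OF J(2) i cx(1)])
      then show "f r c x t = f r c 0 t0 - \<i> * (LINT s:{0..<x}|lebesgue. G q f r c t0 s)"
        unfolding t cx(2) c0(2) by (rule lin)
    qed
    have a0: "a r c 0 t0 = a' r c 0 t0" using g t0 by (simp add: good_def)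
    let ?D = "(LINT s:{0..<x}|lebesgue. G Q a r c t0 s) - (LINT s:{0..<x}|lebesgue. G Q' a' r c t0 s)"
    define Z where "Z = norm ?D"
    have le: "L * norm ?D
        \<le> bnd (Suc m) x"
      by (rule diff_integral_bound[OF 1(1-3) t0 g 1(4) xt _ step(1)[OF fk] step(1)[OF fk'] Suc.IH])
         auto
    have eq: "norm (a r c x t - a' r c x t) =
      norm ?D"
    proof -
      have "a r c x t - a' r c x t =
        - \<i> * ?D"
        unfolding step(2)[OF fk] step(2)[OF fk'] a0 by (simp add: algebra_simps)
      then show ?thesis by (simp add: norm_mult norm_minus_commute)
    qed
    have "Z \<le> L * Z" using mult_right_mono[OF L(1), of Z] by (simp add: Z_def)
    then show ?case unfolding eq using le unfolding Z_def by linarith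
  next
    case 2
    define \<kappa> where "\<kappa> = \<xi> r / \<xi> c"
    have \<kappa>: "\<kappa> < 1" using speed_ratio[OF os 2(1-3)] 2(4)
      unfolding \<kappa>_def less_le by (simp add: eq_divide_eq_1 divide_eq_1_iff del: right_minus_eq)
    \<comment> \<open>Chosen so that the characteristic meets the diagonal at u, that is t0 +
      \<kappa> * u = u.\<close>
    define t0 where "t0 = u * (1 - \<kappa>)"
    have t0: "0 \<le> t0" using 2 \<kappa> by (simp add: t0_def)
    have g: "good r c t0" using 2(6) by (simp add: t0_def \<kappa>_def)
    have u: "t0 / (1 - \<kappa>) = u" using \<kappa> by (simp add: t0_def)
    have "t0 + \<kappa> * u = u" unfolding t0_def by (simp add: algebra_simps)
    then have uu: "u \<le> t0 + \<xi> r / \<xi> c * u" unfolding \<kappa>_def by simp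
    have J: "{s. 0 \<le> s \<and> s \<le> t0 + \<kappa> * s} = {0..u}"
    proof -
      have "s \<le> t0 + \<kappa> * s \<longleftrightarrow> s \<le> u" for s
      proof -
        have "s \<le> t0 + \<kappa> * s \<longleftrightarrow> s * (1 - \<kappa>) \<le> u * (1 - \<kappa>)" by (simp add: t0_def algebra_simps)
        also have "\<dots> \<longleftrightarrow> s \<le> u" using \<kappa> by (intro mult_le_cancel_right_pos) simp
        finally show ?thesis .
      qed
      then show ?thesis unfolding atLeastAtMost_def atLeast_def atMost_def by blast
    qed
    note c0 = characteristic[OF _ 2(1-3) order_refl t0, folded \<kappa>_def, simplified mult_zero_right add_0_right, OF _ t0, unfolded J u]
    have a0: "a r c 0 t0 = a' r c 0 t0" using g t0 by (simp add: good_def)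
    let ?D = "(LINT s:{0..u}|lebesgue. G Q a r c t0 s) - (LINT s:{0..u}|lebesgue. G Q' a' r c t0 s)"
    define Z where "Z = norm ?D"
    have le: "L * norm ?D
        \<le> bnd (Suc m) u"
      by (rule diff_integral_bound[OF 2(1-3) t0 g 2(5) uu order_refl c0(1)[OF fk] c0(1)[OF fk'] Suc.IH])
    \<comment> \<open>Removing the factor 1 / (1 - \<kappa>) from the term with the potential costs
      1 - \<kappa>, which exceeds 1 for negative slopes; \<open>L\<close> absorbs it.\<close>
    have eq: "norm (Q u $$ (r, c) - Q' u $$ (r, c)) = (1 - \<kappa>) *
      norm ?D"
    proof -
      have lin: "w * v + \<i> * I = w * v' + \<i> * I' \<Longrightarrow> w * (v - v') = - \<i> * (I - I')"
        for w v v' I I' :: complex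
        by (simp add: algebra_simps)
      have "\<i> * of_real (1 / (1 - \<kappa>)) * (Q u $$ (r, c) - Q' u $$ (r, c)) =
        - \<i> * ?D"
        using a0 unfolding c0(2)[OF fk] c0(2)[OF fk'] if_not_P[OF 2(4)] by (rule lin)
      then have "norm (\<i> * of_real (1 / (1 - \<kappa>)) * (Q u $$ (r, c) - Q' u $$ (r, c))) = Z"
        unfolding Z_def by (simp only: norm_mult norm_minus_cancel) simp
      moreover have "norm (complex_of_real (1 / (1 - \<kappa>))) = 1 / (1 - \<kappa>)"
        unfolding norm_of_real using \<kappa> by simp
      ultimately have "norm (Q u $$ (r, c) - Q' u $$ (r, c)) / (1 - \<kappa>) = Z"
        by (simp only: norm_mult norm_ii mult_1_left times_divide_eq_left)
      then show ?thesis using \<kappa> unfolding Z_def[symmetric] by (auto simp: mult.commute)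
    qed
    have "(1 - \<kappa>) * Z \<le> L * Z"
      using L(2)[OF 2(1,2)] unfolding \<kappa>_def by (intro mult_right_mono) (simp_all add: Z_def)
    then show ?case unfolding eq using le unfolding Z_def by linarith
  }
qed

lemma potentials_AE_eq:
  assumes rc: "r < 2 * n" "c < 2 * n"
  shows "AE u in lebesgue. 0 \<le> u \<longrightarrow> Q u $$ (r, c) = Q' u $$ (r, c)"
proof (cases "r = c \<or> \<not> level n c \<le> level n r")
  case True
  then show ?thesis using Q0[OF rc] Q'0[OF rc] by (intro AE_I2) simp
next
  case False
  then have p: "level n c \<le> level n r" "r \<noteq> c" by auto
  have "1 - \<xi> r / \<xi> c \<noteq> 0" using speed_ratio[OF os rc p(1)] p(2) by auto
  \<comment> \<open>The characteristic ending on the diagonal at u has foot (1 - \<kappa>) * u,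
    which is good for almost every u.\<close>
  from AE_lebesgue_affine[OF a_eq[OF rc] this, of 0]
  show ?thesis
  proof (eventually_elim, intro impI)
    fix u :: real assume "0 \<le> 0 + (1 - \<xi> r / \<xi> c) * u \<longrightarrow>
      a r c 0 (0 + (1 - \<xi> r / \<xi> c) * u) = a' r c 0 (0 + (1 - \<xi> r / \<xi> c) * u)" and u: "0 \<le> u"
    then have "good r c (u * (1 - \<xi> r / \<xi> c))" by (simp add: good_def mult.commute)
    then have "norm (Q u $$ (r, c) - Q' u $$ (r, c)) \<le> bnd m u" for m
      by (rule iterate_bound(2)[OF rc p u])
    moreover have "(\<lambda>m. bnd m u) \<longlonglongrightarrow> 0"
    proof -
      have "(\<lambda>m. 2 * (C + M) * ((b * u) ^ m / fact m)) \<longlonglongrightarrow> 2 * (C + M) * 0"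
        using summable_LIMSEQ_zero[OF summable_exp[of "b * u"]]
        by (intro tendsto_mult_left) (simp add: divide_inverse mult.commute)
      then show ?thesis unfolding bnd_def by simp
    qed
    ultimately have "norm (Q u $$ (r, c) - Q' u $$ (r, c)) \<le> 0"
      by (intro LIMSEQ_le_const) auto
    then show "Q u $$ (r, c) = Q' u $$ (r, c)" by simp
  qed
qed

end

section \<open>Laplace transforms of exponentially decaying functions\<close>

lemma has_bochner_integral_exp_Ici:
  fixes k :: real
  assumes "0 < k"
  shows "has_bochner_integral lborel (\<lambda>x. indicator {0..} x * exp (- k * x)) (1 / k)"
proof -
  have "has_bochner_integral lborel (\<lambda>x. indicator {0..} x * exp (- k * x)) (0 - (- exp (- k * 0) / k))"
  proof (rule has_bochner_integral_FTC_Ici_nonneg)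
    show "DERIV (\<lambda>x. - exp (- k * x) / k) x :> exp (- k * x)" for x
      using assms by (auto intro!: derivative_eq_intros)
    show "((\<lambda>x. - exp (- k * x) / k) \<longlongrightarrow> 0) at_top"
      using assms by real_asymp
  qed auto
  then show ?thesis by simp
qed

lemma norm_exp_diff_le:
  assumes "Re a \<le> M" "Re b \<le> M"
  shows "norm (exp a - exp b) \<le> exp M * norm (a - b)"
proof (rule field_differentiable_bound[where S = "{z. Re z \<le> M}" and f = exp and f' = exp])
  show "convex {z. Re z \<le> M}" by (rule convex_halfspace_Re_le)
qed (use assms in \<open>auto intro!: derivative_eq_intros\<close>)

text \<open>The bound is demanded at every point and forces f to vanish on the negative axis, so
  half-line integrals can be written over all of \<open>lborel\<close>.\<close>

definition exp_decaying_fun :: "real \<Rightarrow> real \<Rightarrow> (real \<Rightarrow> complex) \<Rightarrow> bool" where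
  "exp_decaying_fun B \<delta> f \<longleftrightarrow> 0 \<le> B \<and> 0 < \<delta> \<and> f \<in> borel_measurable borel \<and>
     (\<forall>x. norm (f x) \<le> indicator {0..} x * (B * exp (- \<delta> * x)))"

definition laplace :: "(real \<Rightarrow> complex) \<Rightarrow> complex \<Rightarrow> complex" where
  "laplace f w = (LINT x|lborel. f x * exp (- w * of_real x))"

lemma exp_decaying_funD:
  assumes "exp_decaying_fun B \<delta> f"
  shows "0 \<le> B" "0 < \<delta>" "f \<in> borel_measurable borel" "x < 0 \<Longrightarrow> f x = 0" "norm (f x) \<le> B * exp (- \<delta> * x)"
proof -
  from assms have *: "0 \<le> B" "0 < \<delta>" "f \<in> borel_measurable borel"
     "\<And>x. norm (f x) \<le> indicator {0..} x * (B * exp (- \<delta> * x))"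
    unfolding exp_decaying_fun_def by auto
  then show "0 \<le> B" "0 < \<delta>" "f \<in> borel_measurable borel" by auto
  show "x < 0 \<Longrightarrow> f x = 0" using *(4)[of x] by simp
  show "norm (f x) \<le> B * exp (- \<delta> * x)" using *(4)[of x] *(1) by (cases "x < 0") simp_all
qed

lemma exp_decaying_fun_mono:
  assumes "exp_decaying_fun B \<delta> f" "0 < \<delta>'" "\<delta>' \<le> \<delta>"
  shows "exp_decaying_fun B \<delta>' f"
proof -
  have "norm (f x) \<le> indicator {0..} x * (B * exp (- \<delta>' * x))" for x
  proof (cases "x < 0")
    case False
    have "norm (f x) \<le> B * exp (- \<delta> * x)" by (rule exp_decaying_funD(5)[OF assms(1)])
    also have "\<dots> \<le> B * exp (- \<delta>' * x)"
      using False assms exp_decaying_funD(1)[OF assms(1)] by (intro mult_left_mono) (auto intro: mult_right_mono)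
    finally show ?thesis using False by simp
  qed (simp add: exp_decaying_funD(4)[OF assms(1)])
  then show ?thesis using assms exp_decaying_funD(1,3)[OF assms(1)] unfolding exp_decaying_fun_def by auto
qed

lemma laplace_norm_bound:
  assumes f: "exp_decaying_fun B \<delta> f" and w: "- \<delta> < Re w"
  shows "integrable lborel (\<lambda>x. f x * exp (- w * of_real x))" "norm (laplace f w) \<le> B / (\<delta> + Re w)"
proof -
  note fD = exp_decaying_funD[OF f]
  note [measurable] = fD(3)
  have "has_bochner_integral lborel (\<lambda>x. B * (indicator {0..} x * exp (- (\<delta> + Re w) * x))) (B * (1 / (\<delta> + Re w)))"
    using w by (intro has_bochner_integral_mult_right has_bochner_integral_exp_Ici) auto
  then have int: "integrable lborel (\<lambda>x. B * (indicator {0..} x * exp (- (\<delta> + Re w) * x)))"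
    and val: "(LINT x|lborel. B * (indicator {0..} x * exp (- (\<delta> + Re w) * x))) = B / (\<delta> + Re w)"
    by (simp_all add: has_bochner_integral_iff)
  have le: "norm (f x * exp (- w * of_real x)) \<le> B * (indicator {0..} x * exp (- (\<delta> + Re w) * x))" for x
  proof (cases "x < 0")
    case False
    have "norm (f x * exp (- w * of_real x)) \<le> B * exp (- \<delta> * x) * exp (- Re w * x)"
      unfolding norm_mult norm_exp_eq_Re using fD(1) fD(5)[of x] by (intro mult_mono) auto
    also have "\<dots> = B * exp (- (\<delta> + Re w) * x)"
      by (simp add: mult_exp_exp left_diff_distrib)
    finally show ?thesis using False by simp
  qed (simp add: fD(4))
  show 1: "integrable lborel (\<lambda>x. f x * exp (- w * of_real x))"
    by (rule Bochner_Integration.integrable_bound[OF int]) (simp_all only: real_norm_def, measurable, rule AE_I2, rule order_trans[OF le abs_ge_self])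
  have "norm (laplace f w) \<le> (LINT x|lborel. norm (f x * exp (- w * of_real x)))"
    unfolding laplace_def by (rule integral_norm_bound)
  also have "\<dots> \<le> (LINT x|lborel. B * (indicator {0..} x * exp (- (\<delta> + Re w) * x)))"
    by (intro integral_mono integrable_norm 1 int le)
  finally show "norm (laplace f w) \<le> B / (\<delta> + Re w)" unfolding val .
qed

text \<open>Differentiation in w brings down a factor x. It can be dominated because w0 keeps a
  distance from the line Re w = - \<delta>, which leaves exponential decay to spare.\<close>

lemma laplace_has_field_derivative:
  assumes f: "exp_decaying_fun B \<delta> f" and w: "- \<delta> < Re w0"
  shows "(laplace f has_field_derivative (LINT x|lborel. f x * (- of_real x * exp (- w0 * of_real x)))) (at w0)"
proof -
  let ?D = "LINT x|lborel. f x * (- of_real x * exp (- w0 * of_real x))"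
  note fD = exp_decaying_funD[OF f]
  note [measurable] = fD(3)
  \<comment> \<open>In the ball of radius c around w0 the rate \<delta> + Re w is still at least c.
    Of c = k + k one half dominates the factor x, by k * x \<le> exp (k * x), and the other keeps
    the majorant integrable.\<close>
  define c where "c = (\<delta> + Re w0) / 2"
  have c: "0 < c" using w by (simp add: c_def)
  define k where "k = c / 2"
  have k: "0 < k" "c = k + k" using c by (simp_all add: k_def)
  have c2: "2 * c = \<delta> + Re w0" by (simp add: c_def)
  let ?S = "ball w0 c"
  have ReS: "Re w0 - c \<le> Re w" if "w \<in> ?S" for w
    using that abs_Re_le_cmod[of "w0 - w"] by (auto simp: dist_norm)
  have "(laplace f has_field_derivative ?D) (at w0 within ?S)"
    unfolding has_field_derivative_iff tendsto_at_iff_sequentially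
  proof (intro allI impI)
    fix X :: "nat \<Rightarrow> complex" assume X: "\<forall>i. X i \<in> ?S - {w0}" and lim: "X \<longlonglongrightarrow> w0"
    define q where "q i x = f x * ((exp (- X i * of_real x) - exp (- w0 * of_real x)) / (X i - w0))" for i x
    have quot: "(laplace f (X i) - laplace f w0) / (X i - w0) = (LINT x|lborel. q i x)" for i
    proof -
      have "- \<delta> < Re w0 - c" using w c2 by linarith
      also have "\<dots> \<le> Re (X i)" using ReS X by blast
      finally have r: "- \<delta> < Re (X i)" .
      have "laplace f (X i) - laplace f w0 = (LINT x|lborel. f x * exp (- X i * of_real x) - f x * exp (- w0 * of_real x))"
        unfolding laplace_def
        by (intro Bochner_Integration.integral_diff[symmetric] laplace_norm_bound(1)[OF f] r w)
      also have "\<dots> / (X i - w0) = (LINT x|lborel. (f x * exp (- X i * of_real x) - f x * exp (- w0 * of_real x)) / (X i - w0))"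
        by simp
      finally show ?thesis unfolding q_def by (simp add: right_diff_distrib)
    qed
    have "(\<lambda>i. LINT x|lborel. q i x) \<longlonglongrightarrow> ?D"
    proof (rule integral_dominated_convergence)
      show "integrable lborel (\<lambda>x. (B / k) * (indicator {0..} x * exp (- k * x)))"
        using has_bochner_integral_exp_Ici[OF k(1)]
        by (intro integrable_mult_right) (simp add: has_bochner_integral_iff)
      show "AE x in lborel. (\<lambda>i. q i x) \<longlonglongrightarrow> f x * (- of_real x * exp (- w0 * of_real x))"
      proof (rule AE_I2)
        fix x :: real
        have "((\<lambda>w. exp (- w * of_real x)) has_field_derivative - of_real x * exp (- w0 * of_real x)) (at w0 within ?S)"
          by (auto intro!: derivative_eq_intros)
        then have "(\<lambda>i. (exp (- X i * of_real x) - exp (- w0 * of_real x)) / (X i - w0)) \<longlonglongrightarrow> - of_real x * exp (- w0 * of_real x)"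
          unfolding has_field_derivative_iff tendsto_at_iff_sequentially using X lim by (auto simp: o_def)
        then show "(\<lambda>i. q i x) \<longlonglongrightarrow> f x * (- of_real x * exp (- w0 * of_real x))"
          unfolding q_def by (intro tendsto_mult tendsto_const)
      qed
      show "AE x in lborel. norm (q i x) \<le> (B / k) * (indicator {0..} x * exp (- k * x))" for i
      proof (rule AE_I2)
        fix x :: real
        show "norm (q i x) \<le> (B / k) * (indicator {0..} x * exp (- k * x))"
        proof (cases "x < 0")
          case False
          then have x: "0 \<le> x" by simp
          have ne: "X i - w0 \<noteq> 0" using X by simp
          have Xi: "Re w0 - c \<le> Re (X i)" using ReS X by blast
          have "norm (exp (- X i * of_real x) - exp (- w0 * of_real x)) \<le>
            exp (- (Re w0 - c) * x) * norm (- X i * of_real x - - w0 * of_real x)"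
          proof (rule norm_exp_diff_le)
            show "Re (- X i * of_real x) \<le> - (Re w0 - c) * x"
              using mult_right_mono[OF Xi x] by (simp add: algebra_simps)
            show "Re (- w0 * of_real x) \<le> - (Re w0 - c) * x" using c x by (simp add: left_diff_distrib)
          qed
          also have "norm (- X i * of_real x - - w0 * of_real x) = norm (X i - w0) * x"
          proof -
            have "- X i * of_real x - - w0 * of_real x = - ((X i - w0) * of_real x)" by (simp add: algebra_simps)
            then show ?thesis using x by (simp add: norm_mult)
          qed
          finally have "norm ((exp (- X i * of_real x) - exp (- w0 * of_real x)) / (X i - w0)) \<le> exp (- (Re w0 - c) * x) * x"
            using ne by (simp add: norm_divide divide_le_eq mult_ac)
          then have "norm (q i x) \<le> B * exp (- \<delta> * x) * (exp (- (Re w0 - c) * x) * x)"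
            unfolding q_def norm_mult using fD(5)[of x] fD(1) by (intro mult_mono) auto
          also have "\<dots> = B * x * (exp (- \<delta> * x) * exp (- (Re w0 - c) * x))" by (simp only: mult_ac)
          also have "exp (- \<delta> * x) * exp (- (Re w0 - c) * x) = exp (- c * x)"
          proof -
            have d: "\<delta> = 2 * c - Re w0" using c2 by linarith
            have "- \<delta> * x + - (Re w0 - c) * x = - c * x" unfolding d by (simp add: algebra_simps)
            then show ?thesis unfolding mult_exp_exp by (simp only:)
          qed
          also have "B * x * exp (- c * x) = B * (1 / k) * ((k * x) * exp (- c * x))" using k(1) by simp
          also have "\<dots> \<le> B * (1 / k) * (exp (k * x) * exp (- c * x))"
          proof (intro mult_left_mono mult_right_mono)
            show "k * x \<le> exp (k * x)" using exp_ge_add_one_self[of "k * x"] by (rule order_trans[rotated]) simp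
          qed (use k(1) fD(1) x in auto)
          also have "exp (k * x) * exp (- c * x) = exp (- k * x)"
          proof -
            have "k * x + - c * x = - k * x" unfolding k(2) by (simp add: algebra_simps)
            then show ?thesis unfolding mult_exp_exp by (simp only:)
          qed
          finally show ?thesis using x by (simp add: mult.assoc)
        next
          case True
          then show ?thesis unfolding q_def by (simp add: fD(4)[OF True])
        qed
      qed
    next
      show "(\<lambda>x. f x * (- of_real x * exp (- w0 * of_real x))) \<in> borel_measurable lborel" by measurable
      show "q i \<in> borel_measurable lborel" for i unfolding q_def by measurable
    qed
    then show "((\<lambda>y. (laplace f y - laplace f w0) / (y - w0)) \<circ> X) \<longlonglongrightarrow>
        ?D"
      unfolding o_def quot .
  qed
  moreover have "at w0 within ?S = at w0" by (rule at_within_open) (use c in auto)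
  ultimately show ?thesis by (simp only:)
qed

lemma laplace_holomorphic:
  assumes "exp_decaying_fun B \<delta> f"
  shows "laplace f holomorphic_on {w. - \<delta> < Re w}"
  using laplace_has_field_derivative[OF assms] open_halfspace_Re_gt[of "- \<delta>"]
  by (auto simp: holomorphic_on_open)

lemma integral_exp_Icc:
  fixes c :: complex and a b :: real
  assumes "a \<le> b" "c \<noteq> 0"
  shows "(LINT y|lborel. indicator {a..b} y *\<^sub>R exp (c * of_real y)) = (exp (c * of_real b) - exp (c * of_real a)) / c"
proof -
  have "(LINT y|lborel. indicator {a..b} y *\<^sub>R exp (c * of_real y)) = exp (c * of_real b) / c - exp (c * of_real a) / c"
  proof (rule integral_FTC_Icc[OF assms(1)])
    fix x
    have "((\<lambda>z. exp (c * z) / c) has_field_derivative exp (c * of_real x)) (at (of_real x))"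
      using assms(2) by (auto intro!: derivative_eq_intros)
    then show "((\<lambda>y. exp (c * of_real y) / c) has_vector_derivative exp (c * of_real x)) (at x within {a..b})"
      by (intro has_vector_derivative_real_field)
  qed (intro continuous_intros)
  then show ?thesis by (simp only: diff_divide_distrib)
qed

lemma integral_exp_Ici:
  fixes c :: complex
  assumes "0 < Re c"
  shows "integrable lborel (\<lambda>y. indicator {0..} y *\<^sub>R exp (- c * of_real y))"
    and "(LINT y|lborel. indicator {0..} y *\<^sub>R exp (- c * of_real y)) = 1 / c"
proof -
  have dom: "integrable lborel (\<lambda>y. indicator {0..} y * exp (- Re c * y))"
    using has_bochner_integral_exp_Ici[OF assms] by (simp add: has_bochner_integral_iff)
  show "integrable lborel (\<lambda>y. indicator {0..} y *\<^sub>R exp (- c * of_real y))"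
    by (rule Bochner_Integration.integrable_bound[OF dom]) (auto intro!: AE_I2 simp: indicator_def)
  have c0: "- c \<noteq> 0" using assms by auto
  have "(\<lambda>n::nat. LINT y|lborel. indicator {0..real n} y *\<^sub>R exp (- c * of_real y)) \<longlonglongrightarrow>
      (LINT y|lborel. indicator {0..} y *\<^sub>R exp (- c * of_real y))"
  proof (rule integral_dominated_convergence[OF _ _ dom])
    show "AE y in lborel. (\<lambda>n. indicat_real {0..real n} y *\<^sub>R exp (- c * of_real y)) \<longlonglongrightarrow> indicat_real {0..} y *\<^sub>R exp (- c * of_real y)"
    proof (rule AE_I2)
      fix y :: real
      obtain N where N: "y \<le> real N" using real_arch_simple by blast
      have "\<forall>n\<ge>N. indicat_real {0..real n} y *\<^sub>R exp (- c * of_real y) = indicat_real {0..} y *\<^sub>R exp (- c * of_real y)"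
        using N by (auto simp: indicator_def)
      then show "(\<lambda>n. indicat_real {0..real n} y *\<^sub>R exp (- c * of_real y)) \<longlonglongrightarrow> indicat_real {0..} y *\<^sub>R exp (- c * of_real y)"
        by (intro tendsto_eventually) (auto simp: eventually_sequentially)
    qed
    show "AE y in lborel. norm (indicat_real {0..real n} y *\<^sub>R exp (- c * of_real y)) \<le> indicat_real {0..} y * exp (- Re c * y)" for n
      by (intro AE_I2) (auto simp: indicator_def)
  qed auto
  moreover have "(\<lambda>n::nat. LINT y|lborel. indicator {0..real n} y *\<^sub>R exp (- c * of_real y)) = (\<lambda>n. (exp (- c * of_real (real n)) - 1) / (- c))"
    by (intro ext) (subst integral_exp_Icc[OF _ c0], auto)
  moreover have "(\<lambda>n::nat. (exp (- c * of_real (real n)) - 1) / (- c)) \<longlonglongrightarrow> (0 - 1) / (- c)"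
  proof (intro tendsto_divide tendsto_diff tendsto_const c0, rule tendsto_norm_zero_cancel)
    have "(\<lambda>n::nat. exp (- Re c * real n)) \<longlonglongrightarrow> 0" using assms by real_asymp
    then show "(\<lambda>n::nat. norm (exp (- c * of_real (real n)))) \<longlonglongrightarrow> 0" by simp
  qed
  ultimately show "(LINT y|lborel. indicator {0..} y *\<^sub>R exp (- c * of_real y)) = 1 / c"
    using LIMSEQ_unique by fastforce
qed

section \<open>Convolution and division by a linear factor\<close>

context
  fixes g :: "real \<Rightarrow> complex" and \<phi> :: "real \<Rightarrow> real" and h :: "real \<Rightarrow> complex"
  assumes g: "integrable lborel g" and \<phi>: "integrable lborel \<phi>" "\<And>u. \<bar>\<phi> u\<bar> \<le> 1" "\<And>u. u \<noteq> 0 \<Longrightarrow> isCont \<phi> u"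
  defines "h \<equiv> \<lambda>y. LINT x|lborel. g x * of_real (\<phi> (y - x))"
begin

lemma conv_measurable: "g \<in> borel_measurable borel" "\<phi> \<in> borel_measurable borel"
  using borel_measurable_integrable[OF g] borel_measurable_integrable[OF \<phi>(1)] by simp_all

text \<open>For fixed y the integrand depends discontinuously on y only at the single point x = y, a
  null set, so dominated convergence applies. This is how continuity arises from a merely integrable
  g.\<close>

lemma continuous_conv: "continuous_on UNIV h"
proof (rule continuous_at_imp_continuous_on, rule ballI)
  note [measurable] = conv_measurable
  fix y :: real
  show "isCont h y"
    unfolding continuous_at_sequentially
  proof (intro allI impI)
    fix X :: "nat \<Rightarrow> real" assume X: "X \<longlonglongrightarrow> y"
    have "(\<lambda>n. LINT x|lborel. g x * of_real (\<phi> (X n - x))) \<longlonglongrightarrow> (LINT x|lborel. g x * of_real (\<phi> (y - x)))"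
    proof (rule integral_dominated_convergence[where w = "\<lambda>x. norm (g x)"])
      show "AE x in lborel. (\<lambda>n. g x * of_real (\<phi> (X n - x))) \<longlonglongrightarrow> g x * of_real (\<phi> (y - x))"
        using AE_lborel_singleton[of y]
      proof eventually_elim
        fix x :: real assume "x \<noteq> y"
        then have "isCont \<phi> (y - x)" by (intro \<phi>(3)) simp
        then have "(\<lambda>n. \<phi> (X n - x)) \<longlonglongrightarrow> \<phi> (y - x)"
          by (rule isCont_tendsto_compose) (intro tendsto_diff X tendsto_const)
        then show "(\<lambda>n. g x * of_real (\<phi> (X n - x))) \<longlonglongrightarrow> g x * of_real (\<phi> (y - x))"
          by (intro tendsto_mult tendsto_const tendsto_of_real)
      qed
      show "AE x in lborel. norm (g x * of_real (\<phi> (X n - x))) \<le> norm (g x)" for n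
        using \<phi>(2) by (intro AE_I2) (simp add: norm_mult mult_left_le)
      show "integrable lborel (\<lambda>x. norm (g x))" using g by simp
    qed measurable
    then show "(h \<circ> X) \<longlonglongrightarrow> h y" unfolding h_def o_def .
  qed
qed

lemma integrable_conv_pair:
  "integrable (lborel \<Otimes>\<^sub>M lborel) (\<lambda>(x, y). g x * of_real (\<phi> (y - x)))"
proof (rule lborel_pair.Fubini_integrable)
  note [measurable] = conv_measurable
  show "(\<lambda>(x, y). g x * of_real (\<phi> (y - x))) \<in> borel_measurable (lborel \<Otimes>\<^sub>M lborel)" by measurable
  have sh: "integrable lborel (\<lambda>y. \<phi> (y - x))" for x
    using lborel_integrable_real_affine[OF \<phi>(1), of 1 "- x"] by simp
  have "(LINT y|lborel. norm (g x * of_real (\<phi> (y - x)))) = norm (g x) * (LINT y|lborel. \<bar>\<phi> y\<bar>)" for x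
    using lborel_integral_real_affine[of 1 "\<lambda>y. \<bar>\<phi> y\<bar>" "- x"] by (simp add: norm_mult)
  then show "integrable lborel (\<lambda>x. LINT y|lborel. norm (case (x, y) of (x, y) \<Rightarrow> g x * of_real (\<phi> (y - x))))"
    using g by simp
  show "AE x in lborel. integrable lborel (\<lambda>y. case (x, y) of (x, y) \<Rightarrow> g x * complex_of_real (\<phi> (y - x)))"
    using sh by (intro AE_I2) simp
qed

lemma integrable_conv: "integrable lborel h"
  using lborel_pair.integrable_snd[OF integrable_conv_pair] unfolding h_def by simp

lemma conv_transform:
  assumes "Re w = 0"
  shows "(LINT y|lborel. indicator {0..} y *\<^sub>R (h y * exp (- w * of_real y))) =
    (LINT x|lborel. g x * (LINT y|lborel. indicator {0..} y *\<^sub>R (of_real (\<phi> (y - x)) * exp (- w * of_real y))))"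
proof -
  note [measurable] = conv_measurable
  let ?F = "\<lambda>x y. g x * (indicator {0..} y *\<^sub>R (of_real (\<phi> (y - x)) * exp (- w * of_real y)))"
  have int: "integrable (lborel \<Otimes>\<^sub>M lborel) (\<lambda>(x, y). ?F x y)"
  proof (rule Bochner_Integration.integrable_bound[OF integrable_conv_pair])
    show "AE p in lborel \<Otimes>\<^sub>M lborel. norm (case p of (x, y) \<Rightarrow> ?F x y) \<le> norm (case p of (x, y) \<Rightarrow> g x * complex_of_real (\<phi> (y - x)))"
      using assms by (intro AE_I2) (auto simp: norm_mult indicator_def split: prod.split)
  qed measurable
  have "(LINT y|lborel. indicator {0..} y *\<^sub>R (h y * exp (- w * of_real y))) = (LINT y|lborel. LINT x|lborel. ?F x y)"
  proof (rule Bochner_Integration.integral_cong[OF refl])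
    fix y :: real
    have "(LINT x|lborel. ?F x y) = (LINT x|lborel. (g x * of_real (\<phi> (y - x))) * (indicator {0..} y *\<^sub>R exp (- w * of_real y)))"
      by (intro Bochner_Integration.integral_cong refl) (simp add: mult_ac)
    also have "\<dots> = h y * (indicator {0..} y *\<^sub>R exp (- w * of_real y))"
      unfolding h_def by (rule integral_mult_left_zero)
    finally show "indicator {0..} y *\<^sub>R (h y * exp (- w * of_real y)) = (LINT x|lborel. ?F x y)"
      by (simp only: mult_scaleR_right)
  qed
  also have "\<dots> = (LINT x|lborel. LINT y|lborel. ?F x y)"
    by (rule lborel_pair.Fubini_integral[OF int])
  finally show ?thesis by (simp only: integral_mult_right_zero)
qed

end

lemma half_line_transformsI:
  assumes f: "continuous_on UNIV f" "integrable lborel f"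
    and F: "\<And>lam. F lam = (LINT x|lborel. indicator {0..} x *\<^sub>R (f x * exp (- (- \<i> * of_real (sg * lam)) * of_real x)))"
  shows "F \<in> half_line_transforms sg"
proof -
  have fm [measurable]: "f \<in> borel_measurable borel" using borel_measurable_integrable[OF f(2)] by simp
  have "integrable lborel (\<lambda>x. indicator {0..} x *\<^sub>R f x)"
    using f(2) by (intro integrable_mult_indicator) auto
  then have "set_integrable lebesgue {0..} f"
    unfolding set_integrable_def using integrable_completion[of "\<lambda>x. indicator {0..} x *\<^sub>R f x" lborel] by simp
  moreover have "F lam = (LINT x:{0..}|lebesgue. f x * exp (\<i> * of_real (sg * lam * x)))" for lam
    unfolding F set_lebesgue_integral_def
    by (subst integral_completion, measurable) (simp add: mult.assoc)
  moreover have "continuous_on {0..} f" using f(1) by (rule continuous_on_subset) simp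
  ultimately show ?thesis unfolding half_line_transforms_def by blast
qed

lemma integrable_phase:
  fixes f :: "real \<Rightarrow> complex"
  assumes "integrable lborel f" "Re w = 0"
  shows "integrable lborel (\<lambda>y. indicator {0..} y *\<^sub>R (f y * exp (- w * of_real y)))"
proof (rule Bochner_Integration.integrable_bound[OF assms(1)])
  have [measurable]: "f \<in> borel_measurable borel" using borel_measurable_integrable[OF assms(1)] by simp
  show "(\<lambda>y. indicator {0..} y *\<^sub>R (f y * exp (- w * of_real y))) \<in> borel_measurable lborel" by measurable
  show "AE y in lborel. norm (indicator {0..} y *\<^sub>R (f y * exp (- w * of_real y))) \<le> norm (f y)"
    using assms(2) by (intro AE_I2) (auto simp: norm_mult indicator_def)
qed

lemma exp_decaying_fun_integrable:
  assumes "exp_decaying_fun B \<delta> f" shows "integrable lborel f"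
  using laplace_norm_bound(1)[OF assms, of 0] exp_decaying_funD(2)[OF assms] by simp

lemma isCont_indicator_mult_exp:
  fixes u k :: real
  assumes "u \<noteq> 0"
  shows "isCont (\<lambda>u. indicator {0..} u * exp (k * u) :: real) u"
    and "isCont (\<lambda>u. indicator {..0} u * exp (k * u) :: real) u"
proof -
  have "isCont (indicator {0..} :: real \<Rightarrow> real) u" "isCont (indicator {..0} :: real \<Rightarrow> real) u"
    using assms by (simp_all add: isCont_indicator frontier_def)
  then show "isCont (\<lambda>u. indicator {0..} u * exp (k * u) :: real) u"
    "isCont (\<lambda>u. indicator {..0} u * exp (k * u) :: real) u"
    by (auto intro!: continuous_intros)
qed

text \<open>Division by \<lambda> + i r is convolution with exp (- r u) on u \<ge> 0, which
  preserves the half-line. The pole lies outside the upper half-plane, so an arbitrary constant may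
  be subtracted: it contributes the transform of c exp (- r y).\<close>

lemma half_line_transform_upper:
  assumes f: "exp_decaying_fun B \<delta> f" and r: "0 < r"
  shows "(\<lambda>lam. (laplace f (- \<i> * of_real lam) - c) / (of_real lam + \<i> * of_real r)) \<in> half_line_transforms 1"
proof -
  define \<phi> where "\<phi> u = indicator {0..} u * exp (- r * u)" for u :: real
  have \<phi>: "integrable lborel \<phi>" "\<And>u. \<bar>\<phi> u\<bar> \<le> 1" "\<And>u. u \<noteq> 0 \<Longrightarrow> isCont \<phi> u"
  proof -
    show "integrable lborel \<phi>" using has_bochner_integral_exp_Ici[OF r] unfolding \<phi>_def by (simp add: has_bochner_integral_iff)
    show "\<bar>\<phi> u\<bar> \<le> 1" for u using r unfolding \<phi>_def by (simp add: indicator_def)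
    show "isCont \<phi> u" if "u \<noteq> 0" for u
      unfolding \<phi>_def[abs_def] by (rule isCont_indicator_mult_exp(1)[OF that])
  qed
  note fi = exp_decaying_fun_integrable[OF f]
  define h where "h y = (LINT x|lborel. f x * of_real (\<phi> (y - x)))" for y
  have hc: "continuous_on UNIV h" and hi: "integrable lborel h"
    using continuous_conv[OF fi \<phi>] integrable_conv[OF fi \<phi>] unfolding h_def by auto
  \<comment> \<open>With \<bar>y\<bar> in the exponent k is continuous and integrable on the whole
    line, although only y \<ge> 0 enters the transform. The factor - i comes from w + r = - i
    (\<lambda> + i r).\<close>
  define k where "k y = - \<i> * (h y - c * of_real (exp (- r * \<bar>y\<bar>)))" for y
  have "integrable lborel (\<lambda>y. exp (- r * \<bar>y\<bar>))"
  proof -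
    have "integrable lborel (\<lambda>y. \<phi> y + \<phi> (0 + (-1) * y))"
      using lborel_integrable_real_affine[OF \<phi>(1), of "-1" 0] \<phi>(1) by (intro Bochner_Integration.integrable_add) auto
    then show ?thesis
      by (rule Bochner_Integration.integrable_bound) (auto intro!: AE_I2 simp: \<phi>_def indicator_def)
  qed
  then have ei: "integrable lborel (\<lambda>y. c * of_real (exp (- r * \<bar>y\<bar>)))" by simp
  then have ki: "integrable lborel k"
    unfolding k_def by (intro integrable_mult_right Bochner_Integration.integrable_diff hi ei)
  have kc: "continuous_on UNIV k" unfolding k_def by (intro continuous_intros hc)
  show ?thesis
  proof (rule half_line_transformsI[OF kc ki])
    fix lam :: real
    define w where "w = - \<i> * of_real lam"
    let ?I = "\<lambda>h. LINT y|lborel. indicator {0..} y *\<^sub>R (h y * exp (- w * of_real y))"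
    have w: "Re w = 0" and wr: "0 < Re (w + of_real r)" using r by (simp_all add: w_def)
    have wr0: "w + of_real r \<noteq> 0" using wr by force
    have inner: "?I (\<lambda>y. of_real (\<phi> (y - x))) = exp (- w * of_real x) / (w + of_real r)"
      if "0 \<le> x" for x
    proof -
      have "?I (\<lambda>y. of_real (\<phi> (y - x)))
        = (LINT u|lborel. indicator {0..} (x + 1 * u) *\<^sub>R (of_real (\<phi> (x + 1 * u - x)) * exp (- w * of_real (x + 1 * u))))"
        by (subst lborel_integral_real_affine[of 1 _ x]) simp_all
      also have "\<dots> = (LINT u|lborel. exp (- w * of_real x) * (indicator {0..} u *\<^sub>R exp (- (w + of_real r) * of_real u)))"
      proof (rule Bochner_Integration.integral_cong[OF refl])
        fix u :: real
        show "indicator {0..} (x + 1 * u) *\<^sub>R (of_real (\<phi> (x + 1 * u - x)) * exp (- w * of_real (x + 1 * u)))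
          = exp (- w * of_real x) * (indicator {0..} u *\<^sub>R exp (- (w + of_real r) * of_real u))"
        proof (cases "0 \<le> u")
          case True
          then show ?thesis using that
            by (simp add: \<phi>_def exp_of_real[symmetric] mult_exp_exp algebra_simps)
        qed (simp add: \<phi>_def)
      qed
      also have "\<dots> = exp (- w * of_real x) * (1 / (w + of_real r))"
        unfolding integral_mult_right_zero integral_exp_Ici(2)[OF wr] ..
      finally show ?thesis by simp
    qed
    have "?I h = laplace f w / (w + of_real r)"
    proof -
      have "?I h =
        (LINT x|lborel. f x * ?I (\<lambda>y. of_real (\<phi> (y - x))))"
        unfolding h_def by (rule conv_transform[OF fi \<phi> w])
      also have "\<dots> = (LINT x|lborel. f x * exp (- w * of_real x) / (w + of_real r))"
      proof (rule Bochner_Integration.integral_cong[OF refl])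
        fix x
        show "f x * ?I (\<lambda>y. of_real (\<phi> (y - x))) = f x * exp (- w * of_real x) / (w + of_real r)"
        proof (cases "x < 0")
          case False
          then show ?thesis by (subst inner) auto
        qed (simp add: exp_decaying_funD(4)[OF f])
      qed
      also have "\<dots> = laplace f w / (w + of_real r)" unfolding laplace_def by (rule integral_divide_zero)
      finally show ?thesis .
    qed
    moreover have "?I (\<lambda>y. c * of_real (exp (- r * \<bar>y\<bar>))) = c * (1 / (w + of_real r))"
    proof -
      have "?I (\<lambda>y. c * of_real (exp (- r * \<bar>y\<bar>)))
        = (LINT y|lborel. c * (indicator {0..} y *\<^sub>R exp (- (w + of_real r) * of_real y)))"
      proof (rule Bochner_Integration.integral_cong[OF refl])
        fix y :: real
        show "indicator {0..} y *\<^sub>R (c * of_real (exp (- r * \<bar>y\<bar>)) * exp (- w * of_real y)) = c * (indicator {0..} y *\<^sub>R exp (- (w + of_real r) * of_real y))"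
          by (cases "0 \<le> y") (simp_all add: exp_of_real[symmetric] mult_exp_exp algebra_simps)
      qed
      then show ?thesis unfolding integral_mult_right_zero integral_exp_Ici(2)[OF wr] .
    qed
    moreover have "?I k =
      - \<i> * (?I h -
        ?I (\<lambda>y. c * of_real (exp (- r * \<bar>y\<bar>))))"
      unfolding Bochner_Integration.integral_diff[OF integrable_phase[OF hi w] integrable_phase[OF ei w], symmetric]
        integral_mult_right_zero[symmetric] k_def
      by (intro Bochner_Integration.integral_cong refl) (simp add: algebra_simps scaleR_right_diff_distrib)
    ultimately have "?I k =
      - \<i> * (laplace f w / (w + of_real r) - c * (1 / (w + of_real r)))" by (simp only:)
    also have "\<dots> = (laplace f w - c) / (of_real lam + \<i> * of_real r)"
    proof -
      have *: "w + of_real r = - \<i> * (of_real lam + \<i> * of_real r)" by (simp add: w_def algebra_simps)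
      have "- \<i> * (a / (- \<i> * d) - c * (1 / (- \<i> * d))) = (a - c) / d" for a d :: complex
        by (cases "d = 0") (simp_all add: field_simps)
      then show ?thesis unfolding * .
    qed
    finally show "(laplace f (- \<i> * of_real lam) - c) / (of_real lam + \<i> * of_real r) =
      (LINT x|lborel. indicator {0..} x *\<^sub>R (k x * exp (- (- \<i> * of_real (1 * lam)) * of_real x)))"
      unfolding w_def by simp
  qed
qed

text \<open>Now the pole \<lambda> = - i r lies in the half-plane itself, and
  \<open>laplace f (of_real r)\<close> is the value of the transform there. Convolution with exp (r
  u) on u \<le> 0, cut off at y = 0, leaves an exponential integrated over [0, x], whose two
  endpoints produce the two terms of the numerator.\<close>

lemma half_line_transform_lower:
  assumes f: "exp_decaying_fun B \<delta> f" and r: "0 < r"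
  shows "(\<lambda>lam. (laplace f (\<i> * of_real lam) - laplace f (of_real r)) / (of_real lam + \<i> * of_real r)) \<in> half_line_transforms (- 1)"
proof -
  define \<phi> where "\<phi> u = indicator {..0} u * exp (r * u)" for u :: real
  have \<phi>: "integrable lborel \<phi>" "\<And>u. \<bar>\<phi> u\<bar> \<le> 1" "\<And>u. u \<noteq> 0 \<Longrightarrow> isCont \<phi> u"
  proof -
    have "integrable lborel (\<lambda>x. indicator {0..} x * exp (- r * x))"
      using has_bochner_integral_exp_Ici[OF r] by (simp add: has_bochner_integral_iff)
    from lborel_integrable_real_affine[OF this, of "-1" 0]
    have "integrable lborel (\<lambda>x. indicator {0..} (0 + - 1 * x) * exp (- r * (0 + - 1 * x)))" by simp
    moreover have "\<phi> \<in> borel_measurable lborel" unfolding \<phi>_def[abs_def] by measurable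
    ultimately show "integrable lborel \<phi>"
      by (rule Bochner_Integration.integrable_bound) (auto intro!: AE_I2 simp: \<phi>_def indicator_def)
    show "\<bar>\<phi> u\<bar> \<le> 1" for u using r unfolding \<phi>_def by (simp add: indicator_def mult_nonneg_nonpos)
    show "isCont \<phi> u" if "u \<noteq> 0" for u
      unfolding \<phi>_def[abs_def] by (rule isCont_indicator_mult_exp(2)[OF that])
  qed
  note fi = exp_decaying_fun_integrable[OF f]
  define h where "h y = (LINT x|lborel. f x * of_real (\<phi> (y - x)))" for y
  have hc: "continuous_on UNIV h" and hi: "integrable lborel h"
    using continuous_conv[OF fi \<phi>] integrable_conv[OF fi \<phi>] unfolding h_def by auto
  show ?thesis
  proof (rule half_line_transformsI[of "\<lambda>y. - \<i> * h y"])
    show "continuous_on UNIV (\<lambda>y. - \<i> * h y)" by (intro continuous_intros hc)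
    show "integrable lborel (\<lambda>y. - \<i> * h y)" using hi by simp
    fix lam :: real
    define w where "w = \<i> * of_real lam"
    let ?I = "\<lambda>h. LINT y|lborel. indicator {0..} y *\<^sub>R (h y * exp (- w * of_real y))"
    have w: "Re w = 0" by (simp add: w_def)
    have rw0: "of_real r - w \<noteq> 0" using r w by (metis Re_complex_of_real eq_iff_diff_eq_0 less_irrefl)
    have inner: "?I (\<lambda>y. of_real (\<phi> (y - x))) =
        (exp (- w * of_real x) - exp (- of_real r * of_real x)) / (of_real r - w)"
      if "0 \<le> x" for x
    proof -
      have "?I (\<lambda>y. of_real (\<phi> (y - x)))
        = (LINT y|lborel. exp (- of_real r * of_real x) * (indicator {0..x} y *\<^sub>R exp ((of_real r - w) * of_real y)))"
      proof (rule Bochner_Integration.integral_cong[OF refl])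
        fix y :: real
        show "indicator {0..} y *\<^sub>R (of_real (\<phi> (y - x)) * exp (- w * of_real y))
          = exp (- of_real r * of_real x) * (indicator {0..x} y *\<^sub>R exp ((of_real r - w) * of_real y))"
          by (cases "0 \<le> y"; cases "y \<le> x")
            (simp_all add: \<phi>_def exp_of_real[symmetric] mult_exp_exp algebra_simps)
      qed
      also have "\<dots> = exp (- of_real r * of_real x) * ((exp ((of_real r - w) * of_real x) - exp ((of_real r - w) * of_real 0)) / (of_real r - w))"
        unfolding integral_mult_right_zero integral_exp_Icc[OF that rw0] ..
      also have "\<dots> = (exp (- of_real r * of_real x) * exp ((of_real r - w) * of_real x) - exp (- of_real r * of_real x)) / (of_real r - w)"
        by (simp add: right_diff_distrib)
      also have "exp (- of_real r * of_real x) * exp ((of_real r - w) * of_real x) = exp (- w * of_real x)"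
        unfolding mult_exp_exp by (simp add: algebra_simps)
      finally show ?thesis .
    qed
    have "?I h = (laplace f w - laplace f (of_real r)) / (of_real r - w)"
    proof -
      have "?I h =
        (LINT x|lborel. f x * ?I (\<lambda>y. of_real (\<phi> (y - x))))"
        unfolding h_def by (rule conv_transform[OF fi \<phi> w])
      also have "\<dots> = (LINT x|lborel. (f x * exp (- w * of_real x) - f x * exp (- of_real r * of_real x)) / (of_real r - w))"
      proof (rule Bochner_Integration.integral_cong[OF refl])
        fix x
        show "f x * ?I (\<lambda>y. of_real (\<phi> (y - x))) =
          (f x * exp (- w * of_real x) - f x * exp (- of_real r * of_real x)) / (of_real r - w)"
        proof (cases "x < 0")
          case False
          then show ?thesis by (subst inner) (auto simp: right_diff_distrib)
        qed (simp add: exp_decaying_funD(4)[OF f])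
      qed
      also have "\<dots> = (laplace f w - laplace f (of_real r)) / (of_real r - w)"
        unfolding laplace_def integral_divide_zero
        using laplace_norm_bound(1)[OF f, of w] laplace_norm_bound(1)[OF f, of "of_real r"]
          exp_decaying_funD(2)[OF f] r w by simp
      finally show ?thesis .
    qed
    moreover have "?I (\<lambda>y. - \<i> * h y) =
      - \<i> * ?I h"
      unfolding integral_mult_right_zero[symmetric]
      by (intro Bochner_Integration.integral_cong refl) simp
    ultimately have "?I (\<lambda>y. - \<i> * h y) =
      - \<i> * ((laplace f w - laplace f (of_real r)) / (of_real r - w))" by (simp only:)
    also have "\<dots> = (laplace f w - laplace f (of_real r)) / (of_real lam + \<i> * of_real r)"
    proof -
      have *: "of_real r - w = - \<i> * (of_real lam + \<i> * of_real r)" by (simp add: w_def algebra_simps)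
      have "- \<i> * (a / (- \<i> * d)) = a / d" for a d :: complex
        by (cases "d = 0") (simp_all add: field_simps)
      then show ?thesis unfolding * .
    qed
    finally show "(laplace f (\<i> * of_real lam) - laplace f (of_real r)) / (of_real lam + \<i> * of_real r) =
      (LINT x|lborel. indicator {0..} x *\<^sub>R (- \<i> * h x * exp (- (- \<i> * of_real (- 1 * lam)) * of_real x)))"
      unfolding w_def by simp
  qed
qed

section \<open>Uniqueness in the Riemann--Hilbert problem\<close>

text \<open>Compared with \<open>half_line_transforms\<close>, continuity of f is traded for
  exponential decay. F is tied to the transform only on the closed half-plane.\<close>

definition half_plane_transform :: "real \<Rightarrow> (complex \<Rightarrow> complex) \<Rightarrow> bool" where
  "half_plane_transform sg F \<longleftrightarrow> (\<exists>B \<delta> f. exp_decaying_fun B \<delta> f \<and>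
     (\<forall>z. 0 \<le> sg * Im z \<longrightarrow> F z = laplace f (- \<i> * of_real sg * z)))"

lemma half_plane_transform_add:
  assumes "half_plane_transform sg F" "half_plane_transform sg G"
  shows "half_plane_transform sg (\<lambda>z. F z + G z)"
proof -
  obtain B \<delta> f where f: "exp_decaying_fun B \<delta> f" and F: "\<And>z. 0 \<le> sg * Im z \<Longrightarrow> F z = laplace f (- \<i> * of_real sg * z)"
    using assms(1) unfolding half_plane_transform_def by blast
  obtain C \<epsilon> g where g: "exp_decaying_fun C \<epsilon> g" and G: "\<And>z. 0 \<le> sg * Im z \<Longrightarrow> G z = laplace g (- \<i> * of_real sg * z)"
    using assms(2) unfolding half_plane_transform_def by blast
  define \<eta> where "\<eta> = min \<delta> \<epsilon>"
  have \<eta>: "0 < \<eta>" "\<eta> \<le> \<delta>" "\<eta> \<le> \<epsilon>" using exp_decaying_funD(2)[OF f] exp_decaying_funD(2)[OF g] by (auto simp: \<eta>_def)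
  note f' = exp_decaying_fun_mono[OF f \<eta>(1,2)] and g' = exp_decaying_fun_mono[OF g \<eta>(1,3)]
  have [measurable]: "f \<in> borel_measurable borel" "g \<in> borel_measurable borel"
    using exp_decaying_funD(3)[OF f] exp_decaying_funD(3)[OF g] .
  have "norm (f x + g x) \<le> indicator {0..} x * ((B + C) * exp (- \<eta> * x))" for x
  proof (cases "x < 0")
    case False
    have "norm (f x + g x) \<le> B * exp (- \<eta> * x) + C * exp (- \<eta> * x)"
      by (intro order_trans[OF norm_triangle_ineq] add_mono exp_decaying_funD(5)[OF f'] exp_decaying_funD(5)[OF g'])
    then show ?thesis using False by (simp add: distrib_right)
  qed (simp add: exp_decaying_funD(4)[OF f] exp_decaying_funD(4)[OF g])
  then have "exp_decaying_fun (B + C) \<eta> (\<lambda>x. f x + g x)"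
    using \<eta>(1) exp_decaying_funD(1)[OF f] exp_decaying_funD(1)[OF g] unfolding exp_decaying_fun_def by auto
  moreover have "F z + G z = laplace (\<lambda>x. f x + g x) (- \<i> * of_real sg * z)" if "0 \<le> sg * Im z" for z
  proof -
    have "- \<eta> < Re (- \<i> * of_real sg * z)" using that \<eta>(1) by simp
    from laplace_norm_bound(1)[OF f' this] laplace_norm_bound(1)[OF g' this] show ?thesis
      unfolding F[OF that] G[OF that] laplace_def distrib_right by (rule Bochner_Integration.integral_add[symmetric])
  qed
  ultimately show ?thesis unfolding half_plane_transform_def by blast
qed

lemma half_plane_transform_cmult:
  assumes "half_plane_transform sg F"
  shows "half_plane_transform sg (\<lambda>z. c * F z)"
proof -
  obtain B \<delta> f where f: "exp_decaying_fun B \<delta> f" and F: "\<And>z. 0 \<le> sg * Im z \<Longrightarrow> F z = laplace f (- \<i> * of_real sg * z)"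
    using assms(1) unfolding half_plane_transform_def by blast
  have [measurable]: "f \<in> borel_measurable borel" by (rule exp_decaying_funD(3)[OF f])
  have "norm (c * f x) \<le> indicator {0..} x * (norm c * B * exp (- \<delta> * x))" for x
    using exp_decaying_funD(5)[OF f, of x] exp_decaying_funD(4)[OF f, of x]
    by (cases "x < 0") (simp_all add: norm_mult mult.assoc mult_left_mono)
  then have "exp_decaying_fun (norm c * B) \<delta> (\<lambda>x. c * f x)"
    using exp_decaying_funD(1,2)[OF f] unfolding exp_decaying_fun_def by auto
  moreover have "c * F z = laplace (\<lambda>x. c * f x) (- \<i> * of_real sg * z)" if "0 \<le> sg * Im z" for z
    unfolding F[OF that] laplace_def mult.assoc[of c] by (rule integral_mult_right_zero[symmetric])
  ultimately show ?thesis unfolding half_plane_transform_def by blast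
qed

lemma half_plane_transform_zero: "half_plane_transform sg (\<lambda>z. 0)"
proof -
  have "exp_decaying_fun 0 1 (\<lambda>x. 0)" by (simp add: exp_decaying_fun_def)
  moreover have "laplace (\<lambda>x. 0) w = 0" for w by (simp add: laplace_def)
  ultimately show ?thesis unfolding half_plane_transform_def by metis
qed

lemma half_plane_transform_diff:
  assumes "half_plane_transform sg F" "half_plane_transform sg G"
  shows "half_plane_transform sg (\<lambda>z. F z - G z)"
  using half_plane_transform_add[OF assms(1) half_plane_transform_cmult[OF assms(2), of "- 1"]] by simp

lemma half_plane_transform_sum:
  assumes "finite I" "\<And>i. i \<in> I \<Longrightarrow> half_plane_transform sg (F i)"
  shows "half_plane_transform sg (\<lambda>z. \<Sum>i\<in>I. F i z)"
  using assms by (induction I rule: finite_induct) (auto intro: half_plane_transform_zero half_plane_transform_add)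

text \<open>Exponential decay moves the domain of holomorphy beyond the real axis, to sg * Im z > -
  \<delta>, which yields continuity up to the axis. The last bound gives decay along the imaginary
  axis without an appeal to the Riemann--Lebesgue lemma.\<close>

lemma half_plane_transform_analytic:
  assumes "half_plane_transform sg F"
  shows "F holomorphic_on {z. 0 < sg * Im z}" "continuous_on {z. 0 \<le> sg * Im z} F"
    and "\<exists>K. \<forall>z. 0 \<le> sg * Im z \<longrightarrow> norm (F z) \<le> K"
    and "\<exists>B. \<forall>z. 0 < sg * Im z \<longrightarrow> norm (F z) \<le> B / (sg * Im z)"
proof -
  obtain B \<delta> f where f: "exp_decaying_fun B \<delta> f" and F: "\<And>z. 0 \<le> sg * Im z \<Longrightarrow> F z = laplace f (- \<i> * of_real sg * z)"
    using assms(1) unfolding half_plane_transform_def by blast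
  have \<delta>: "0 < \<delta>" and B: "0 \<le> B" using exp_decaying_funD[OF f] by auto
  have "(laplace f \<circ> (\<lambda>z. - \<i> * of_real sg * z)) holomorphic_on {z. - \<delta> < sg * Im z}"
    by (rule holomorphic_on_compose_gen[OF _ laplace_holomorphic[OF f]]) (auto intro!: holomorphic_intros)
  then have hol: "(\<lambda>z. laplace f (- \<i> * of_real sg * z)) holomorphic_on {z. - \<delta> < sg * Im z}" unfolding o_def .
  have "(\<lambda>z. laplace f (- \<i> * of_real sg * z)) holomorphic_on {z. 0 < sg * Im z}"
    by (rule holomorphic_on_subset[OF hol]) (use \<delta> in force)
  then show "F holomorphic_on {z. 0 < sg * Im z}" by (rule holomorphic_transform) (simp add: F)
  have "continuous_on {z. 0 \<le> sg * Im z} (\<lambda>z. laplace f (- \<i> * of_real sg * z))"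
    by (rule continuous_on_subset[OF holomorphic_on_imp_continuous_on[OF hol]]) (use \<delta> in force)
  then show "continuous_on {z. 0 \<le> sg * Im z} F" by (rule continuous_on_eq) (simp add: F)
  have bd: "norm (F z) \<le> B / (\<delta> + sg * Im z)" if "0 \<le> sg * Im z" for z
    using laplace_norm_bound(2)[OF f, of "- \<i> * of_real sg * z"] that \<delta> by (simp add: F)
  have "norm (F z) \<le> B / \<delta>" if "0 \<le> sg * Im z" for z
  proof -
    have "B / (\<delta> + sg * Im z) \<le> B / \<delta>" using that \<delta> B by (intro divide_left_mono mult_pos_pos) auto
    then show ?thesis using bd[OF that] by simp
  qed
  then show "\<exists>K. \<forall>z. 0 \<le> sg * Im z \<longrightarrow> norm (F z) \<le> K" by blast
  have "norm (F z) \<le> B / (sg * Im z)" if "0 < sg * Im z" for z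
  proof -
    have "B / (\<delta> + sg * Im z) \<le> B / (sg * Im z)" using that \<delta> B by (intro frac_le) auto
    then show ?thesis using bd[of z] that by simp
  qed
  then show "\<exists>B. \<forall>z. 0 < sg * Im z \<longrightarrow> norm (F z) \<le> B / (sg * Im z)" by blast
qed

lemma half_plane_transform_radial:
  assumes "half_plane_transform sg F" "\<bar>sg\<bar> = 1"
  shows "((\<lambda>s. F (\<i> * of_real (sg * s))) \<longlongrightarrow> 0) at_top"
proof -
  obtain B where B: "\<And>z. 0 < sg * Im z \<Longrightarrow> norm (F z) \<le> B / (sg * Im z)"
    using half_plane_transform_analytic(4)[OF assms(1)] by blast
  have sg: "sg * sg = 1" using assms(2) by (auto simp: abs_if split: if_splits)
  have "norm (F (\<i> * of_real (sg * s))) \<le> B / s" if "0 < s" for s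
    using B[of "\<i> * of_real (sg * s)"] that sg by (simp add: mult.assoc[symmetric])
  then have "\<forall>\<^sub>F s in at_top. norm (F (\<i> * of_real (sg * s))) \<le> B / s"
    using eventually_gt_at_top[of 0] by (rule eventually_mono[rotated])
  moreover have "((\<lambda>s. B / s) \<longlongrightarrow> 0) at_top" by real_asymp
  ultimately show ?thesis by (rule Lim_null_comparison)
qed

section \<open>Scalar entries admissible in the Riemann--Hilbert problem\<close>

definition rh_entry :: "real \<Rightarrow> (complex \<Rightarrow> complex) \<Rightarrow> bool" where
  "rh_entry sg F \<longleftrightarrow> F holomorphic_on {z. 0 < sg * Im z} \<and> continuous_on {z. 0 \<le> sg * Im z} F \<and>
     (F \<longlongrightarrow> 0) (inf at_infinity (principal {z. 0 \<le> sg * Im z})) \<and>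
     (\<lambda>lam. F (of_real lam)) \<in> half_line_transforms sg"

lemma rh_unknown_iff:
  "rh_unknown n sg X \<longleftrightarrow> (\<forall>z. 0 \<le> sg * Im z \<longrightarrow> X z \<in> carrier_mat n n) \<and>
     (\<forall>k<n. \<forall>j<n. rh_entry sg (\<lambda>z. X z $$ (k, j)))"
  unfolding rh_unknown_def rh_entry_def ..

lemma half_line_transforms_add:
  assumes "F \<in> half_line_transforms sg" "G \<in> half_line_transforms sg"
  shows "(\<lambda>lam. F lam + G lam) \<in> half_line_transforms sg"
proof -
  obtain f where f: "continuous_on {0..} f" "set_integrable lebesgue {0..} f"
    "\<And>lam. F lam = (LINT x:{0..}|lebesgue. f x * exp (\<i> * of_real (sg * lam * x)))"
    using assms(1) unfolding half_line_transforms_def by blast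
  obtain g where g: "continuous_on {0..} g" "set_integrable lebesgue {0..} g"
    "\<And>lam. G lam = (LINT x:{0..}|lebesgue. g x * exp (\<i> * of_real (sg * lam * x)))"
    using assms(2) unfolding half_line_transforms_def by blast
  have int: "set_integrable lebesgue {0..} (\<lambda>x. k x * exp (\<i> * of_real (sg * lam * x)))"
    if "set_integrable lebesgue {0..} k" for k :: "real \<Rightarrow> complex" and lam
    unfolding set_integrable_def
  proof (rule Bochner_Integration.integrable_bound[OF that[unfolded set_integrable_def]])
    note [measurable] = borel_measurable_integrable[OF that[unfolded set_integrable_def]]
    have [measurable]: "(\<lambda>x. exp (\<i> * complex_of_real (sg * lam * x))) \<in> borel_measurable lebesgue"
      by (rule measurable_completion) measurable
    have "(\<lambda>x. (indicat_real {0..} x *\<^sub>R k x) * exp (\<i> * complex_of_real (sg * lam * x))) \<in> borel_measurable lebesgue"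
      by measurable
    then show "(\<lambda>x. indicat_real {0..} x *\<^sub>R (k x * exp (\<i> * complex_of_real (sg * lam * x)))) \<in> borel_measurable lebesgue"
      by simp
  qed (simp add: norm_mult)
  have "F lam + G lam = (LINT x:{0..}|lebesgue. (f x + g x) * exp (\<i> * of_real (sg * lam * x)))" for lam
    unfolding f(3) g(3) distrib_right using set_integral_add(2)[OF int[OF f(2)] int[OF g(2)]] by simp
  then show ?thesis
    unfolding half_line_transforms_def using continuous_on_add[OF f(1) g(1)] set_integral_add(1)[OF f(2) g(2)]
    by blast
qed

lemma rh_entry_add:
  assumes "rh_entry sg F" "rh_entry sg G" shows "rh_entry sg (\<lambda>z. F z + G z)"
  using assms tendsto_add[of F 0 _ G 0] unfolding rh_entry_def
  by (auto intro!: holomorphic_intros continuous_intros half_line_transforms_add)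

text \<open>The linear denominator supplies the decay in all directions that the unknowns must have
  at infinity, so boundedness of the transforms suffices.\<close>

lemma tendsto_bounded_over_linear:
  fixes N :: "complex \<Rightarrow> complex"
  assumes "\<And>z. z \<in> S \<Longrightarrow> norm (N z) \<le> K"
  shows "((\<lambda>z. N z / (z + a)) \<longlongrightarrow> 0) (inf at_infinity (principal S))"
proof (rule Lim_null_comparison)
  show "\<forall>\<^sub>F z in inf at_infinity (principal S). norm (N z / (z + a)) \<le> K / norm (z + a)"
    unfolding eventually_inf_principal using assms
    by (intro always_eventually allI impI) (simp add: norm_divide divide_right_mono)
  have "filterlim (\<lambda>z. a + z) at_infinity at_infinity" by (rule tendsto_add_filterlim_at_infinity[OF tendsto_const filterlim_ident])
  then have "filterlim (\<lambda>z. norm (z + a)) at_top at_infinity"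
    unfolding filterlim_at_infinity_conv_norm_at_top by (simp add: add.commute)
  then have "((\<lambda>z. K / norm (z + a)) \<longlongrightarrow> 0) at_infinity" by (intro real_tendsto_divide_at_top[OF tendsto_const])
  then show "((\<lambda>z. K / norm (z + a)) \<longlongrightarrow> 0) (inf at_infinity (principal S))" by (rule tendsto_mono[rotated]) simp
qed

lemma rh_entry_upper:
  assumes F: "half_plane_transform 1 F" and r: "0 < r"
  shows "rh_entry 1 (\<lambda>z. (F z - c) / (z + \<i> * of_real r))"
proof -
  have ne: "z + \<i> * of_real r \<noteq> 0" if "0 \<le> Im z" for z
  proof
    assume "z + \<i> * of_real r = 0"
    then have "Im (z + \<i> * of_real r) = 0" by simp
    then show False using that r by simp
  qed
  note A = half_plane_transform_analytic[OF F, simplified]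
  obtain K where K: "\<And>z. 0 \<le> Im z \<Longrightarrow> norm (F z) \<le> K" using A(3) by blast
  obtain B \<delta> f where f: "exp_decaying_fun B \<delta> f" and Ff: "\<And>z. 0 \<le> 1 * Im z \<Longrightarrow> F z = laplace f (- \<i> * of_real 1 * z)"
    using F unfolding half_plane_transform_def by blast
  have "(\<lambda>z. (F z - c) / (z + \<i> * of_real r)) holomorphic_on {z. 0 < Im z}"
    using ne by (intro holomorphic_intros A) auto
  moreover have "continuous_on {z. 0 \<le> Im z} (\<lambda>z. (F z - c) / (z + \<i> * of_real r))"
    using ne by (intro continuous_intros A) auto
  moreover have "((\<lambda>z. (F z - c) / (z + \<i> * of_real r)) \<longlongrightarrow> 0) (inf at_infinity (principal {z. 0 \<le> Im z}))"
  proof (rule tendsto_bounded_over_linear[where K = "K + norm c"])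
    show "norm (F z - c) \<le> K + norm c" if "z \<in> {z. 0 \<le> Im z}" for z
      using K[of z] that norm_triangle_ineq4[of "F z" c] by simp
  qed
  moreover have "(\<lambda>lam. (F (of_real lam) - c) / (of_real lam + \<i> * of_real r)) \<in> half_line_transforms 1"
    using half_line_transform_upper[OF f r, of c] by (simp add: Ff)
  ultimately show ?thesis unfolding rh_entry_def by simp
qed

text \<open>Subtracting F a makes the pole at a removable, and \<open>deriv F a\<close> is the value
  that keeps the quotient holomorphic.\<close>

lemma rh_entry_lower:
  fixes F :: "complex \<Rightarrow> complex" and r :: real
  assumes F: "half_plane_transform (- 1) F" and r: "0 < r"
  defines "a \<equiv> - \<i> * of_real r"
  shows "rh_entry (- 1) (\<lambda>z. if z = a then deriv F a else (F z - F a) / (z - a))" (is "rh_entry _ ?G")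
proof -
  have Im_a: "Im a = - r" by (simp add: a_def)
  note A = half_plane_transform_analytic[OF F, simplified]
  obtain K where K: "\<And>z. Im z \<le> 0 \<Longrightarrow> norm (F z) \<le> K" using A(3) by auto
  obtain B \<delta> f where f: "exp_decaying_fun B \<delta> f" and Ff: "\<And>z. 0 \<le> - 1 * Im z \<Longrightarrow> F z = laplace f (- \<i> * of_real (- 1) * z)"
    using F unfolding half_plane_transform_def by blast
  have hol: "?G holomorphic_on {z. Im z < 0}"
    by (rule pole_lemma_open[OF A(1) open_halfspace_Im_lt])
  moreover have "continuous_on {z. Im z \<le> 0} ?G"
  proof -
    \<comment> \<open>Holomorphy settles the open half-plane, including a. The strip above height -
      r contains the real axis and avoids a. Both sets are relatively open, so continuity can be
      glued.\<close>
    let ?S = "{z. Im z < 0}" and ?T = "{z. Im z \<le> 0 \<and> - r < Im z}"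
    have un: "{z. Im z \<le> 0} = ?S \<union> ?T" using r by auto
    have "continuous_on ?T (\<lambda>z. (F z - F a) / (z - a))"
      using Im_a by (intro continuous_intros continuous_on_subset[OF A(2)]) auto
    then have T: "continuous_on ?T ?G"
      by (rule continuous_on_eq) (use Im_a in auto)
    have "openin (top_of_set (?S \<union> ?T)) ?S"
      unfolding openin_open by (intro exI[of _ ?S] conjI open_halfspace_Im_lt) auto
    moreover have "openin (top_of_set (?S \<union> ?T)) ?T"
      unfolding openin_open by (intro exI[of _ "{z. - r < Im z}"] conjI open_halfspace_Im_gt) auto
    ultimately show ?thesis
      unfolding un by (rule continuous_on_Un_local_open[OF _ _ holomorphic_on_imp_continuous_on[OF hol] T])
  qed
  moreover have "(?G \<longlongrightarrow> 0) (inf at_infinity (principal {z. Im z \<le> 0}))"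
  proof -
    have "((\<lambda>z. (F z - F a) / (z + - a)) \<longlongrightarrow> 0) (inf at_infinity (principal {z. Im z \<le> 0}))"
    proof (rule tendsto_bounded_over_linear[where K = "K + norm (F a)"])
      show "norm (F z - F a) \<le> K + norm (F a)" if "z \<in> {z. Im z \<le> 0}" for z
        using K[of z] that norm_triangle_ineq4[of "F z" "F a"] by simp
    qed
    moreover have "\<forall>\<^sub>F z in inf at_infinity (principal {z. Im z \<le> 0}). z \<noteq> a"
    proof -
      have "\<forall>\<^sub>F z in at_infinity. z \<noteq> a"
        unfolding eventually_at_infinity by (intro exI[of _ "norm a + 1"]) auto
      then show ?thesis unfolding eventually_inf_principal by eventually_elim simp
    qed
    then have "\<forall>\<^sub>F z in inf at_infinity (principal {z. Im z \<le> 0}). (F z - F a) / (z + - a) = ?G z"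
      by eventually_elim simp
    ultimately show ?thesis by (rule Lim_transform_eventually)
  qed
  moreover have "(\<lambda>lam. ?G (of_real lam)) \<in> half_line_transforms (- 1)"
  proof -
    have "F a = laplace f (of_real r)" using Ff[of a] Im_a r by (simp add: a_def)
    moreover have "complex_of_real lam \<noteq> a" for lam
      using Im_a r by (metis Im_complex_of_real less_irrefl neg_equal_0_iff_equal)
    ultimately have "(\<lambda>lam. ?G (of_real lam)) =
        (\<lambda>lam. (laplace f (\<i> * of_real lam) - laplace f (of_real r)) / (of_real lam + \<i> * of_real r))"
      using Ff by (auto simp: a_def fun_eq_iff)
    then show ?thesis using half_line_transform_lower[OF f r] by simp
  qed
  ultimately show ?thesis unfolding rh_entry_def by simp
qed

section \<open>Matrix inverses and matrices of transforms\<close>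

lemma mat_inv_Units:
  fixes M :: "complex mat"
  assumes "M \<in> carrier_mat n n" "M \<in> Units (ring_mat TYPE(complex) n ())"
  shows "mat_inv M \<in> carrier_mat n n" "M * mat_inv M = 1\<^sub>m n" "mat_inv M * M = 1\<^sub>m n"
proof -
  obtain B where B: "mat_inverse M = Some B"
    using mat_inverse(1)[OF assms(1), where b = "()"] assms(2) by (cases "mat_inverse M") blast+
  from mat_inverse(2)[OF assms(1) B] show "mat_inv M \<in> carrier_mat n n" "M * mat_inv M = 1\<^sub>m n" "mat_inv M * M = 1\<^sub>m n"
    by (simp_all add: B)
qed

lemma mat_inv_invertible:
  fixes M :: "complex mat"
  assumes M: "M \<in> carrier_mat n n" and "invertible_mat M"
  shows "mat_inv M \<in> carrier_mat n n" "M * mat_inv M = 1\<^sub>m n" "mat_inv M * M = 1\<^sub>m n"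
proof -
  obtain B where B: "M * B = 1\<^sub>m n" "B * M = 1\<^sub>m (dim_row B)"
    using assms unfolding invertible_mat_def inverts_mat_def by auto
  have "dim_col B = n" using arg_cong[OF B(1), of dim_col] by simp
  moreover have "dim_row B = n" using arg_cong[OF B(2), of dim_col] M by simp
  ultimately have "B \<in> carrier_mat n n" by auto
  then have "M \<in> Units (ring_mat TYPE(complex) n ())"
    unfolding Units_def using M B by (auto simp: ring_mat_simps)
  from mat_inv_Units[OF M this] show "mat_inv M \<in> carrier_mat n n" "M * mat_inv M = 1\<^sub>m n" "mat_inv M * M = 1\<^sub>m n" .
qed

definition mat_transform :: "nat \<Rightarrow> real \<Rightarrow> (complex \<Rightarrow> complex mat) \<Rightarrow> bool" where
  "mat_transform n sg X \<longleftrightarrow> (\<forall>z. X z \<in> carrier_mat n n) \<and>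
     (\<forall>k<n. \<forall>j<n. half_plane_transform sg (\<lambda>z. X z $$ (k, j)))"

lemma mat_transform_carrier: "mat_transform n sg X \<Longrightarrow> X z \<in> carrier_mat n n"
  unfolding mat_transform_def by blast

lemma mat_transform_entry: "mat_transform n sg X \<Longrightarrow> k < n \<Longrightarrow> j < n \<Longrightarrow> half_plane_transform sg (\<lambda>z. X z $$ (k, j))"
  unfolding mat_transform_def by blast

lemma mat_transform_diff:
  assumes X: "mat_transform n sg X" and Y: "mat_transform n sg Y"
  shows "mat_transform n sg (\<lambda>z. X z - Y z)"
  unfolding mat_transform_def
proof (intro conjI allI impI)
  show "X z - Y z \<in> carrier_mat n n" for z using mat_transform_carrier[OF Y] by (intro minus_carrier_mat)
  fix k j assume kj: "k < n" "j < n"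
  have "(\<lambda>z. (X z - Y z) $$ (k, j)) = (\<lambda>z. X z $$ (k, j) - Y z $$ (k, j))"
    using kj carrier_matD[OF mat_transform_carrier[OF Y]] by simp
  then show "half_plane_transform sg (\<lambda>z. (X z - Y z) $$ (k, j))"
    using half_plane_transform_diff[OF mat_transform_entry[OF X kj] mat_transform_entry[OF Y kj]] by simp
qed

lemma mat_transform_mult_left:
  assumes X: "mat_transform n sg X" and M: "M \<in> carrier_mat n n"
  shows "mat_transform n sg (\<lambda>z. M * X z)"
  unfolding mat_transform_def
proof (intro conjI allI impI)
  show "M * X z \<in> carrier_mat n n" for z using mat_transform_carrier[OF X] M by (intro mult_carrier_mat)
  fix k j assume kj: "k < n" "j < n"
  have "(\<lambda>z. (M * X z) $$ (k, j)) = (\<lambda>z. \<Sum>l<n. M $$ (k, l) * X z $$ (l, j))"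
  proof
    fix z
    show "(M * X z) $$ (k, j) = (\<Sum>l<n. M $$ (k, l) * X z $$ (l, j))"
      using kj M mat_transform_carrier[OF X, of z] by (simp add: scalar_prod_def lessThan_atLeast0)
  qed
  then show "half_plane_transform sg (\<lambda>z. (M * X z) $$ (k, j))"
    using kj by (auto intro!: half_plane_transform_sum half_plane_transform_cmult mat_transform_entry[OF X])
qed

lemma mat_transform_mult_right:
  assumes X: "mat_transform n sg X" and M: "M \<in> carrier_mat n n"
  shows "mat_transform n sg (\<lambda>z. X z * M)"
  unfolding mat_transform_def
proof (intro conjI allI impI)
  show "X z * M \<in> carrier_mat n n" for z using mat_transform_carrier[OF X] M by (intro mult_carrier_mat)
  fix k j assume kj: "k < n" "j < n"
  have "(\<lambda>z. (X z * M) $$ (k, j)) = (\<lambda>z. \<Sum>l<n. M $$ (l, j) * X z $$ (k, l))"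
  proof
    fix z
    show "(X z * M) $$ (k, j) = (\<Sum>l<n. M $$ (l, j) * X z $$ (k, l))"
      using kj M mat_transform_carrier[OF X, of z] by (simp add: scalar_prod_def lessThan_atLeast0 mult.commute)
  qed
  then show "half_plane_transform sg (\<lambda>z. (X z * M) $$ (k, j))"
    using kj by (auto intro!: half_plane_transform_sum half_plane_transform_cmult mat_transform_entry[OF X])
qed

text \<open>Along the imaginary axis the entries tend to those of the identity, and the determinant
  is a polynomial in the entries.\<close>

lemma mat_transform_eventually_invertible:
  assumes X: "mat_transform n sg X" and sg: "\<bar>sg\<bar> = 1"
  shows "\<forall>\<^sub>F s in at_top. Determinant.det (1\<^sub>m n + X (\<i> * of_real (sg * s))) \<noteq> 0"
proof -
  let ?M = "\<lambda>s. 1\<^sub>m n + X (\<i> * of_real (sg * s))"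
  have car: "?M s \<in> carrier_mat n n" for s using mat_transform_carrier[OF X] by simp
  have ent: "((\<lambda>s. ?M s $$ (k, j)) \<longlongrightarrow> (1\<^sub>m n :: complex mat) $$ (k, j)) at_top" if kj: "k < n" "j < n" for k j
  proof -
    have "(\<lambda>s. ?M s $$ (k, j)) = (\<lambda>s. (1\<^sub>m n :: complex mat) $$ (k, j) + X (\<i> * of_real (sg * s)) $$ (k, j))"
      using kj carrier_matD[OF mat_transform_carrier[OF X]] by simp
    then show ?thesis
      using tendsto_add[OF tendsto_const half_plane_transform_radial[OF mat_transform_entry[OF X kj] sg]] by simp
  qed
  have "((\<lambda>s. Determinant.det (?M s)) \<longlongrightarrow> Determinant.det (1\<^sub>m n :: complex mat)) at_top"
    unfolding det_def'[OF car] det_def'[OF one_carrier_mat]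
    by (intro tendsto_sum tendsto_mult tendsto_const tendsto_prod ent) (auto simp: permutes_in_image)
  then have "((\<lambda>s. Determinant.det (?M s)) \<longlongrightarrow> 1) at_top" by simp
  then show ?thesis by (rule tendsto_imp_eventually_ne) simp
qed

text \<open>A transform tends to 0 along the imaginary axis, so a constant value must be 0, and
  continuity carries this to the real axis. The point a is exempted because at a removable pole the
  quotient encodes a derivative and not a value.\<close>

lemma mat_transform_zero_on_axis:
  assumes X: "mat_transform n sg X" and sg: "\<bar>sg\<bar> = 1"
    and z0: "\<And>z. 0 < sg * Im z \<Longrightarrow> z \<noteq> a \<Longrightarrow> X z = M" and M: "M \<in> carrier_mat n n"
  shows "M = 0\<^sub>m n n" "X (of_real lam) = 0\<^sub>m n n"
proof -
  have sg2: "sg * sg = 1" using sg by (auto simp: abs_if split: if_splits)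
  show M0: "M = 0\<^sub>m n n"
  proof (rule eq_matI)
    fix k j assume kj: "k < dim_row (0\<^sub>m n n :: complex mat)" "j < dim_col (0\<^sub>m n n :: complex mat)"
    have "\<forall>\<^sub>F s in at_top. X (\<i> * of_real (sg * s)) $$ (k, j) = M $$ (k, j)"
      using eventually_gt_at_top[of "norm a"]
    proof eventually_elim
      fix s assume s: "norm a < s"
      then have "0 < s" using norm_ge_zero[of a] by linarith
      moreover have "norm (\<i> * complex_of_real (sg * s)) = s" using sg \<open>0 < s\<close> by (simp add: norm_mult abs_mult)
      ultimately show "X (\<i> * of_real (sg * s)) $$ (k, j) = M $$ (k, j)"
        using s sg2 by (subst z0) (auto simp: mult.assoc[symmetric])
    qed
    then have "((\<lambda>s. X (\<i> * of_real (sg * s)) $$ (k, j)) \<longlongrightarrow> M $$ (k, j)) at_top" by (rule tendsto_eventually)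
    moreover have "((\<lambda>s. X (\<i> * of_real (sg * s)) $$ (k, j)) \<longlongrightarrow> 0) at_top"
      by (rule half_plane_transform_radial[OF mat_transform_entry[OF X] sg]) (use kj in auto)
    ultimately have "M $$ (k, j) = 0" by (rule tendsto_unique[OF trivial_limit_at_top_linorder])
    then show "M $$ (k, j) = 0\<^sub>m n n $$ (k, j)" using kj by simp
  qed (use M in auto)
  show "X (of_real lam) = 0\<^sub>m n n"
  proof (rule eq_matI)
    fix k j assume "k < dim_row (0\<^sub>m n n :: complex mat)" "j < dim_col (0\<^sub>m n n :: complex mat)"
    then have kj: "k < n" "j < n" by auto
    define p where "p m = complex_of_real lam + \<i> * of_real (sg / real (Suc m))" for m
    have pIm: "0 < sg * Im (p m)" for m unfolding p_def using sg2 by simp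
    have p: "p \<longlonglongrightarrow> of_real lam"
    proof -
      have "(\<lambda>m. sg / real (Suc m)) \<longlonglongrightarrow> 0" by real_asymp
      then have "(\<lambda>m. complex_of_real lam + \<i> * of_real (sg / real (Suc m))) \<longlonglongrightarrow> of_real lam + \<i> * of_real 0"
        by (intro tendsto_add tendsto_mult tendsto_const tendsto_of_real)
      then show ?thesis by (simp add: p_def[abs_def])
    qed
    have "continuous_on {z. 0 \<le> sg * Im z} (\<lambda>z. X z $$ (k, j))"
      by (rule half_plane_transform_analytic(2)[OF mat_transform_entry[OF X kj]])
    then have "(\<lambda>m. X (p m) $$ (k, j)) \<longlonglongrightarrow> X (of_real lam) $$ (k, j)"
      by (rule continuous_on_tendsto_compose[OF _ p]) (use pIm in \<open>auto intro!: always_eventually less_imp_le\<close>)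
    moreover have "\<forall>\<^sub>F m in sequentially. X (p m) $$ (k, j) = 0"
    proof -
      have "\<forall>\<^sub>F m in sequentially. p m \<noteq> a"
      proof (cases "a = of_real lam")
        case True
        have "p m \<noteq> a" for m using pIm[of m] unfolding True by auto
        then show ?thesis by simp
      next
        case False
        then show ?thesis by (intro tendsto_imp_eventually_ne[OF p]) auto
      qed
      then show ?thesis by eventually_elim (use z0[OF pIm] M0 kj in auto)
    qed
    then have "(\<lambda>m. X (p m) $$ (k, j)) \<longlonglongrightarrow> 0" by (rule tendsto_eventually)
    ultimately have "X (of_real lam) $$ (k, j) = 0" by (rule LIMSEQ_unique)
    then show "X (of_real lam) $$ (k, j) = 0\<^sub>m n n $$ (k, j)" using kj by simp
  qed (use mat_transform_carrier[OF X] in auto)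
qed

section \<open>Comparison of two solutions\<close>

lemma rh_unknownI:
  assumes "\<And>k j. k < n \<Longrightarrow> j < n \<Longrightarrow> rh_entry sg (f k j)"
  shows "rh_unknown n sg (\<lambda>z. Matrix.mat n n (\<lambda>(k, j). f k j z))"
  unfolding rh_unknown_iff
proof (intro conjI allI impI)
  fix k j assume kj: "k < n" "j < n"
  have "(\<lambda>z. Matrix.mat n n (\<lambda>(k, j). f k j z) $$ (k, j)) = f k j" using kj by simp
  then show "rh_entry sg (\<lambda>z. Matrix.mat n n (\<lambda>(k, j). f k j z) $$ (k, j))" using assms[OF kj] by simp
qed simp

text \<open>\<open>rh_uniquely_solvable\<close> compares solutions of the inhomogeneous problem. A
  solution of the homogeneous problem is therefore tested by adding it to a given solution.\<close>

lemma rh_solution_add: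
  assumes X: "rh_solution n S Xp Xm" and S: "\<And>lam. S lam \<in> carrier_mat n n"
    and fp: "\<And>k j. k < n \<Longrightarrow> j < n \<Longrightarrow> rh_entry 1 (fp k j)"
    and fm: "\<And>k j. k < n \<Longrightarrow> j < n \<Longrightarrow> rh_entry (- 1) (fm k j)"
    and eq: "\<And>lam::real. Matrix.mat n n (\<lambda>(k, j). fp k j (of_real lam)) * S lam = Matrix.mat n n (\<lambda>(k, j). fm k j (of_real lam))"
  shows "rh_solution n S (\<lambda>z. Matrix.mat n n (\<lambda>(k, j). Xp z $$ (k, j) + fp k j z))
    (\<lambda>z. Matrix.mat n n (\<lambda>(k, j). Xm z $$ (k, j) + fm k j z))"
  unfolding rh_solution_def
proof (intro conjI allI)
  have Xp: "rh_unknown n 1 Xp" and Xm: "rh_unknown n (- 1) Xm"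
    and Xeq: "\<And>lam::real. (1\<^sub>m n + Xp (of_real lam)) * S lam = 1\<^sub>m n + Xm (of_real lam)"
    using X unfolding rh_solution_def by auto
  show "rh_unknown n 1 (\<lambda>z. Matrix.mat n n (\<lambda>(k, j). Xp z $$ (k, j) + fp k j z))"
    using Xp unfolding rh_unknown_iff by (intro rh_unknownI[unfolded rh_unknown_iff] rh_entry_add fp) auto
  show "rh_unknown n (- 1) (\<lambda>z. Matrix.mat n n (\<lambda>(k, j). Xm z $$ (k, j) + fm k j z))"
    using Xm unfolding rh_unknown_iff by (intro rh_unknownI[unfolded rh_unknown_iff] rh_entry_add fm) auto
  fix lam :: real
  let ?z = "complex_of_real lam"
  let ?Fp = "Matrix.mat n n (\<lambda>(k, j). fp k j ?z)" and ?Fm = "Matrix.mat n n (\<lambda>(k, j). fm k j ?z)"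
  have car: "Xp ?z \<in> carrier_mat n n" "Xm ?z \<in> carrier_mat n n"
    using Xp Xm unfolding rh_unknown_def by auto
  have p: "Matrix.mat n n (\<lambda>(k, j). Xp ?z $$ (k, j) + fp k j ?z) = Xp ?z + ?Fp"
    and m: "Matrix.mat n n (\<lambda>(k, j). Xm ?z $$ (k, j) + fm k j ?z) = Xm ?z + ?Fm"
    using car by (auto intro!: eq_matI)
  have "(1\<^sub>m n + (Xp ?z + ?Fp)) * S lam = ((1\<^sub>m n + Xp ?z) + ?Fp) * S lam"
    using car by (subst assoc_add_mat[of _ n n]) auto
  also have "\<dots> = (1\<^sub>m n + Xp ?z) * S lam + ?Fp * S lam"
    by (rule add_mult_distrib_mat[OF _ _ S]) (use car in auto)
  also have "\<dots> = 1\<^sub>m n + (Xm ?z + ?Fm)"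
    unfolding Xeq eq using car by (subst assoc_add_mat[of _ n n]) auto
  finally show "(1\<^sub>m n + Matrix.mat n n (\<lambda>(k, j). Xp ?z $$ (k, j) + fp k j ?z)) * S lam =
    1\<^sub>m n + Matrix.mat n n (\<lambda>(k, j). Xm ?z $$ (k, j) + fm k j ?z)"
    unfolding p m .
qed

lemma rh_transform_unique:
  assumes Ap: "mat_transform n 1 Ap" and Am: "mat_transform n (- 1) Am"
    and Bp: "mat_transform n 1 Bp" and Bm: "mat_transform n (- 1) Bm"
    and S: "\<And>lam. S lam \<in> carrier_mat n n"
    and eqA: "\<And>lam::real. (1\<^sub>m n + Ap (of_real lam)) * S lam = 1\<^sub>m n + Am (of_real lam)"
    and eqB: "\<And>lam::real. (1\<^sub>m n + Bp (of_real lam)) * S lam = 1\<^sub>m n + Bm (of_real lam)"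
    and rh: "rh_uniquely_solvable n S"
  shows "Bp (of_real lam) = Ap (of_real lam)" "Bm (of_real lam) = Am (of_real lam)"
proof -
  define Yp where "Yp z = Bp z - Ap z" for z
  define Ym where "Ym z = Bm z - Am z" for z
  have Yp: "mat_transform n 1 Yp" and Ym: "mat_transform n (- 1) Ym"
    unfolding Yp_def Ym_def by (intro mat_transform_diff Ap Am Bp Bm)+
  have "\<forall>\<^sub>F s in at_top. Determinant.det (1\<^sub>m n + Am (\<i> * of_real (- 1 * s))) \<noteq> 0 \<and> 0 < s"
    by (intro eventually_conj mat_transform_eventually_invertible[OF Am] eventually_gt_at_top) simp
  then obtain r :: real where "Determinant.det (1\<^sub>m n + Am (\<i> * of_real (- 1 * r))) \<noteq> 0" and r: "0 < r"
    using eventually_happens'[OF trivial_limit_at_top_linorder] by blast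
  \<comment> \<open>The pole to be divided out, far enough down the imaginary axis for I + Am to be
    invertible there.\<close>
  define a where "a = - \<i> * complex_of_real r"
  have za: "z + \<i> * of_real r = z - a" for z by (simp add: a_def)
  define M where "M = 1\<^sub>m n + Am a"
  have M: "M \<in> carrier_mat n n" unfolding M_def using mat_transform_carrier[OF Am] by simp
  have "Determinant.det M \<noteq> 0"
    using \<open>Determinant.det (1\<^sub>m n + Am (\<i> * of_real (- 1 * r))) \<noteq> 0\<close> unfolding M_def a_def by simp
  note Mi = mat_inv_Units[OF M det_non_zero_imp_unit[OF M this]]
  \<comment> \<open>A left factor passes through the relation, in which S acts from the right. This
    choice makes Ym - c (I + Am) vanish at a.\<close>
  define c where "c = Ym a * mat_inv M"
  note car = mat_transform_carrier[OF Ap] mat_transform_carrier[OF Am] mat_transform_carrier[OF Bp]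
    mat_transform_carrier[OF Bm] mat_transform_carrier[OF Yp] mat_transform_carrier[OF Ym]
  have c: "c \<in> carrier_mat n n" unfolding c_def by (rule mult_carrier_mat[OF car(6) Mi(1)])
  have cM: "c * M = Ym a"
    unfolding c_def using assoc_mult_mat[OF car(6) Mi(1) M] Mi(3) right_mult_one_mat[OF car(6)] by simp
  \<comment> \<open>The numerator Yp - c (I + Ap) is Np - c, a transform minus a constant: the form
    covered by \<open>rh_entry_upper\<close>.\<close>
  define Np where "Np z = Yp z - c * Ap z" for z
  define Nm where "Nm z = Ym z - c * Am z" for z
  have Np: "mat_transform n 1 Np" and Nm: "mat_transform n (- 1) Nm"
    unfolding Np_def Nm_def by (intro mat_transform_diff mat_transform_mult_left Yp Ym Ap Am c)+
  note carN = mat_transform_carrier[OF Np] mat_transform_carrier[OF Nm]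
  have N: "Np z - c = Yp z - c * (1\<^sub>m n + Ap z)" "Nm z - c = Ym z - c * (1\<^sub>m n + Am z)" for z
  proof -
    have "Y - c * X - c = Y - c * (1\<^sub>m n + X)" if "X \<in> carrier_mat n n" "Y \<in> carrier_mat n n" for X Y
    proof -
      have "c * (1\<^sub>m n + X) = c + c * X"
        using mult_add_distrib_mat[OF c one_carrier_mat that(1)] right_mult_one_mat[OF c] by simp
      then show ?thesis using that c by (auto intro!: eq_matI)
    qed
    then show "Np z - c = Yp z - c * (1\<^sub>m n + Ap z)" "Nm z - c = Ym z - c * (1\<^sub>m n + Am z)"
      unfolding Np_def Nm_def using car by blast+
  qed
  \<comment> \<open>Since the numerator vanishes at a, the constant c is the value of Nm there, as
    \<open>rh_entry_lower\<close> requires.\<close>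
  have Na: "Nm a = c"
  proof -
    have "Nm a - c = 0\<^sub>m n n" unfolding N M_def[symmetric] cM using car(6) by simp
    then have "(Nm a - c) $$ (k, j) = 0" if "k < n" "j < n" for k j using that by simp
    then have "Nm a $$ (k, j) = c $$ (k, j)" if "k < n" "j < n" for k j using that c by simp
    then show ?thesis using c carN(2)[of a] by (intro eq_matI) auto
  qed
  have NS: "(Np (of_real lam) - c) * S lam = Nm (of_real lam) - c" for lam :: real
  proof -
    let ?z = "complex_of_real lam"
    have "Yp ?z = (1\<^sub>m n + Bp ?z) - (1\<^sub>m n + Ap ?z)"
      unfolding Yp_def using car(1)[of ?z] car(3)[of ?z] by (auto intro!: eq_matI)
    then have "Yp ?z * S lam = (1\<^sub>m n + Bm ?z) - (1\<^sub>m n + Am ?z)"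
      using minus_mult_distrib_mat[OF _ _ S, of "1\<^sub>m n + Bp ?z" n "1\<^sub>m n + Ap ?z"] car eqA eqB by simp
    also have "\<dots> = Ym ?z"
      unfolding Ym_def using car(2)[of ?z] car(4)[of ?z] by (auto intro!: eq_matI)
    finally have YS: "Yp ?z * S lam = Ym ?z" .
    have "c * (1\<^sub>m n + Ap ?z) * S lam = c * (1\<^sub>m n + Am ?z)"
      using assoc_mult_mat[OF c _ S, of "1\<^sub>m n + Ap ?z"] car(1) eqA by simp
    then show ?thesis
      unfolding N using minus_mult_distrib_mat[OF car(5) _ S, of "c * (1\<^sub>m n + Ap ?z)"] YS c car(1) by simp
  qed
  define fp where "fp k j z = (Np z $$ (k, j) - c $$ (k, j)) / (z + \<i> * of_real r)" for k j z
  define fm where "fm k j z = (if z = a then deriv (\<lambda>z. Nm z $$ (k, j)) a else (Nm z $$ (k, j) - Nm a $$ (k, j)) / (z - a))" for k j z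
  have fp: "rh_entry 1 (fp k j)" if "k < n" "j < n" for k j
    unfolding fp_def by (rule rh_entry_upper[OF mat_transform_entry[OF Np that] r])
  have fm: "rh_entry (- 1) (fm k j)" if "k < n" "j < n" for k j
    unfolding fm_def a_def by (rule rh_entry_lower[OF mat_transform_entry[OF Nm that] r])
  have eq: "Matrix.mat n n (\<lambda>(k, j). fp k j (of_real lam)) * S lam = Matrix.mat n n (\<lambda>(k, j). fm k j (of_real lam))" for lam :: real
  proof -
    let ?z = "complex_of_real lam"
    have "Im (?z - a) = r" by (simp add: a_def)
    then have ne: "?z \<noteq> a" using r by auto
    have p: "Matrix.mat n n (\<lambda>(k, j). fp k j ?z) = (1 / (?z - a)) \<cdot>\<^sub>m (Np ?z - c)"
      unfolding fp_def za using c carN(1)[of ?z] by (auto intro!: eq_matI)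
    have m: "Matrix.mat n n (\<lambda>(k, j). fm k j ?z) = (1 / (?z - a)) \<cdot>\<^sub>m (Nm ?z - c)"
      unfolding fm_def Na if_not_P[OF ne] using c carN(2)[of ?z] by (auto intro!: eq_matI)
    show ?thesis unfolding p m using mult_smult_assoc_mat[OF _ S, of "Np ?z - c" n] NS c by (simp add: minus_carrier_mat)
  qed
  \<comment> \<open>Some solution with transforms of continuous functions. It need not be Ap and Am,
    whose underlying functions are only known to be measurable.\<close>
  obtain Xp Xm where X: "rh_solution n S Xp Xm" using rh unfolding rh_uniquely_solvable_def by blast
  note XZ = rh_solution_add[OF X S fp fm eq]
  note uniq = rh[unfolded rh_uniquely_solvable_def, THEN conjunct2, rule_format, OF conjI[OF XZ X]]
  have Zp: "fp k j z = 0" if "0 < Im z" "k < n" "j < n" for k j z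
  proof -
    have "Matrix.mat n n (\<lambda>(k, j). Xp z $$ (k, j) + fp k j z) = Xp z"
      using uniq[THEN conjunct1] that(1) by blast
    from arg_cong[OF this, of "\<lambda>X. X $$ (k, j)"] show ?thesis using that by simp
  qed
  have Zm: "fm k j z = 0" if "Im z < 0" "k < n" "j < n" for k j z
  proof -
    have "Matrix.mat n n (\<lambda>(k, j). Xm z $$ (k, j) + fm k j z) = Xm z"
      using uniq[THEN conjunct2] that(1) by blast
    from arg_cong[OF this, of "\<lambda>X. X $$ (k, j)"] show ?thesis using that by simp
  qed
  have Nm_c: "Nm z = c" if "0 < - 1 * Im z" "z \<noteq> a" for z
    using Zm[of z] that c carN(2)[of z] unfolding fm_def Na by (intro eq_matI) auto
  have Np_c: "Np z = c" if "0 < 1 * Im z" "z \<noteq> a" for z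
    using Zp[of z] that c carN(1)[of z] unfolding fp_def za by (intro eq_matI) auto
  have c0: "c = 0\<^sub>m n n" and Nm0: "Nm (of_real lam) = 0\<^sub>m n n"
    using mat_transform_zero_on_axis[OF Nm _ Nm_c c] by auto
  have Np0: "Np (of_real lam) = 0\<^sub>m n n"
    using mat_transform_zero_on_axis(2)[OF Np _ Np_c c] by auto
  have cX: "c * X = 0\<^sub>m n n" if "X \<in> carrier_mat n n" for X unfolding c0 using that by simp
  have eq0: "Y = X" if "Y - X - 0\<^sub>m n n = 0\<^sub>m n n" "Y \<in> carrier_mat n n" "X \<in> carrier_mat n n" for X Y :: "complex mat"
  proof (rule eq_matI)
    fix k j assume "k < dim_row X" "j < dim_col X"
    then show "Y $$ (k, j) = X $$ (k, j)" using arg_cong[OF that(1), of "\<lambda>X. X $$ (k, j)"] that(2,3) by simp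
  qed (use that in auto)
  show "Bp (of_real lam) = Ap (of_real lam)"
    using Np0 unfolding Np_def Yp_def cX[OF car(1)] by (rule eq0) (rule car)+
  show "Bm (of_real lam) = Am (of_real lam)"
    using Nm0 unfolding Nm_def Ym_def cX[OF car(2)] by (rule eq0) (rule car)+
qed

section \<open>Fourier uniqueness\<close>

lemma char_density_eq:
  fixes p :: "real \<Rightarrow> real"
  assumes "p \<in> borel_measurable borel" "\<And>t. 0 \<le> p t"
  shows "char (density lborel (\<lambda>t. ennreal (p t))) s = (LINT t|lborel. of_real (p t) * exp (\<i> * of_real (s * t)))"
proof -
  have "char (density lborel (\<lambda>t. ennreal (p t))) s = (LINT t|lborel. p t *\<^sub>R exp (\<i> * of_real (s * t)))"
    unfolding char_def using assms by (subst integral_density) auto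
  then show ?thesis by (simp add: scaleR_conv_of_real)
qed

lemma integrable_mult_phase:
  fixes k :: "real \<Rightarrow> complex"
  assumes "integrable lborel k"
  shows "integrable lborel (\<lambda>t. k t * exp (\<i> * of_real (s * t)))"
proof (rule Bochner_Integration.integrable_bound[OF assms])
  have [measurable]: "k \<in> borel_measurable borel" using borel_measurable_integrable[OF assms] by simp
  show "(\<lambda>t. k t * exp (\<i> * of_real (s * t))) \<in> borel_measurable lborel" by measurable
qed (simp add: norm_mult)

text \<open>The positive and negative parts of g have equal transforms, and at s = 0 equal mass C.
  Normalised by C they are probability densities with the same characteristic function.\<close>

lemma fourier_unique_real:
  fixes g :: "real \<Rightarrow> real"
  assumes g: "integrable lborel g"
    and F: "\<And>s. (LINT t|lborel. of_real (g t) * exp (\<i> * of_real (s * t))) = (0::complex)"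
  shows "AE t in lborel. g t = 0"
proof -
  let ?E = "\<lambda>s t. exp (\<i> * complex_of_real (s * t))"
  have [measurable]: "g \<in> borel_measurable borel" using borel_measurable_integrable[OF g] by simp
  define p where "p t = max (g t) 0" for t
  define m where "m t = max (- g t) 0" for t
  have p: "integrable lborel p" and m: "integrable lborel m"
    unfolding p_def[abs_def] m_def[abs_def] using g by auto
  have nn: "0 \<le> p t" "0 \<le> m t" and gpm: "g t = p t - m t" for t by (auto simp: p_def m_def)
  have [measurable]: "p \<in> borel_measurable borel" "m \<in> borel_measurable borel"
    unfolding p_def[abs_def] m_def[abs_def] by measurable
  have phase: "integrable lborel (\<lambda>t. complex_of_real (k t) * ?E s t)"
    if "integrable lborel k" for k :: "real \<Rightarrow> real" and s
    using that by (intro integrable_mult_phase) simp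
  have eq: "(LINT t|lborel. complex_of_real (p t) * ?E s t) =
    (LINT t|lborel. complex_of_real (m t) * ?E s t)" for s
    using F[of s] Bochner_Integration.integral_diff[OF phase[OF p, of s] phase[OF m, of s]]
    unfolding gpm by (simp add: left_diff_distrib)
  define C where "C = (LINT t|lborel. p t)"
  have Cm: "C = (LINT t|lborel. m t)"
    using eq[of 0] unfolding C_def by simp
  have C0: "0 \<le> C" unfolding C_def using nn by (intro Bochner_Integration.integral_nonneg)
  have "AE t in lborel. p t = m t"
  proof (cases "C = 0")
    case True
    have "AE t in lborel. p t = 0" using integral_nonneg_eq_0_iff_AE[OF p] True nn unfolding C_def by simp
    moreover have "AE t in lborel. m t = 0" using integral_nonneg_eq_0_iff_AE[OF m] True nn unfolding Cm by simp
    ultimately show ?thesis by eventually_elim simp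
  next
    case False
    then have C: "0 < C" using C0 by simp
    define \<mu> where "\<mu> k = density lborel (\<lambda>t. ennreal (k t / C))" for k :: "real \<Rightarrow> real"
    have dist: "real_distribution (\<mu> k)"
      if k: "integrable lborel k" "\<And>t. 0 \<le> k t" "(LINT t|lborel. k t) = C" for k :: "real \<Rightarrow> real"
    proof -
      have [measurable]: "k \<in> borel_measurable borel" using borel_measurable_integrable[OF k(1)] by simp
      have "(\<integral>\<^sup>+ t. ennreal (k t / C) \<partial>lborel) = ennreal (LINT t|lborel. k t / C)"
        using k C by (intro nn_integral_eq_integral) auto
      then have "(\<integral>\<^sup>+ t. ennreal (k t / C) \<partial>lborel) = 1" using k C by simp
      then have "prob_space (\<mu> k)"
        unfolding \<mu>_def by (intro prob_spaceI) (simp add: emeasure_density)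
      then show ?thesis unfolding real_distribution_def real_distribution_axioms_def by (simp add: \<mu>_def)
    qed
    have ch: "char (\<mu> k) s = (LINT t|lborel. complex_of_real (k t) * ?E s t) / C"
      if k: "k \<in> borel_measurable borel" "\<And>t. 0 \<le> k t" for k s
    proof -
      have "char (\<mu> k) s = (LINT t|lborel. complex_of_real (k t / C) * ?E s t)"
        unfolding \<mu>_def using k C by (intro char_density_eq) auto
      also have "\<dots> = (LINT t|lborel. complex_of_real (k t) * ?E s t / C)"
        by simp
      finally show ?thesis by simp
    qed
    have "\<mu> p = \<mu> m"
      by (rule Levy_uniqueness[OF dist[OF p] dist[OF m]]) (use nn Cm C_def eq in \<open>auto simp: ch\<close>)
    then have "AE t in lborel. ennreal (p t / C) = ennreal (m t / C)"
      unfolding \<mu>_def by (intro sigma_finite_measure.density_unique[OF sigma_finite_lborel]) auto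
    then show ?thesis by eventually_elim (use nn C in simp)
  qed
  then show ?thesis by eventually_elim (simp add: gpm)
qed

text \<open>Conjugating the integral and replacing s by - s shows that the conjugate of f has zero
  transform as well, so real and imaginary part separate.\<close>

lemma fourier_unique:
  fixes f :: "real \<Rightarrow> complex"
  assumes f: "integrable lborel f"
    and F: "\<And>s. (LINT t|lborel. f t * exp (\<i> * of_real (s * t))) = 0"
  shows "AE t in lborel. f t = 0"
proof -
  let ?E = "\<lambda>s t. exp (\<i> * complex_of_real (s * t))"
  note phase = integrable_mult_phase
  have cf: "integrable lborel (\<lambda>t. cnj (f t))" using f by simp
  have Fc: "(LINT t|lborel. cnj (f t) * ?E s t) = 0" for s
  proof -
    have "(LINT t|lborel. cnj (f t) * ?E s t) = (LINT t|lborel. cnj (f t * ?E (- s) t))"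
      by (intro Bochner_Integration.integral_cong refl) (simp add: exp_cnj)
    also have "\<dots> = cnj (LINT t|lborel. f t * ?E (- s) t)" by (rule Bochner_Integration.integral_cnj)
    finally show ?thesis using F[of "- s"] by simp
  qed
  have "AE t in lborel. Re (f t) = 0"
  proof (rule fourier_unique_real)
    show "integrable lborel (\<lambda>t. Re (f t))" using f by simp
    fix s
    have "(LINT t|lborel. of_real (Re (f t)) * ?E s t) =
      (LINT t|lborel. (f t * ?E s t + cnj (f t) * ?E s t) / 2)"
      by (intro Bochner_Integration.integral_cong refl) (simp add: complex_add_cnj distrib_right[symmetric])
    also have "\<dots> = 0"
      unfolding integral_divide_zero Bochner_Integration.integral_add[OF phase[OF f] phase[OF cf]] F Fc by simp
    finally show "(LINT t|lborel. of_real (Re (f t)) * ?E s t) = (0::complex)" .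
  qed
  moreover have "AE t in lborel. Im (f t) = 0"
  proof (rule fourier_unique_real)
    show "integrable lborel (\<lambda>t. Im (f t))" using f by simp
    fix s
    have "(LINT t|lborel. of_real (Im (f t)) * ?E s t) =
      (LINT t|lborel. (f t * ?E s t - cnj (f t) * ?E s t) / (2 * \<i>))"
    proof (rule Bochner_Integration.integral_cong[OF refl])
      fix t
      let ?e = "exp (\<i> * complex_of_real (s * t))"
      have "of_real (Im (f t)) * ?e * (2 * \<i>) = f t * ?e - cnj (f t) * ?e"
        by (simp add: complex_diff_cnj left_diff_distrib[symmetric] mult_ac)
      then show "of_real (Im (f t)) * ?e = (f t * ?e - cnj (f t) * ?e) / (2 * \<i>)"
        by (subst nonzero_eq_divide_eq) simp_all
    qed
    also have "\<dots> = 0"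
      unfolding integral_divide_zero Bochner_Integration.integral_diff[OF phase[OF f] phase[OF cf]] F Fc by simp
    finally show "(LINT t|lborel. of_real (Im (f t)) * ?E s t) = (0::complex)" .
  qed
  ultimately show ?thesis by eventually_elim (simp add: complex_eq_iff)
qed

section \<open>Half-line integrals of Lebesgue measurable functions\<close>

lemma exp_decaying_representative:
  fixes u :: "real \<Rightarrow> complex"
  assumes u: "u \<in> borel_measurable (lebesgue_on {0..})" and B: "0 \<le> B" "0 < \<delta>"
    and le: "\<And>t. 0 \<le> t \<Longrightarrow> norm (u t) \<le> B * exp (- \<delta> * t)"
  obtains v where "exp_decaying_fun B \<delta> v" "AE t in lebesgue. indicator {0..} t *\<^sub>R u t = v t"
proof -
  have "(\<lambda>t. indicator {0..} t *\<^sub>R u t) \<in> borel_measurable lebesgue"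
    using u by (subst (asm) borel_measurable_restrict_space_iff) auto
  then have "(\<lambda>t. Re (indicator {0..} t *\<^sub>R u t)) \<in> borel_measurable lebesgue"
    "(\<lambda>t. Im (indicator {0..} t *\<^sub>R u t)) \<in> borel_measurable lebesgue"
    by (simp_all only: borel_measurable_complex_iff)
  from this[THEN completion_ex_borel_measurable_real] obtain wr wi where
    wr: "wr \<in> borel_measurable lborel" "AE t in lborel. Re (indicator {0..} t *\<^sub>R u t) = wr t" and
    wi: "wi \<in> borel_measurable lborel" "AE t in lborel. Im (indicator {0..} t *\<^sub>R u t) = wi t" by blast
  define w where "w t = Complex (wr t) (wi t)" for t
  have [measurable]: "wr \<in> borel_measurable borel" "wi \<in> borel_measurable borel" using wr wi by simp_all
  have [measurable]: "w \<in> borel_measurable borel"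
    unfolding w_def[abs_def] borel_measurable_complex_iff by simp
  have ae: "AE t in lborel. indicator {0..} t *\<^sub>R u t = w t"
    using wr(2) wi(2) by eventually_elim (simp only: w_def complex_eq_iff complex.sel)
  \<comment> \<open>The bound holds for w only almost everywhere. Resetting w to 0 where it fails
    keeps v Borel and makes the bound hold at every point.\<close>
  define v where "v t = (if norm (w t) \<le> indicator {0..} t * (B * exp (- \<delta> * t)) then w t else 0)" for t
  have "v \<in> borel_measurable borel" unfolding v_def[abs_def] by measurable
  moreover have "norm (v t) \<le> indicator {0..} t * (B * exp (- \<delta> * t))" for t
    using B by (simp add: v_def)
  ultimately have "exp_decaying_fun B \<delta> v" using B unfolding exp_decaying_fun_def by auto
  moreover have "AE t in lborel. indicator {0..} t *\<^sub>R u t = v t"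
    using ae
  proof eventually_elim
    fix t assume t: "indicator {0..} t *\<^sub>R u t = w t"
    have "norm (w t) \<le> indicator {0..} t * (B * exp (- \<delta> * t))"
      unfolding t[symmetric] using le[of t] by (simp add: indicator_def)
    then show "indicator {0..} t *\<^sub>R u t = v t" using t by (simp add: v_def)
  qed
  then have "AE t in lebesgue. indicator {0..} t *\<^sub>R u t = v t" by (simp add: AE_completion_iff)
  ultimately show thesis by (rule that)
qed

lemma half_line_integral_eq:
  assumes v: "exp_decaying_fun B \<delta> v" and ae: "AE t in lebesgue. indicator {0..} t *\<^sub>R u t = v t"
    and u: "u \<in> borel_measurable (lebesgue_on {0..})"
  shows "(LINT t:{0..}|lebesgue. u t * exp (\<i> * of_real (s * t))) = (LINT t|lborel. v t * exp (\<i> * of_real (s * t)))"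
proof -
  have [measurable]: "v \<in> borel_measurable borel" by (rule exp_decaying_funD(3)[OF v])
  have 1: "(\<lambda>t. indicator {0..} t *\<^sub>R u t) \<in> borel_measurable lebesgue"
    using u by (subst (asm) borel_measurable_restrict_space_iff) auto
  have 2: "(\<lambda>t. exp (\<i> * complex_of_real (s * t))) \<in> borel_measurable lebesgue"
    by (rule measurable_completion) measurable
  have 3: "(\<lambda>t. v t * exp (\<i> * complex_of_real (s * t))) \<in> borel_measurable lborel" by measurable
  have "(LINT t:{0..}|lebesgue. u t * exp (\<i> * of_real (s * t))) = (LINT t|lebesgue. (indicator {0..} t *\<^sub>R u t) * exp (\<i> * of_real (s * t)))"
    unfolding set_lebesgue_integral_def by simp
  also have "\<dots> = (LINT t|lebesgue. v t * exp (\<i> * of_real (s * t)))"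
  proof (rule integral_cong_AE)
    show "AE t in lebesgue. (indicator {0..} t *\<^sub>R u t) * exp (\<i> * of_real (s * t)) = v t * exp (\<i> * of_real (s * t))"
      using ae by eventually_elim simp
  qed (use borel_measurable_times[OF 1 2] measurable_completion[OF 3] in simp_all)
  also have "\<dots> = (LINT t|lborel. v t * exp (\<i> * of_real (s * t)))"
    by (rule integral_completion[OF 3])
  finally show ?thesis .
qed

text \<open>Rescaling x = \<rho> t absorbs the modulus of a column speed. Columns with different
  speeds become transforms in one common variable, and only the sign of the speed decides the
  half-plane.\<close>

lemma half_line_integral_transform:
  fixes u :: "real \<Rightarrow> complex"
  assumes u: "u \<in> borel_measurable (lebesgue_on {0..})" and B: "0 \<le> B" "0 < \<delta>"
    and le: "\<And>t. 0 \<le> t \<Longrightarrow> norm (u t) \<le> B * exp (- \<delta> * t)"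
    and \<rho>: "0 < \<rho>"
  obtains F where "half_plane_transform sg F"
    "\<And>lam::real. F (of_real lam) = (LINT t:{0..}|lebesgue. u t * exp (\<i> * of_real (lam * (sg * \<rho>) * t)))"
proof -
  obtain v where v: "exp_decaying_fun B \<delta> v" and ae: "AE t in lebesgue. indicator {0..} t *\<^sub>R u t = v t"
    using exp_decaying_representative[OF u B le] by blast
  have [measurable]: "v \<in> borel_measurable borel" by (rule exp_decaying_funD(3)[OF v])
  define f where "f x = v (1 / \<rho> * x) / \<rho>" for x
  have "norm (f x) \<le> indicator {0..} x * (B / \<rho> * exp (- (\<delta> / \<rho>) * x))" for x
  proof (cases "x < 0")
    case True
    then have "1 / \<rho> * x < 0" using \<rho> by (simp add: divide_neg_pos)
    then show ?thesis unfolding f_def using True by (simp add: exp_decaying_funD(4)[OF v])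
  next
    case False
    then show ?thesis
      using exp_decaying_funD(5)[OF v, of "1 / \<rho> * x"] \<rho> by (simp add: f_def norm_divide divide_right_mono)
  qed
  moreover have "f \<in> borel_measurable borel" unfolding f_def[abs_def] by measurable
  ultimately have f: "exp_decaying_fun (B / \<rho>) (\<delta> / \<rho>) f"
    using B \<rho> unfolding exp_decaying_fun_def by auto
  show thesis
  proof (rule that[of "\<lambda>z. laplace f (- \<i> * of_real sg * z)"])
    show "half_plane_transform sg (\<lambda>z. laplace f (- \<i> * of_real sg * z))"
      unfolding half_plane_transform_def using f by blast
    fix lam :: real
    have "(LINT t:{0..}|lebesgue. u t * exp (\<i> * of_real (lam * (sg * \<rho>) * t))) =
      (LINT t|lborel. v t * exp (\<i> * of_real (lam * (sg * \<rho>) * t)))"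
      by (rule half_line_integral_eq[OF v ae u])
    also have "\<dots> = \<bar>1 / \<rho>\<bar> *\<^sub>R (LINT x|lborel. v (0 + 1 / \<rho> * x) * exp (\<i> * of_real (lam * (sg * \<rho>) * (0 + 1 / \<rho> * x))))"
      by (rule lborel_integral_real_affine) (use \<rho> in simp)
    also have "\<dots> = (LINT x|lborel. \<bar>1 / \<rho>\<bar> *\<^sub>R (v (0 + 1 / \<rho> * x) * exp (\<i> * of_real (lam * (sg * \<rho>) * (0 + 1 / \<rho> * x)))))"
      by (rule integral_scaleR_right[symmetric])
    also have "\<dots> = laplace f (- \<i> * of_real sg * of_real lam)"
      unfolding laplace_def
    proof (rule Bochner_Integration.integral_cong[OF refl])
      fix x :: real
      have "lam * (sg * \<rho>) * (0 + 1 / \<rho> * x) = lam * sg * x" using \<rho> by simp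
      then show "\<bar>1 / \<rho>\<bar> *\<^sub>R (v (0 + 1 / \<rho> * x) * exp (\<i> * of_real (lam * (sg * \<rho>) * (0 + 1 / \<rho> * x)))) =
        f x * exp (- (- \<i> * of_real sg * of_real lam) * of_real x)"
        using \<rho> by (simp only:) (simp add: f_def scaleR_conv_of_real mult_ac)
    qed
    finally show "laplace f (- \<i> * of_real sg * of_real lam) =
      (LINT t:{0..}|lebesgue. u t * exp (\<i> * of_real (lam * (sg * \<rho>) * t)))" by simp
  qed
qed

text \<open>As \<eta> is nonzero, lam * \<eta> runs through all real frequencies, and Fourier
  uniqueness applies to Borel representatives.\<close>

lemma half_line_integral_unique:
  fixes u u' :: "real \<Rightarrow> complex"
  assumes u: "u \<in> borel_measurable (lebesgue_on {0..})" "0 \<le> B" "0 < \<delta>" "\<And>t. 0 \<le> t \<Longrightarrow> norm (u t) \<le> B * exp (- \<delta> * t)"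
    and u': "u' \<in> borel_measurable (lebesgue_on {0..})" "0 \<le> B'" "0 < \<delta>'" "\<And>t. 0 \<le> t \<Longrightarrow> norm (u' t) \<le> B' * exp (- \<delta>' * t)"
    and \<eta>: "\<eta> \<noteq> 0"
    and eq: "\<And>lam. (LINT t:{0..}|lebesgue. u t * exp (\<i> * of_real (lam * \<eta> * t))) = (LINT t:{0..}|lebesgue. u' t * exp (\<i> * of_real (lam * \<eta> * t)))"
  shows "AE t in lebesgue. 0 \<le> t \<longrightarrow> u t = u' t"
proof -
  obtain v where v: "exp_decaying_fun B \<delta> v" and ae: "AE t in lebesgue. indicator {0..} t *\<^sub>R u t = v t"
    using exp_decaying_representative[OF u] by blast
  obtain v' where v': "exp_decaying_fun B' \<delta>' v'" and ae': "AE t in lebesgue. indicator {0..} t *\<^sub>R u' t = v' t"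
    using exp_decaying_representative[OF u'] by blast
  have int: "integrable lborel (\<lambda>t. k t * exp (\<i> * of_real (s * t)))" if k: "exp_decaying_fun C \<epsilon> k" for C \<epsilon> k s
    using laplace_norm_bound(1)[OF k, of "- \<i> * of_real s"] exp_decaying_funD(2)[OF k] by (simp add: mult.assoc)
  have "AE t in lborel. v t - v' t = 0"
  proof (rule fourier_unique)
    show "integrable lborel (\<lambda>t. v t - v' t)"
      by (intro Bochner_Integration.integrable_diff exp_decaying_fun_integrable[OF v] exp_decaying_fun_integrable[OF v'])
    fix s
    have "(LINT t|lborel. v t * exp (\<i> * of_real (s * t))) = (LINT t|lborel. v' t * exp (\<i> * of_real (s * t)))"
      using eq[of "s / \<eta>"] \<eta> half_line_integral_eq[OF v ae u(1), of s] half_line_integral_eq[OF v' ae' u'(1), of s] by simp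
    then show "(LINT t|lborel. (v t - v' t) * exp (\<i> * of_real (s * t))) = 0"
      unfolding left_diff_distrib Bochner_Integration.integral_diff[OF int[OF v] int[OF v']] by simp
  qed
  then have "AE t in lebesgue. v t - v' t = 0" by (simp add: AE_completion_iff)
  with ae ae' show ?thesis by eventually_elim auto
qed

section \<open>From the scattering matrices to the kernels\<close>

definition entry_transform :: "(nat \<Rightarrow> real) \<Rightarrow> (nat \<Rightarrow> nat \<Rightarrow> real \<Rightarrow> real \<Rightarrow> complex) \<Rightarrow> nat \<Rightarrow> nat \<Rightarrow> real \<Rightarrow> complex" where
  "entry_transform \<xi> a r c lam = (LINT t:{0..}|lebesgue. a r c 0 t * exp (\<i> * of_real (lam * \<xi> c * t)))"

definition block_transform :: "nat \<Rightarrow> (nat \<Rightarrow> real) \<Rightarrow> (nat \<Rightarrow> nat \<Rightarrow> real \<Rightarrow> real \<Rightarrow> complex) \<Rightarrow> nat \<Rightarrow> nat \<Rightarrow> real \<Rightarrow> complex mat" where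
  "block_transform n \<xi> a p q lam = Matrix.mat n n (\<lambda>(k, j). entry_transform \<xi> a (p * n + k) (q * n + j) lam)"

lemma block_transform_carrier: "block_transform n \<xi> a p q lam \<in> carrier_mat n n"
  by (simp add: block_transform_def)

lemma kernel_transform_eq:
  assumes "\<And>t. 0 \<le> t \<Longrightarrow> A 0 t \<in> carrier_mat n n"
    and "\<And>k j t. k < n \<Longrightarrow> j < n \<Longrightarrow> 0 \<le> t \<Longrightarrow> A 0 t $$ (k, j) = a (p * n + k) (q * n + j) 0 t"
    and "\<And>j. j < n \<Longrightarrow> \<eta> j = \<xi> (q * n + j)"
  shows "kernel_transform n \<eta> A lam = block_transform n \<xi> a p q lam"
proof (rule eq_matI)
  fix k j assume "k < dim_row (block_transform n \<xi> a p q lam)" "j < dim_col (block_transform n \<xi> a p q lam)"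
  then have kj: "k < n" "j < n" by (simp_all add: block_transform_def)
  have "(LINT t:{0..}|lebesgue. (A 0 t * mat_diag n (\<lambda>l. exp (\<i> * of_real (lam * \<eta> l * t)))) $$ (k, j)) =
    (LINT t:{0..}|lebesgue. a (p * n + k) (q * n + j) 0 t * exp (\<i> * of_real (lam * \<xi> (q * n + j) * t)))"
  proof (rule set_lebesgue_integral_cong)
    show "\<forall>t. t \<in> {0..} \<longrightarrow> (A 0 t * mat_diag n (\<lambda>l. exp (\<i> * of_real (lam * \<eta> l * t)))) $$ (k, j) =
      a (p * n + k) (q * n + j) 0 t * exp (\<i> * of_real (lam * \<xi> (q * n + j) * t))"
    proof (intro allI impI)
      fix t :: real assume "t \<in> {0..}"
      then have t: "0 \<le> t" by simp
      show "(A 0 t * mat_diag n (\<lambda>l. exp (\<i> * of_real (lam * \<eta> l * t)))) $$ (k, j) =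
        a (p * n + k) (q * n + j) 0 t * exp (\<i> * of_real (lam * \<xi> (q * n + j) * t))"
        unfolding mat_diag_mult_right[OF assms(1)[OF t]] using kj assms(2)[OF kj t] assms(3)[OF kj(2)] by simp
    qed
  qed simp
  then show "kernel_transform n \<eta> A lam $$ (k, j) = block_transform n \<xi> a p q lam $$ (k, j)"
    unfolding kernel_transform_def block_transform_def entry_transform_def using kj by simp
qed (simp_all add: kernel_transform_def block_transform_def)

lemma kernel_transforms_block:
  assumes "transformation_kernels n \<xi> Q A11 A12 A21 A22"
  defines "a \<equiv> block_entry n A11 A12 A21 A22"
  shows "kernel_transform n \<xi> A11 lam = block_transform n \<xi> a 0 0 lam"
    and "kernel_transform n (\<lambda>l. \<xi> (n + l)) A12 lam = block_transform n \<xi> a 0 1 lam"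
    and "kernel_transform n \<xi> A21 lam = block_transform n \<xi> a 1 0 lam"
    and "kernel_transform n (\<lambda>l. \<xi> (n + l)) A22 lam = block_transform n \<xi> a 1 1 lam"
proof -
  have "\<forall>A\<in>{A11, A12, A21, A22}. \<forall>x t. 0 \<le> x \<and> x \<le> t \<longrightarrow> A x t \<in> carrier_mat n n"
    using assms(1)[unfolded transformation_kernels_def, THEN conjunct1] by blast
  then have car: "A 0 t \<in> carrier_mat n n" if "A \<in> {A11, A12, A21, A22}" "0 \<le> t" for A t
    using that by (metis order_refl)
  show "kernel_transform n \<xi> A11 lam = block_transform n \<xi> a 0 0 lam"
    "kernel_transform n (\<lambda>l. \<xi> (n + l)) A12 lam = block_transform n \<xi> a 0 1 lam"
    "kernel_transform n \<xi> A21 lam = block_transform n \<xi> a 1 0 lam"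
    "kernel_transform n (\<lambda>l. \<xi> (n + l)) A22 lam = block_transform n \<xi> a 1 1 lam"
    by (rule kernel_transform_eq; (rule car)?; simp add: a_def block_entry_def)+
qed

lemma block_transform_cong:
  assumes "\<And>r c t. r < 2 * n \<Longrightarrow> c < 2 * n \<Longrightarrow> 0 \<le> t \<Longrightarrow> a r c 0 t = b r c 0 t" "p < 2" "q < 2"
  shows "block_transform n \<xi> a p q lam = block_transform n \<xi> b p q lam"
proof -
  have lt: "p * n + k < 2 * n" if "p < 2" "k < n" for p k
    using that by (cases p) auto
  have "entry_transform \<xi> a r c lam = entry_transform \<xi> b r c lam" if "r < 2 * n" "c < 2 * n" for r c
    unfolding entry_transform_def using assms(1)[OF that] by (intro set_lebesgue_integral_cong) auto
  then show ?thesis unfolding block_transform_def using lt[OF assms(2)] lt[OF assms(3)]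
    by (intro cong_mat) auto
qed

text \<open>The half-plane is decided by the column block: the first one carries the negative
  speeds, the second one the positive speeds.\<close>

lemma block_transform_mat_transform:
  assumes os: "ordered_speeds n \<xi>" and fk: "full_kernels n \<xi> Q a"
    and mp: "measurable_potential n Q" and ed: "exp_decaying Q"
    and p: "p < 2" and q: "q = 0 \<and> sg = - 1 \<or> q = 1 \<and> sg = (1::real)"
  obtains X where "mat_transform n sg X" "\<And>lam. X (of_real lam) = block_transform n \<xi> a p q lam"
proof -
  obtain B \<delta> where B: "0 \<le> B" "0 < \<delta>"
    and le: "\<And>r c x t. r < 2 * n \<Longrightarrow> c < 2 * n \<Longrightarrow> 0 \<le> x \<Longrightarrow> x \<le> t \<Longrightarrow> norm (a r c x t) \<le> B * exp (- \<delta> * t)"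
    using full_kernels_exp_bound[OF os fk mp ed] by blast
  have "\<exists>F. half_plane_transform sg F \<and> (\<forall>lam. F (of_real lam) = entry_transform \<xi> a (p * n + k) (q * n + j) lam)"
    if kj: "k < n" "j < n" for k j
  proof -
    have r: "p * n + k < 2 * n" using p kj by (cases p) auto
    have c: "q * n + j < 2 * n" using q kj by auto
    have "\<xi> (q * n + j) = sg * \<bar>\<xi> (q * n + j)\<bar>" "0 < \<bar>\<xi> (q * n + j)\<bar>"
      using os kj q unfolding ordered_speeds_def by force+
    note \<xi> = this
    have "a (p * n + k) (q * n + j) 0 \<in> borel_measurable (lebesgue_on {0..})"
      using fk[unfolded full_kernels_def, THEN conjunct2, THEN conjunct1] r c by blast
    from half_line_integral_transform[OF this B le[OF r c order_refl] \<xi>(2), of sg]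
    obtain F where "half_plane_transform sg F" "\<And>lam. F (of_real lam) =
      (LINT t:{0..}|lebesgue. a (p * n + k) (q * n + j) 0 t * exp (\<i> * of_real (lam * (sg * \<bar>\<xi> (q * n + j)\<bar>) * t)))" by blast
    then show ?thesis unfolding entry_transform_def \<xi>(1)[symmetric] by blast
  qed
  then obtain F where F: "\<And>k j. k < n \<Longrightarrow> j < n \<Longrightarrow> half_plane_transform sg (F k j)"
    "\<And>k j lam. k < n \<Longrightarrow> j < n \<Longrightarrow> F k j (of_real lam) = entry_transform \<xi> a (p * n + k) (q * n + j) lam"
    by metis
  show thesis
  proof (rule that[of "\<lambda>z. Matrix.mat n n (\<lambda>(k, j). F k j z)"])
    show "mat_transform n sg (\<lambda>z. Matrix.mat n n (\<lambda>(k, j). F k j z))"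
      unfolding mat_transform_def using F(1) by simp
    show "Matrix.mat n n (\<lambda>(k, j). F k j (of_real lam)) = block_transform n \<xi> a p q lam" for lam
      unfolding block_transform_def using F(2) by (intro cong_mat) auto
  qed
qed

text \<open>Uniqueness replaces the existentially bound kernels inside
  \<open>scattering_matrix\<close> by the given \<open>a\<close>. The relations obtained for
  different boundary matrices then speak of the same transforms.\<close>

lemma scattering_matrix_relation:
  assumes os: "ordered_speeds n \<xi>" and fk: "full_kernels n \<xi> Q a"
    and mp: "measurable_potential n Q" and ed: "exp_decaying Q"
    and H: "H \<in> carrier_mat n n" "invertible_mat H" and S: "scattering_matrix n \<xi> Q H S"
  obtains Xp Xm where "mat_transform n 1 Xp" "mat_transform n (- 1) Xm"
    "\<And>lam. Xp (of_real lam) = block_transform n \<xi> a 1 1 lam - H * block_transform n \<xi> a 0 1 lam"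
    "\<And>lam. Xm (of_real lam) = H * block_transform n \<xi> a 0 0 lam * mat_inv H - block_transform n \<xi> a 1 0 lam * mat_inv H"
    "\<And>lam. S lam \<in> carrier_mat n n"
    "\<And>lam. (1\<^sub>m n + Xp (of_real lam)) * S lam = 1\<^sub>m n + Xm (of_real lam)"
proof -
  let ?T = "block_transform n \<xi> a"
  obtain A11 A12 A21 A22 where K: "transformation_kernels n \<xi> Q A11 A12 A21 A22"
    and inv: "\<And>lam. invertible_mat (1\<^sub>m n + A_H_plus n \<xi> H A12 A22 lam)"
    and Seq: "\<And>lam. S lam = mat_inv (1\<^sub>m n + A_H_plus n \<xi> H A12 A22 lam) * (1\<^sub>m n + A_H_minus n \<xi> H A11 A21 lam)"
    using S unfolding scattering_matrix_def by blast
  note fk' = full_kernels_block_entry[OF os K]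
  have bt: "block_transform n \<xi> (block_entry n A11 A12 A21 A22) p q lam = ?T p q lam"
    if "p < 2" "q < 2" for p q lam
    by (rule block_transform_cong[OF _ that]) (rule full_kernels_unique[OF os fk' fk mp ed], auto)
  note kt = kernel_transforms_block[OF K]
  have plus: "A_H_plus n \<xi> H A12 A22 lam = ?T 1 1 lam - H * ?T 0 1 lam" for lam
    unfolding A_H_plus_def kt by (simp add: bt)
  have minus: "A_H_minus n \<xi> H A11 A21 lam = H * ?T 0 0 lam * mat_inv H - ?T 1 0 lam * mat_inv H" for lam
    unfolding A_H_minus_def kt by (simp add: bt)
  note Hi = mat_inv_invertible(1)[OF H]
  obtain X00 where X00: "mat_transform n (- 1) X00" "\<And>lam. X00 (of_real lam) = ?T 0 0 lam"
    using block_transform_mat_transform[OF os fk mp ed, of 0 0 "- 1"] by auto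
  obtain X01 where X01: "mat_transform n 1 X01" "\<And>lam. X01 (of_real lam) = ?T 0 1 lam"
    using block_transform_mat_transform[OF os fk mp ed, of 0 1 1] by auto
  obtain X10 where X10: "mat_transform n (- 1) X10" "\<And>lam. X10 (of_real lam) = ?T 1 0 lam"
    using block_transform_mat_transform[OF os fk mp ed, of 1 0 "- 1"] by auto
  obtain X11 where X11: "mat_transform n 1 X11" "\<And>lam. X11 (of_real lam) = ?T 1 1 lam"
    using block_transform_mat_transform[OF os fk mp ed, of 1 1 1] by auto
  show thesis
  proof (rule that[of "\<lambda>z. X11 z - H * X01 z" "\<lambda>z. H * X00 z * mat_inv H - X10 z * mat_inv H"])
    show p: "mat_transform n 1 (\<lambda>z. X11 z - H * X01 z)"
      by (intro mat_transform_diff mat_transform_mult_left X11 X01 H)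
    show m: "mat_transform n (- 1) (\<lambda>z. H * X00 z * mat_inv H - X10 z * mat_inv H)"
      by (intro mat_transform_diff mat_transform_mult_left mat_transform_mult_right X00 X10 H Hi)
    fix lam :: real
    show pe: "X11 (of_real lam) - H * X01 (of_real lam) = ?T 1 1 lam - H * ?T 0 1 lam"
      unfolding X11(2) X01(2) ..
    show me: "H * X00 (of_real lam) * mat_inv H - X10 (of_real lam) * mat_inv H =
      H * ?T 0 0 lam * mat_inv H - ?T 1 0 lam * mat_inv H"
      unfolding X00(2) X10(2) ..
    let ?P = "1\<^sub>m n + (X11 (of_real lam) - H * X01 (of_real lam))" and ?M = "1\<^sub>m n + (H * X00 (of_real lam) * mat_inv H - X10 (of_real lam) * mat_inv H)"
    have P: "?P \<in> carrier_mat n n" and M: "?M \<in> carrier_mat n n"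
      using mat_transform_carrier[OF p] mat_transform_carrier[OF m] by simp_all
    have "invertible_mat ?P" using inv[of lam] unfolding plus pe .
    note Pi = mat_inv_invertible[OF P this]
    have S: "S lam = mat_inv ?P * ?M" unfolding Seq plus minus pe me ..
    show "S lam \<in> carrier_mat n n" unfolding S by (rule mult_carrier_mat[OF Pi(1) M])
    show "?P * S lam = ?M"
      unfolding S using assoc_mult_mat[OF P Pi(1) M] Pi(2) left_mult_one_mat[OF M] by simp
  qed
qed

text \<open>Subtracting the two equations leaves (H1 - H2) (Y - Y') = 0.\<close>

lemma two_boundary_conditions:
  fixes H1 H2 :: "complex mat"
  assumes H: "H1 \<in> carrier_mat n n" "H2 \<in> carrier_mat n n" "Determinant.det (H1 - H2) \<noteq> 0"
    and X: "X \<in> carrier_mat n n" "X' \<in> carrier_mat n n" and Y: "Y \<in> carrier_mat n n" "Y' \<in> carrier_mat n n"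
    and eq: "X - H1 * Y = X' - H1 * Y'" "X - H2 * Y = X' - H2 * Y'"
  shows "X = X'" "Y = Y'"
proof -
  have sub: "H * Y - H * Y' = X - X'" if "H \<in> carrier_mat n n" "X - H * Y = X' - H * Y'" for H
  proof (rule eq_matI)
    fix k j assume "k < dim_row (X - X')" "j < dim_col (X - X')"
    then have kj: "k < n" "j < n" using X by auto
    have "(X - H * Y) $$ (k, j) = (X' - H * Y') $$ (k, j)" using that(2) by simp
    then have "X $$ (k, j) - (H * Y) $$ (k, j) = X' $$ (k, j) - (H * Y') $$ (k, j)"
      using kj that(1) X Y by (simp del: index_mult_mat(1))
    then show "(H * Y - H * Y') $$ (k, j) = (X - X') $$ (k, j)"
      using kj that(1) X Y by (simp del: index_mult_mat(1) add: algebra_simps)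
  qed (use that X Y in auto)
  have HH: "H1 - H2 \<in> carrier_mat n n" using H by (intro minus_carrier_mat)
  have YY: "Y - Y' \<in> carrier_mat n n" using Y by (intro minus_carrier_mat)
  note inv = mat_inv_Units[OF HH det_non_zero_imp_unit[OF HH H(3)]]
  have "(H1 - H2) * (Y - Y') = H1 * (Y - Y') - H2 * (Y - Y')" by (rule minus_mult_distrib_mat[OF H(1,2) YY])
  also have "\<dots> = (X - X') - (X - X')"
    unfolding mult_minus_distrib_mat[OF H(1) Y] mult_minus_distrib_mat[OF H(2) Y]
      sub[OF H(1) eq(1)] sub[OF H(2) eq(2)] ..
  also have "\<dots> = 0\<^sub>m n n" using X by (auto intro!: eq_matI)
  finally have "mat_inv (H1 - H2) * ((H1 - H2) * (Y - Y')) = 0\<^sub>m n n" using inv(1) by simp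
  then have "Y - Y' = 0\<^sub>m n n" using assoc_mult_mat[OF inv(1) HH YY] inv(3) left_mult_one_mat[OF YY] by simp
  then have e: "(Y - Y') $$ (k, j) = 0" if "k < n" "j < n" for k j using that by simp
  show YY': "Y = Y'"
  proof (rule eq_matI)
    fix k j assume "k < dim_row Y'" "j < dim_col Y'"
    then show "Y $$ (k, j) = Y' $$ (k, j)" using e[of k j] Y by simp
  qed (use Y in auto)
  show "X = X'"
  proof (rule eq_matI)
    fix k j assume "k < dim_row X'" "j < dim_col X'"
    then have kj: "k < n" "j < n" using X by auto
    have "(X - H1 * Y) $$ (k, j) = (X' - H1 * Y) $$ (k, j)" using eq(1) YY' by simp
    then show "X $$ (k, j) = X' $$ (k, j)" using kj X Y H by (simp del: index_mult_mat(1))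
  qed (use X in auto)
qed

text \<open>Multiplication by H from the right brings the lower relation into the shape X - H Y of
  the upper one, so a single elimination serves both.\<close>

lemma minus_relation_cancel_inverse:
  fixes H :: "complex mat"
  assumes H: "H \<in> carrier_mat n n" "invertible_mat H"
    and X: "X \<in> carrier_mat n n" "X' \<in> carrier_mat n n" and Y: "Y \<in> carrier_mat n n" "Y' \<in> carrier_mat n n"
    and eq: "H * X * mat_inv H - Y * mat_inv H = H * X' * mat_inv H - Y' * mat_inv H"
  shows "Y - H * X = Y' - H * X'"
proof -
  note inv = mat_inv_invertible[OF H]
  have c: "(H * X * mat_inv H - Y * mat_inv H) * H = H * X - Y" if "X \<in> carrier_mat n n" "Y \<in> carrier_mat n n" for X Y
  proof -
    have HX: "H * X \<in> carrier_mat n n" using H that by simp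
    have "(H * X * mat_inv H - Y * mat_inv H) * H = H * X * mat_inv H * H - Y * mat_inv H * H"
      by (rule minus_mult_distrib_mat[OF mult_carrier_mat[OF HX inv(1)] mult_carrier_mat[OF that(2) inv(1)] H(1)])
    then show ?thesis
      using assoc_mult_mat[OF HX inv(1) H(1)] assoc_mult_mat[OF that(2) inv(1) H(1)] inv(3)
        right_mult_one_mat[OF HX] right_mult_one_mat[OF that(2)] by simp
  qed
  have "H * X - Y = H * X' - Y'" using eq c[OF X(1) Y(1)] c[OF X(2) Y(2)] by simp
  then have e: "(H * X - Y) $$ (k, j) = (H * X' - Y') $$ (k, j)" for k j by simp
  show ?thesis
  proof (rule eq_matI)
    fix k j assume "k < dim_row (Y' - H * X')" "j < dim_col (Y' - H * X')"
    then have kj: "k < n" "j < n" using H X by auto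
    have "(H * X) $$ (k, j) - Y $$ (k, j) = (H * X') $$ (k, j) - Y' $$ (k, j)"
      using e[of k j] kj X Y H by (simp del: index_mult_mat(1))
    then show "(Y - H * X) $$ (k, j) = (Y' - H * X') $$ (k, j)"
      using kj X Y H by (simp del: index_mult_mat(1) add: algebra_simps)
  qed (use X Y H in auto)
qed

section \<open>Recovery of the kernels and of the potential\<close>

lemma M_canonical_zero:
  assumes "M_canonical n Q" "r < 2 * n" "c < 2 * n" "0 \<le> s" and rc: "r = c \<or> \<not> level n c \<le> level n r"
  shows "Q s $$ (r, c) = 0"
proof -
  have Q: "strictly_lower_tri n (q11 n Q s)" "lower_anti_tri n (q12 n Q s)"
    "upper_anti_tri n (q21 n Q s)" "strictly_upper_tri n (q22 n Q s)"
    using assms(1,4) unfolding M_canonical_def by auto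
  have b: "block n p q (Q s) $$ (k, j) = Q s $$ (p * n + k, q * n + j)" if "k < n" "j < n" for p q k j
    using that by (simp add: block_def)
  \<comment> \<open>A position with r = c lies in one of the diagonal blocks, whose triangles are
    strict.\<close>
  have "(r < n \<and> c < n \<and> r \<le> c) \<or> (r < n \<and> n \<le> c \<and> Suc r + Suc (c - n) \<le> n)
      \<or> (n \<le> r \<and> c < n \<and> n + 2 \<le> Suc (r - n) + Suc c) \<or> (n \<le> r \<and> n \<le> c \<and> c - n \<le> r - n)"
    using rc assms(2,3) unfolding level_def by (cases "r < n"; cases "c < n") auto
  then show ?thesis
  proof (elim disjE conjE, goal_cases)
    case 1
    then show ?thesis using Q(1) b[of r c 0 0] unfolding strictly_lower_tri_def by simp
  next
    case 2
    then show ?thesis using Q(2) b[of r "c - n" 0 1] assms(3) unfolding lower_anti_tri_def by simp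
  next
    case 3
    then show ?thesis using Q(3) b[of "r - n" c 1 0] assms(2) unfolding upper_anti_tri_def by simp
  next
    case 4
    then show ?thesis using Q(4) b[of "r - n" "c - n" 1 1] assms(2,3) unfolding strictly_upper_tri_def by simp
  qed
qed

lemma potential_bound:
  assumes "measurable_potential n Q" "exp_decaying Q"
  obtains C where "0 \<le> C"
    "\<And>r c x. r < 2 * n \<Longrightarrow> c < 2 * n \<Longrightarrow> 0 \<le> x \<Longrightarrow> norm (Q x $$ (r, c)) \<le> C"
proof -
  obtain C \<epsilon> where C: "0 < C" "0 < \<epsilon>"
    and Q: "\<And>r c x. r < 2 * n \<Longrightarrow> c < 2 * n \<Longrightarrow> 0 \<le> x \<Longrightarrow> norm (Q x $$ (r, c)) \<le> C * exp (- \<epsilon> * x)"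
    using potential_exp_bound[OF assms] by blast
  have "norm (Q x $$ (r, c)) \<le> C" if "r < 2 * n" "c < 2 * n" "0 \<le> x" for r c x
  proof -
    have "C * exp (- \<epsilon> * x) \<le> C" using C that by (intro mult_left_le) auto
    then show ?thesis using Q[OF that] by simp
  qed
  then show thesis using that[of C] C by simp
qed

lemma kernels_determine_potential:
  assumes os: "ordered_speeds n \<xi>" and fk: "full_kernels n \<xi> Q a" and fk': "full_kernels n \<xi> Q' a'"
    and mp: "measurable_potential n Q" "measurable_potential n Q'"
    and ed: "exp_decaying Q" "exp_decaying Q'" and mc: "M_canonical n Q" "M_canonical n Q'"
    and eq: "\<And>r c. r < 2 * n \<Longrightarrow> c < 2 * n \<Longrightarrow> AE t in lebesgue. 0 \<le> t \<longrightarrow> a r c 0 t = a' r c 0 t"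
  shows "AE x in lebesgue_on {0..}. Q' x = Q x"
proof -
  obtain C1 where C1: "0 \<le> C1" "\<And>r c x. r < 2 * n \<Longrightarrow> c < 2 * n \<Longrightarrow> 0 \<le> x \<Longrightarrow> norm (Q x $$ (r, c)) \<le> C1"
    using potential_bound[OF mp(1) ed(1)] by blast
  obtain C2 where C2: "0 \<le> C2" "\<And>r c x. r < 2 * n \<Longrightarrow> c < 2 * n \<Longrightarrow> 0 \<le> x \<Longrightarrow> norm (Q' x $$ (r, c)) \<le> C2"
    using potential_bound[OF mp(2) ed(2)] by blast
  obtain M1 where M1: "0 \<le> M1"
    "\<And>r c x t. r < 2 * n \<Longrightarrow> c < 2 * n \<Longrightarrow> 0 \<le> x \<Longrightarrow> x \<le> t \<Longrightarrow> norm (a r c x t) \<le> M1"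
    by (rule full_kernels_bounded[OF fk]) (rule that)
  obtain M2 where M2: "0 \<le> M2"
    "\<And>r c x t. r < 2 * n \<Longrightarrow> c < 2 * n \<Longrightarrow> 0 \<le> x \<Longrightarrow> x \<le> t \<Longrightarrow> norm (a' r c x t) \<le> M2"
    by (rule full_kernels_bounded[OF fk']) (rule that)
  obtain L where L: "0 \<le> L" "\<And>r c. r < 2 * n \<Longrightarrow> c < 2 * n \<Longrightarrow> 1 - \<xi> r / \<xi> c \<le> L"
    using finite_double_bound[of "2 * n" "\<lambda>r c. 1 - \<xi> r / \<xi> c"] by blast
  interpret kernel_pair n \<xi> Q Q' a a' "max C1 C2" "max M1 M2" "max L 1"
  proof unfold_locales
    show "norm (Q s $$ (r, c)) \<le> max C1 C2" "norm (Q' s $$ (r, c)) \<le> max C1 C2"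
      if "r < 2 * n" "c < 2 * n" "0 \<le> s" for r c s
      using C1(2)[OF that] C2(2)[OF that] by simp_all
    show "norm (a r c x t) \<le> max M1 M2" "norm (a' r c x t) \<le> max M1 M2"
      if "r < 2 * n" "c < 2 * n" "0 \<le> x" "x \<le> t" for r c x t
      using M1(2)[OF that] M2(2)[OF that] by simp_all
    show "1 - \<xi> r / \<xi> c \<le> max L 1" if "r < 2 * n" "c < 2 * n" for r c
      using L(2)[OF that] by simp
    show "Q s $$ (r, c) = 0" "Q' s $$ (r, c) = 0"
      if "r < 2 * n" "c < 2 * n" "0 \<le> s" "r = c \<or> \<not> level n c \<le> level n r" for r c s
      using M_canonical_zero[OF mc(1) that] M_canonical_zero[OF mc(2) that] .
    show "0 \<le> max C1 C2" "0 \<le> max M1 M2" "1 \<le> max L 1" using C1(1) M1(1) by simp_all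
  qed (fact os fk fk' eq)+
  have "AE x in lebesgue. \<forall>r\<in>{..<2*n}. \<forall>c\<in>{..<2*n}. 0 \<le> x \<longrightarrow> Q x $$ (r, c) = Q' x $$ (r, c)"
    by (intro AE_finite_allI finite_lessThan potentials_AE_eq) auto
  then have "AE x in lebesgue. x \<in> {0..} \<longrightarrow> Q' x = Q x"
  proof (eventually_elim, intro impI)
    fix x :: real
    assume e: "\<forall>r\<in>{..<2*n}. \<forall>c\<in>{..<2*n}. 0 \<le> x \<longrightarrow> Q x $$ (r, c) = Q' x $$ (r, c)" and "x \<in> {0..}"
    then have x: "0 \<le> x" by simp
    have car: "Q x \<in> carrier_mat (2 * n) (2 * n)" "Q' x \<in> carrier_mat (2 * n) (2 * n)"
      using mp x unfolding measurable_potential_def by blast+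
    show "Q' x = Q x"
      using e x car by (intro eq_matI) auto
  qed
  then show ?thesis by (subst AE_restrict_space_iff) auto
qed

lemma block_transforms_determine_kernels:
  assumes os: "ordered_speeds n \<xi>" and fk: "full_kernels n \<xi> Q a" and fk': "full_kernels n \<xi> Q' a'"
    and mp: "measurable_potential n Q" "measurable_potential n Q'"
    and ed: "exp_decaying Q" "exp_decaying Q'"
    and eq: "\<And>p q lam. p < 2 \<Longrightarrow> q < 2 \<Longrightarrow> block_transform n \<xi> a p q lam = block_transform n \<xi> a' p q lam"
    and rc: "r < 2 * n" "c < 2 * n"
  shows "AE t in lebesgue. 0 \<le> t \<longrightarrow> a r c 0 t = a' r c 0 t"
proof -
  obtain B \<delta> where B: "0 \<le> B" "0 < \<delta>"
    and le: "\<And>r c x t. r < 2 * n \<Longrightarrow> c < 2 * n \<Longrightarrow> 0 \<le> x \<Longrightarrow> x \<le> t \<Longrightarrow> norm (a r c x t) \<le> B * exp (- \<delta> * t)"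
    using full_kernels_exp_bound[OF os fk mp(1) ed(1)] by blast
  obtain B' \<delta>' where B': "0 \<le> B'" "0 < \<delta>'"
    and le': "\<And>r c x t. r < 2 * n \<Longrightarrow> c < 2 * n \<Longrightarrow> 0 \<le> x \<Longrightarrow> x \<le> t \<Longrightarrow> norm (a' r c x t) \<le> B' * exp (- \<delta>' * t)"
    using full_kernels_exp_bound[OF os fk' mp(2) ed(2)] by blast
  have meas: "a r c 0 \<in> borel_measurable (lebesgue_on {0..})" "a' r c 0 \<in> borel_measurable (lebesgue_on {0..})"
    using fk[unfolded full_kernels_def, THEN conjunct2, THEN conjunct1] fk'[unfolded full_kernels_def, THEN conjunct2, THEN conjunct1] rc by blast+
  have n: "0 < n" using rc by simp
  have dm: "p div n < 2" "p mod n < n" "p div n * n + p mod n = p" if "p < 2 * n" for p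
    using that n by (simp_all add: less_mult_imp_div_less)
  have "entry_transform \<xi> a r c lam = entry_transform \<xi> a' r c lam" for lam
    using arg_cong[OF eq[OF dm(1)[OF rc(1)] dm(1)[OF rc(2)], of lam], of "\<lambda>X. X $$ (r mod n, c mod n)"]
    unfolding block_transform_def using dm[OF rc(1)] dm[OF rc(2)] by simp
  note eq' = this[unfolded entry_transform_def]
  show ?thesis
  proof (rule half_line_integral_unique[OF meas(1) B _ meas(2) B'])
    show "norm (a r c 0 t) \<le> B * exp (- \<delta> * t)" "norm (a' r c 0 t) \<le> B' * exp (- \<delta>' * t)" if "0 \<le> t" for t
      using le[OF rc order_refl that] le'[OF rc order_refl that] .
    show "\<xi> c \<noteq> 0" by (rule speed_ratio(1)[OF os rc(2,2) order_refl])
  qed (rule eq')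
qed

theorem theorem2:
  fixes n :: nat and \<xi> :: "nat \<Rightarrow> real"
    and Q Q' :: "real \<Rightarrow> complex mat"
    and H1 H2 :: "complex mat"
    and S1 S2 :: "real \<Rightarrow> complex mat"
  assumes "n \<ge> 1" and "ordered_speeds n \<xi>"
    and "measurable_potential n Q" and "M_canonical n Q" and "exp_decaying Q"
    and "H1 \<in> carrier_mat n n" and "invertible_mat H1"
    and "H2 \<in> carrier_mat n n" and "invertible_mat H2"
    and "Determinant.det (H1 - H2) \<noteq> 0"
    and "scattering_matrix n \<xi> Q H1 S1" and "scattering_matrix n \<xi> Q H2 S2"
    and "rh_uniquely_solvable n S1" and "rh_uniquely_solvable n S2"
    and "measurable_potential n Q'" and "M_canonical n Q'" and "exp_decaying Q'"
    and "scattering_matrix n \<xi> Q' H1 S1" and "scattering_matrix n \<xi> Q' H2 S2"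
  shows "AE x in lebesgue_on {0..}. Q' x = Q x"
proof -
  note os = assms(2) and Q = assms(3,5) and Q' = assms(15,17)
  \<comment> \<open>Existence of kernels is read off from the scattering matrices for
    \<open>H1\<close>; those for \<open>H2\<close> are referred to the same kernels by
    uniqueness.\<close>
  have "\<exists>a. full_kernels n \<xi> P a" if "scattering_matrix n \<xi> P H1 S1" for P
    using that full_kernels_block_entry[OF os] unfolding scattering_matrix_def by blast
  then obtain a a' where fk: "full_kernels n \<xi> Q a" and fk': "full_kernels n \<xi> Q' a'"
    using assms(11,18) by blast
  let ?T = "block_transform n \<xi> a" and ?T' = "block_transform n \<xi> a'"
  have same: "?T 1 1 lam - H * ?T 0 1 lam = ?T' 1 1 lam - H * ?T' 0 1 lam \<and>
      ?T 1 0 lam - H * ?T 0 0 lam = ?T' 1 0 lam - H * ?T' 0 0 lam"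
    if H: "H \<in> carrier_mat n n" "invertible_mat H" and S: "scattering_matrix n \<xi> Q H S"
      "scattering_matrix n \<xi> Q' H S" and rh: "rh_uniquely_solvable n S" for H S lam
  proof -
    obtain Xp Xm where X: "mat_transform n 1 Xp" "mat_transform n (- 1) Xm"
      "\<And>lam. Xp (of_real lam) = ?T 1 1 lam - H * ?T 0 1 lam"
      "\<And>lam. Xm (of_real lam) = H * ?T 0 0 lam * mat_inv H - ?T 1 0 lam * mat_inv H"
      "\<And>lam. S lam \<in> carrier_mat n n"
      "\<And>lam. (1\<^sub>m n + Xp (of_real lam)) * S lam = 1\<^sub>m n + Xm (of_real lam)"
      by (rule scattering_matrix_relation[OF os fk Q H S(1)]) (rule that)
    obtain Yp Ym where Y: "mat_transform n 1 Yp" "mat_transform n (- 1) Ym"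
      "\<And>lam. Yp (of_real lam) = ?T' 1 1 lam - H * ?T' 0 1 lam"
      "\<And>lam. Ym (of_real lam) = H * ?T' 0 0 lam * mat_inv H - ?T' 1 0 lam * mat_inv H"
      "\<And>lam. S lam \<in> carrier_mat n n"
      "\<And>lam. (1\<^sub>m n + Yp (of_real lam)) * S lam = 1\<^sub>m n + Ym (of_real lam)"
      by (rule scattering_matrix_relation[OF os fk' Q' H S(2)]) (rule that)
    note u = rh_transform_unique[OF Y(1,2) X(1,2,5) Y(6) X(6) rh, of lam]
    show ?thesis
      using u(1) minus_relation_cancel_inverse[OF H block_transform_carrier block_transform_carrier
          block_transform_carrier block_transform_carrier u(2)[unfolded X(4) Y(4)]]
      unfolding X(3) Y(3) by simp
  qed
  note s1 = same[OF assms(6,7,11,18,13)] and s2 = same[OF assms(8,9,12,19,14)]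
  note bc = two_boundary_conditions[OF assms(6,8,10) block_transform_carrier block_transform_carrier
      block_transform_carrier block_transform_carrier]
  \<comment> \<open>The upper relations yield the transforms of the second column block, the lower
    relations those of the first.\<close>
  note plus = bc[OF s1[THEN conjunct1] s2[THEN conjunct1]] and minus = bc[OF s1[THEN conjunct2] s2[THEN conjunct2]]
  have "?T p q lam = ?T' p q lam" if "p < 2" "q < 2" for p q lam
  proof -
    have "p = 0 \<or> p = 1" "q = 0 \<or> q = 1" using that by auto
    then show ?thesis using plus minus by auto
  qed
  from block_transforms_determine_kernels[OF os fk fk' Q(1) Q'(1) Q(2) Q'(2) this]
  show ?thesis by (rule kernels_determine_potential[OF os fk fk' Q(1) Q'(1) Q(2) Q'(2) assms(4,16)])
qed

end
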